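(* The following two assertions are equivalent. (i) For every integer $r\ge 2$ and all graphs $H_1,\dots,H_r$ with $m_2(H_1)\ge m_2(H_2)\ge\dots\ge m_2(H_r)$ and $m_2(H_2)>1$, there exists a constant $c>0$ such that $\lim_{n\to\infty}\Pr\big(G_{n,p}\text{ is Ramsey for }(H_1,\dots,H_r)\big)=0$ for every $p=p(n)\le c\,n^{-1/m_2(H_1,H_2)}$. (ii) For every strictly balanced pair $(H_1,H_2)$ of graphs with $m_2(H_1)\ge m_2(H_2)>1$, every graph $G$ that is Ramsey for $(H_1,H_2)$ satisfies $m(G)>m_2(H_1,H_2)$.
   Context: For a graph $J$, $v_J$ and $e_J$ denote its numbers of vertices and edges. The maximal density is $m(G)=\max\{e_J/v_J : J\subseteq G,\ v_J\ge 1\}$. The maximal $2$-density is $m_2(H)=\max\{(e_J-1)/(v_J-2): J\subseteq H,\ v_J\ge 3\}$ for a graph $H$ with at least one edge and $v_H\ge 3$; also $m_2(K_2)=1/2$ and $m_2(H)=0$ if $H$ has no edges. For graphs $H_1,H_2$ with $m_2(H_2)>0$, the mixed $2$-density is $m_2(H_1,H_2)=\max\{e_J/(v_J-2+1/m_2(H_2)) : J\subseteq H_1,\ v_J\ge 2\}$. A graph $H_2$ is strictly $2$-balanced if $m_2(H')<m_2(H_2)$ for every proper subgraph $H'\subsetneq H_2$; a graph $H_1$ is strictly $m_2(\cdot,H_2)$-balanced if $m_2(H',H_2)<m_2(H_1,H_2)$ for every proper subgraph $H'\subsetneq H_1$. The pair $(H_1,H_2)$ is strictly balanced if $H_2$ is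 strictly $2$-balanced and $H_1$ is strictly $m_2(\cdot,H_2)$-balanced. A graph $G$ is Ramsey for $(H_1,\dots,H_r)$ if every $r$-coloring of $E(G)$ contains, for some $i\in\{1,\dots,r\}$, a copy of $H_i$ all of whose edges have color $i$. $G_{n,p}$ is the binomial random graph on $n$ vertices with edge probability $p$.
   Formalization: In (i) every graph H_1,…,H_r is additionally required to have at least one edge; with an edgeless H_i (i ≥ 3) every G_{n,p} with n ≥ v(H_i) is vacuously Ramsey, so (i) as worded would fail although (ii) holds. *)

theory Defs
  imports "HOL-Probability.Probability"
begin

datatype 'a graph = Graph (verts: "'a set") (edges: "'a set set")

definition simple_graph :: "'a graph \<Rightarrow> bool" where
  "simple_graph G \<longleftrightarrow>
     finite (verts G) \<and> (\<forall>e\<in>edges G. e \<subseteq> verts G \<and> card e = 2)"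

definition num_verts :: "'a graph \<Rightarrow> nat" where
  "num_verts G = card (verts G)"

definition num_edges :: "'a graph \<Rightarrow> nat" where
  "num_edges G = card (edges G)"

text \<open>Subgraphs are not necessarily induced or spanning; the graph without vertices is allowed.\<close>

definition subgraph :: "'a graph \<Rightarrow> 'a graph \<Rightarrow> bool" where
  "subgraph J G \<longleftrightarrow> simple_graph J \<and> verts J \<subseteq> verts G \<and> edges J \<subseteq> edges G"

definition proper_subgraph :: "'a graph \<Rightarrow> 'a graph \<Rightarrow> bool" where
  "proper_subgraph J G \<longleftrightarrow> subgraph J G \<and> J \<noteq> G"

definition isomorphic :: "'a graph \<Rightarrow> 'b graph \<Rightarrow> bool" where
  "isomorphic J H \<longleftrightarrow>
     (\<exists>f. bij_betw f (verts J) (verts H) \<and> (\<lambda>e. f ` e) ` edges J = edges H)"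

text \<open>The maximal density; the value 0 for the graph without vertices is a convention.\<close>

definition max_density :: "'a graph \<Rightarrow> real" where
  "max_density G =
     (if verts G = {} then 0
      else Max {real (num_edges J) / real (num_verts J) | J.
                 subgraph J G \<and> num_verts J \<ge> 1})"

text \<open>The maximal 2-density. A simple graph with an edge and exactly two vertices is a
  single edge, so the second case is the one of \<open>K\<^sub>2\<close>.\<close>

definition m2 :: "'a graph \<Rightarrow> real" where
  "m2 H =
     (if edges H = {} then 0
      else if num_verts H = 2 then 1 / 2
      else Max {(real (num_edges J) - 1) / (real (num_verts J) - 2) | J.
                 subgraph J H \<and> num_verts J \<ge> 3})"

text \<open>The mixed 2-density, meant for \<open>m2 H2 > 0\<close>. If \<open>H1\<close> has fewer than two vertices,
  the maximum ranges over the empty set and the value is 0 by convention.\<close>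

definition mixed_m2 :: "'a graph \<Rightarrow> 'b graph \<Rightarrow> real" where
  "mixed_m2 H1 H2 =
     (if num_verts H1 < 2 then 0
      else Max {real (num_edges J) / (real (num_verts J) - 2 + 1 / m2 H2) | J.
                 subgraph J H1 \<and> num_verts J \<ge> 2})"

definition strictly_2_balanced :: "'a graph \<Rightarrow> bool" where
  "strictly_2_balanced H \<longleftrightarrow> (\<forall>H'. proper_subgraph H' H \<longrightarrow> m2 H' < m2 H)"

definition strictly_mixed_balanced :: "'a graph \<Rightarrow> 'b graph \<Rightarrow> bool" where
  "strictly_mixed_balanced H1 H2 \<longleftrightarrow>
     (\<forall>H'. proper_subgraph H' H1 \<longrightarrow> mixed_m2 H' H2 < mixed_m2 H1 H2)"

definition strictly_balanced_pair :: "'a graph \<Rightarrow> 'b graph \<Rightarrow> bool" where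
  "strictly_balanced_pair H1 H2 \<longleftrightarrow>
     strictly_2_balanced H2 \<and> strictly_mixed_balanced H1 H2"

text \<open>The colours are the positions \<open>0, \<dots>, r - 1\<close> of the list \<open>Hs\<close> of length \<open>r\<close>. A copy
  of \<open>H\<close> in \<open>G\<close> is a (not necessarily induced) subgraph of \<open>G\<close> isomorphic to \<open>H\<close>. In
  particular, an edgeless \<open>H\<close> has a copy in every colour of every colouring as soon as \<open>G\<close>
  has at least as many vertices as \<open>H\<close>.\<close>

definition ramsey_for :: "'a graph \<Rightarrow> 'b graph list \<Rightarrow> bool" where
  "ramsey_for G Hs \<longleftrightarrow>
     (\<forall>\<phi> :: 'a set \<Rightarrow> nat. (\<forall>e\<in>edges G. \<phi> e < length Hs) \<longrightarrow>
        (\<exists>i<length Hs. \<exists>J. subgraph J G \<and> isomorphic J (Hs ! i) \<and> (\<forall>e\<in>edges J. \<phi> e = i)))"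

definition all_pairs :: "nat \<Rightarrow> nat set set" where
  "all_pairs n = {e. e \<subseteq> {1..n} \<and> card e = 2}"

text \<open>The binomial random graph on \<open>{1..n}\<close>: independent indicators for all pairs. Only
  meaningful for \<open>0 \<le> p \<le> 1\<close>.\<close>

definition gnp :: "nat \<Rightarrow> real \<Rightarrow> nat graph pmf" where
  "gnp n p =
     map_pmf (\<lambda>X. Graph {1..n} {e \<in> all_pairs n. X e})
       (Pi_pmf (all_pairs n) False (\<lambda>_. bernoulli_pmf p))"

end

theory Submission
  imports Defs "HOL-Real_Asymp.Real_Asymp"
begin

text \<open>
  If \<open>G\<close> is Ramsey for the pair and \<open>max_density G\<close> is at most the mixed 2-density, then the second
  moment method shows that the random graph at the threshold contains \<open>G\<close>, hence is Ramsey, with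
  probability bounded away from 0.

  Conversely, colour only with the first two colours and pass to strictly balanced subgraphs. A
  Ramsey graph contains a core: a minimal pair of families of copies of \<open>H\<^sub>1\<close> and \<open>H\<^sub>2\<close> that cannot
  be avoided, so that every edge of a copy of one graph is its intersection with a copy of the
  other. Measure an edge set \<open>E\<close> with vertex set \<open>V\<close> by \<open>\<bar>V\<bar> - \<bar>E\<bar> / m\<close>, the exponent of its expected
  number of copies. Explore the core by attaching a copy \<open>B\<close> of \<open>H\<^sub>2\<close> together with copies of \<open>H\<^sub>1\<close>
  on its new edges. Balancedness implies that the weight never increases, and that it drops by a
  fixed amount unless all the attached pieces are disjoint; such a regular step creates new places
  where the exploration has to go on. So a core either has bounded size, or it yields
  logarithmically many regular steps, or boundedly many degenerate steps of large total loss; the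
  last two are excluded by a first moment bound. Cores of bounded size are excluded by the
  deterministic statement since a bounded subgraph of the random graph has density at most \<open>m\<close>.

  If \<open>m2 H\<^sub>1 = m2 H\<^sub>2 = x\<close>, a single edge already attains the mixed 2-density, so no strictly
  balanced pair is available, and the deterministic statement is replaced by a proof that graphs of
  density at most \<open>x\<close> are not Ramsey.
\<close>


section \<open>Weights of edge sets and cores\<close>

text \<open>The common value \<theta> = 2 - 1/x makes the two densities fit together. It is the
  weight at x of a single edge and of H2, and since m = e/(v - 2 + 1/x) for the balanced H1, it is
  also the weight of H1 at m. Hence a copy of H1 hanging from an edge of a copy B of H2 acts like an
  edge of cost 1/x, and a regular attachment of B changes the weight by 0: the expected number of
  its outcomes is a constant times c, with no power of n to gain. The decay over regular steps
  therefore has to come from the small constant c, which tolerates only boundedly many choices per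
  step. This is why the exploration keeps a queue: the next step attaches at a prescribed edge, so
  the number of choices does not grow with the explored set. A regular step lengthens the queue by
  one and a degenerate step shortens it by a bounded amount. So the queue can be empty, which forces
  a choice among all explored vertices, only after a number of steps bounded in terms of the number
  of degenerate ones. A degenerate step may attach anywhere, because its gain of a fixed power of n
  beats all powers of log n.\<close>

definition edge_set :: "'a set set \<Rightarrow> bool" where
  "edge_set E \<longleftrightarrow> finite E \<and> (\<forall>e\<in>E. card e = 2)"

definition wt :: "real \<Rightarrow> 'a set set \<Rightarrow> real" where
  "wt \<mu> E = real (card (\<Union>E)) - real (card E) / \<mu>"

text \<open>With \<theta> = 2 - 1/x this encodes both notions of strict balancedness after clearing
  denominators: (e - 1)/(v - 2) < x reads wt x > \<theta>, and e/(v - 2 + 1/x) < m reads wt m >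
  \<theta>. A single edge has weight exactly \<theta> at x, hence the gap \<epsilon> is demanded
  only of proper parts with at least two edges.\<close>

definition balanced :: "real \<Rightarrow> real \<Rightarrow> real \<Rightarrow> 'a set set \<Rightarrow> bool" where
  "balanced \<mu> \<theta> \<epsilon> E \<longleftrightarrow> edge_set E \<and> 2 \<le> card E \<and> wt \<mu> E = \<theta> \<and>
     (\<forall>J\<subseteq>E. J \<noteq> {} \<longrightarrow> \<theta> \<le> wt \<mu> J) \<and>
     (\<forall>J. J \<subset> E \<and> 2 \<le> card J \<longrightarrow> \<theta> + \<epsilon> \<le> wt \<mu> J)"

lemma edge_set_Union_finite: "edge_set E \<Longrightarrow> finite (\<Union>E)"
  unfolding edge_set_def by (metis card.infinite finite_Union zero_neq_numeral)

lemma edge_set_subset: "edge_set E \<Longrightarrow> J \<subseteq> E \<Longrightarrow> edge_set J"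
  unfolding edge_set_def by (meson finite_subset subsetD)

lemma edge_set_Un: "edge_set E \<Longrightarrow> edge_set J \<Longrightarrow> edge_set (E \<union> J)"
  unfolding edge_set_def by auto

lemma edge_set_UN: "finite I \<Longrightarrow> (\<And>i. i \<in> I \<Longrightarrow> edge_set (f i)) \<Longrightarrow> edge_set (\<Union>i\<in>I. f i)"
  unfolding edge_set_def by auto

lemma wt_Un:
  assumes "edge_set Y" "edge_set A"
  shows "wt \<mu> (Y \<union> A) = wt \<mu> Y + wt \<mu> A - (real (card (\<Union>Y \<inter> \<Union>A)) - real (card (Y \<inter> A)) / \<mu>)"
proof -
  have "card (\<Union>Y) + card (\<Union>A) = card (\<Union>(Y \<union> A)) + card (\<Union>Y \<inter> \<Union>A)"
    using card_Un_Int[of "\<Union>Y" "\<Union>A"] assms by (simp add: edge_set_Union_finite)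
  moreover have "card Y + card A = card (Y \<union> A) + card (Y \<inter> A)"
    using card_Un_Int[of Y A] assms by (simp add: edge_set_def)
  hence "real (card (Y \<union> A)) = real (card Y) + real (card A) - real (card (Y \<inter> A))" by linarith
  hence "real (card (Y \<union> A)) / \<mu> = real (card Y) / \<mu> + real (card A) / \<mu> - real (card (Y \<inter> A)) / \<mu>"
    by (simp add: add_divide_distrib diff_divide_distrib)
  ultimately show ?thesis unfolding wt_def by linarith
qed

lemma card_Union_ge_3:
  assumes "edge_set J" "2 \<le> card J"
  shows "3 \<le> card (\<Union>J)"
proof (rule ccontr)
  assume "\<not> 3 \<le> card (\<Union>J)"
  hence le: "card (\<Union>J) \<le> 2" by simp
  have fin: "finite (\<Union>J)" using assms edge_set_Union_finite by auto
  have "e = \<Union>J" if "e \<in> J" for e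
    by (rule card_seteq) (use that fin le assms in \<open>auto simp: edge_set_def\<close>)
  hence "J \<subseteq> {\<Union>J}" by auto
  hence "card J \<le> card {\<Union>J}" by (intro card_mono) auto
  thus False using assms by simp
qed

lemma balancedD:
  assumes "balanced \<mu> \<theta> \<epsilon> E"
  shows "edge_set E" "finite E" "2 \<le> card E" "E \<noteq> {}" "wt \<mu> E = \<theta>"
    "\<And>J. J \<subseteq> E \<Longrightarrow> J \<noteq> {} \<Longrightarrow> \<theta> \<le> wt \<mu> J"
    "\<And>J. J \<subset> E \<Longrightarrow> 2 \<le> card J \<Longrightarrow> \<theta> + \<epsilon> \<le> wt \<mu> J"
  using assms unfolding balanced_def edge_set_def by auto

text \<open>If g were the only edge at u, deleting it would remove a vertex and an edge and change
  the weight by at most -1 + 1/x < 0, below the minimum \<theta>.\<close>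

lemma balanced_second_edge:
  assumes "balanced x \<theta> \<epsilon> B" "x > 1" "g \<in> B" "u \<in> g"
  shows "\<exists>h\<in>B. h \<noteq> g \<and> u \<in> h"
proof (rule ccontr)
  assume neg: "\<not> ?thesis"
  note B = balancedD[OF assms(1)]
  let ?J = "B - {g}"
  have c: "card ?J = card B - 1" using assms B by simp
  have "card ?J > 0" using c B(3) by linarith
  hence ne: "?J \<noteq> {}" by (metis card.empty less_irrefl)
  have "\<Union>?J \<subseteq> \<Union>B - {u}" using neg by auto
  hence "card (\<Union>?J) \<le> card (\<Union>B - {u})"
    by (intro card_mono) (use edge_set_Union_finite[OF B(1)] in auto)
  also have "\<dots> = card (\<Union>B) - 1" using assms by (intro card_Diff_singleton) auto
  finally have "card (\<Union>?J) \<le> card (\<Union>B) - 1" .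
  moreover have "card (\<Union>B) > 0" using assms B edge_set_Union_finite[of B] by (auto simp: card_gt_0_iff)
  ultimately have 1: "real (card (\<Union>?J)) \<le> real (card (\<Union>B)) - 1" by linarith
  have "real (card ?J) = real (card B) - 1" using c B by linarith
  hence 2: "real (card ?J) / x = real (card B) / x - 1 / x" by (simp add: diff_divide_distrib)
  have "1 / x < 1" using assms by simp
  hence "wt x ?J < wt x B" unfolding wt_def using 1 2 by linarith
  thus False using B(5) B(6)[of ?J] ne by auto
qed

locale core =
  fixes F1 F2 :: "'a set set set" and m x \<theta> \<epsilon> :: real
  assumes fin1: "finite F1" and fin2: "finite F2"
    and bal1: "A \<in> F1 \<Longrightarrow> balanced m \<theta> \<epsilon> A"
    and bal2: "B \<in> F2 \<Longrightarrow> balanced x \<theta> \<epsilon> B"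
    and x1: "1 < x" and xm: "x \<le> m" and theta: "\<theta> = 2 - 1 / x" and eps: "0 < \<epsilon>" "\<epsilon> \<le> 1"
    and cover1: "A \<in> F1 \<Longrightarrow> e \<in> A \<Longrightarrow> \<exists>B\<in>F2. A \<inter> B = {e}"
    and cover2: "B \<in> F2 \<Longrightarrow> e \<in> B \<Longrightarrow> \<exists>A\<in>F1. A \<inter> B = {e}"
    and conn: "S \<noteq> {} \<Longrightarrow> S \<subset> \<Union>(F1 \<union> F2) \<Longrightarrow> \<exists>M\<in>F1 \<union> F2. M \<inter> S \<noteq> {} \<and> \<not> M \<subseteq> S"
begin

section \<open>Weight changes when copies are attached\<close>

lemma inv_le: "1 / m \<le> 1 / x" using x1 xm by (simp add: frac_le)

text \<open>The shared edges form a nonempty part of A, so they already carry weight \<theta>, which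
  is all that A contributes; common vertices outside the shared edges only lower the result.\<close>

lemma attach_le:
  assumes "A \<in> F1" "edge_set Y" "A \<inter> Y \<noteq> {}"
  shows "wt m (Y \<union> A) \<le> wt m Y"
proof -
  note A = balancedD[OF bal1[OF assms(1)]]
  have "\<theta> \<le> wt m (Y \<inter> A)" using A(6)[of "Y \<inter> A"] assms by auto
  moreover have "card (\<Union>(Y \<inter> A)) \<le> card (\<Union>Y \<inter> \<Union>A)"
    by (intro card_mono) (use A assms edge_set_Union_finite in auto)
  ultimately have "\<theta> \<le> real (card (\<Union>Y \<inter> \<Union>A)) - real (card (Y \<inter> A)) / m"
    unfolding wt_def by linarith
  thus ?thesis using wt_Un[OF assms(2) A(1), of m] A(5) by linarith
qed

text \<open>Two or more shared edges form a proper part of A and have the gap \<epsilon>. With at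
  most one shared edge the third common vertex decides, since 3 - 1/m exceeds \<theta> by at least
  1.\<close>

lemma attach_strict:
  assumes "A \<in> F1" "edge_set Y" "A \<inter> Y \<noteq> {}" "\<not> A \<subseteq> Y" "3 \<le> card (\<Union>Y \<inter> \<Union>A)"
  shows "wt m (Y \<union> A) \<le> wt m Y - \<epsilon>"
proof -
  note A = balancedD[OF bal1[OF assms(1)]]
  have le: "card (\<Union>(Y \<inter> A)) \<le> card (\<Union>Y \<inter> \<Union>A)"
    by (intro card_mono) (use A assms edge_set_Union_finite in auto)
  have "\<theta> + \<epsilon> \<le> real (card (\<Union>Y \<inter> \<Union>A)) - real (card (Y \<inter> A)) / m"
  proof (cases "2 \<le> card (Y \<inter> A)")
    case True
    have "\<theta> + \<epsilon> \<le> wt m (Y \<inter> A)" using A(7)[of "Y \<inter> A"] True assms by auto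
    thus ?thesis using le unfolding wt_def by linarith
  next
    case False
    hence "card (Y \<inter> A) \<le> 1" by simp
    hence "real (card (Y \<inter> A)) / m \<le> 1 / m" using x1 xm by (intro divide_right_mono) auto
    moreover have "3 \<le> real (card (\<Union>Y \<inter> \<Union>A))" using assms(5) by linarith
    ultimately show ?thesis using inv_le eps theta by linarith
  qed
  thus ?thesis using wt_Un[OF assms(2) A(1), of m] A(5) by linarith
qed

text \<open>Take a largest set of copies whose union weighs at most \<theta>. Single copies qualify,
  and by \<open>attach_le\<close> a further copy sharing an edge with the union could be
  added.\<close>

lemma cluster_exists:
  assumes "finite R" "R \<noteq> {}" "\<And>f. f \<in> R \<Longrightarrow> A f \<in> F1"
  shows "\<exists>C. C \<subseteq> R \<and> C \<noteq> {} \<and> wt m (\<Union>f\<in>C. A f) \<le> \<theta> \<and> (\<forall>f\<in>R - C. A f \<inter> (\<Union>g\<in>C. A g) = {})"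
proof -
  define P where "P C \<longleftrightarrow> C \<subseteq> R \<and> C \<noteq> {} \<and> wt m (\<Union>f\<in>C. A f) \<le> \<theta>" for C
  obtain f0 where f0: "f0 \<in> R" using assms by auto
  have P0: "P {f0}" unfolding P_def using f0 balancedD[OF bal1[OF assms(3)[OF f0]]] by auto
  have bd: "\<forall>C. P C \<longrightarrow> card C < Suc (card R)"
    unfolding P_def using assms(1) by (auto intro!: card_mono le_imp_less_Suc)
  obtain C where C: "P C" "\<And>D. P D \<Longrightarrow> card D \<le> card C"
    using ex_has_greatest_nat[of P, OF P0 bd] by auto
  have finC: "finite C" using C(1) assms(1) finite_subset unfolding P_def by auto
  have "A f \<inter> (\<Union>g\<in>C. A g) = {}" if f: "f \<in> R - C" for f
  proof (rule ccontr)
    assume ne: "A f \<inter> (\<Union>g\<in>C. A g) \<noteq> {}"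
    have es: "edge_set (\<Union>g\<in>C. A g)"
      using finC C(1) assms(3) balancedD(1)[OF bal1] unfolding P_def by (intro edge_set_UN) auto
    have "wt m ((\<Union>g\<in>C. A g) \<union> A f) \<le> wt m (\<Union>g\<in>C. A g)"
      using f assms(3) ne es by (intro attach_le) auto
    moreover have "(\<Union>g\<in>insert f C. A g) = (\<Union>g\<in>C. A g) \<union> A f" by auto
    ultimately have "P (insert f C)" using C(1) f unfolding P_def by auto
    from C(2)[OF this] show False using f finC by simp
  qed
  thus ?thesis using C(1) unfolding P_def by blast
qed

text \<open>Group the attached copies into clusters sharing edges. A cluster \<open>C\<close> weighs at most \<open>\<theta>\<close>, as much
  as a single copy, whereas its edges in \<open>B\<close> have \<open>wt x C \<ge> \<theta>\<close>, with a gap unless \<open>C\<close> is a singleton.\<close>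

lemma disjoint_attachments:
  assumes "B \<in> F2" "finite R" "R \<subset> B" "edge_set Y" "Y \<inter> B = B - R"
    and "\<And>f. f \<in> R \<Longrightarrow> A f \<in> F1 \<and> A f \<inter> B = {f} \<and> A f \<inter> Y = {}"
  defines "D \<equiv> wt m (Y \<union> (\<Union>f\<in>R. A f)) - wt m Y - (\<theta> - (real (card (\<Union>B \<inter> \<Union>Y)) - real (card (B - R)) / x))"
  shows "D \<le> - \<epsilon> \<or> (D \<le> 0 \<and> (\<forall>f\<in>R. \<Union>(A f) \<inter> \<Union>B = f \<and> \<Union>(A f) \<inter> \<Union>Y \<subseteq> \<Union>B \<and>
            (\<forall>g\<in>R. g \<noteq> f \<longrightarrow> \<Union>(A f) \<inter> \<Union>(A g) \<subseteq> \<Union>B)))"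
  using assms(2-6) unfolding D_def
\<comment> \<open>\<open>D\<close> compares the true change of weight with that of completing B by
  plain edges of cost 1/x each. Each round moves one cluster C into Y, and the contributions of the
  rounds add up.\<close>
proof (induction "card R" arbitrary: R Y rule: less_induct)
  case less
  note B = balancedD[OF bal2[OF assms(1)]]
  have finVB: "finite (\<Union>B)" using B edge_set_Union_finite by auto
  show ?case
  proof (cases "R = {}")
    case True
    hence "B \<subseteq> Y" using less.prems by auto
    hence "\<Union>B \<inter> \<Union>Y = \<Union>B" by auto
    thus ?thesis using True B(5) unfolding wt_def by auto
  next
    case False
    obtain C where C: "C \<subseteq> R" "C \<noteq> {}" "wt m (\<Union>f\<in>C. A f) \<le> \<theta>"
      "\<forall>f\<in>R - C. A f \<inter> (\<Union>g\<in>C. A g) = {}"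
      using cluster_exists[OF less.prems(1) False, of A] less.prems(5) by blast
    define U where "U = (\<Union>f\<in>C. A f)"
    have finC: "finite C" using C(1) less.prems(1) finite_subset by auto
    have esU: "edge_set U" unfolding U_def
      using finC C(1) less.prems(5) balancedD(1)[OF bal1] by (intro edge_set_UN) auto
    have finU: "finite (\<Union>U)" and finY: "finite (\<Union>Y)"
      using esU less.prems(3) edge_set_Union_finite by auto
    define Y1 where "Y1 = Y \<union> U"
    have esY1: "edge_set Y1" unfolding Y1_def using esU less.prems(3) by (rule edge_set_Un[rotated])
    have AfB: "A f \<inter> B = {f}" and AfY: "A f \<inter> Y = {}" if "f \<in> C" for f
      using less.prems(5)[of f] C(1) that by auto
    have "U \<inter> B = (\<Union>f\<in>C. A f \<inter> B)" unfolding U_def by blast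
    also have "\<dots> = C" using AfB by auto
    finally have UB: "U \<inter> B = C" .
    have UY: "Y \<inter> U = {}" unfolding U_def using AfY by blast
    have Y1B: "Y1 \<inter> B = B - (R - C)" 
    proof -
      have "Y1 \<inter> B = (Y \<inter> B) \<union> (U \<inter> B)" unfolding Y1_def by blast
      thus ?thesis unfolding less.prems(4) UB using C(1) less.prems(2) by blast
    qed
    have cless: "card (R - C) < card R"
      using C(1,2) less.prems(1) by (intro psubset_card_mono) auto
    have TT: "Y1 \<union> (\<Union>f\<in>R - C. A f) = Y \<union> (\<Union>f\<in>R. A f)"
      unfolding Y1_def U_def using C(1) by blast
    define D1 where "D1 = wt m (Y1 \<union> (\<Union>f\<in>R - C. A f)) - wt m Y1 -
        (\<theta> - (real (card (\<Union>B \<inter> \<Union>Y1)) - real (card (B - (R - C))) / x))"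
    have IH: "D1 \<le> - \<epsilon> \<or> (D1 \<le> 0 \<and> (\<forall>f\<in>R - C. \<Union>(A f) \<inter> \<Union>B = f \<and> \<Union>(A f) \<inter> \<Union>Y1 \<subseteq> \<Union>B \<and>
            (\<forall>g\<in>R - C. g \<noteq> f \<longrightarrow> \<Union>(A f) \<inter> \<Union>(A g) \<subseteq> \<Union>B)))"
      unfolding D1_def
    proof (rule less.hyps[OF cless])
      show "finite (R - C)" using less.prems by auto
      show "R - C \<subset> B" using less.prems by auto
      show "edge_set Y1" by fact
      show "Y1 \<inter> B = B - (R - C)" by fact
      fix f assume f: "f \<in> R - C"
      show "A f \<in> F1 \<and> A f \<inter> B = {f} \<and> A f \<inter> Y1 = {}"
      proof -
        have "A f \<inter> U = {}" using C(4) f unfolding U_def by simp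
        moreover have "A f \<in> F1 \<and> A f \<inter> B = {f} \<and> A f \<inter> Y = {}" using f less.prems(5) by simp
        ultimately show ?thesis unfolding Y1_def by (simp add: Int_Un_distrib)
      qed
    qed
    define \<delta> where "\<delta> = wt m Y1 - wt m Y - ((real (card (\<Union>B \<inter> \<Union>Y1)) - real (card (B - (R - C))) / x)
         - (real (card (\<Union>B \<inter> \<Union>Y)) - real (card (B - R)) / x))"
    have Dsum: "wt m (Y \<union> (\<Union>f\<in>R. A f)) - wt m Y - (\<theta> - (real (card (\<Union>B \<inter> \<Union>Y)) - real (card (B - R)) / x))
       = D1 + \<delta>" unfolding D1_def \<delta>_def TT by linarith
    have w1: "wt m Y1 = wt m Y + wt m U - real (card (\<Union>Y \<inter> \<Union>U))"
      unfolding Y1_def using wt_Un[OF less.prems(3) esU, of m] UY by simp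
    have CB: "C \<subseteq> B" using C(1) less.prems(2) by auto
    have CB': "C \<subset> B" using C(1) less.prems(2) by auto
    have cC: "real (card (B - (R - C))) = real (card (B - R)) + real (card C)"
    proof -
      have "B - (R - C) = (B - R) \<union> C" using CB C(1) by blast
      moreover have "card ((B - R) \<union> C) = card (B - R) + card C"
        using B finC C(1) by (intro card_Un_disjoint) auto
      ultimately show ?thesis by simp
    qed
    hence cC': "real (card (B - (R - C))) / x = real (card (B - R)) / x + real (card C) / x"
      by (simp add: add_divide_distrib)
    have vb: "card (\<Union>B \<inter> \<Union>Y1) + card (\<Union>B \<inter> \<Union>U \<inter> \<Union>Y) = card (\<Union>B \<inter> \<Union>Y) + card (\<Union>B \<inter> \<Union>U)"
    proof -
      have "card (\<Union>B \<inter> \<Union>Y) + card (\<Union>B \<inter> \<Union>U) = card ((\<Union>B \<inter> \<Union>Y) \<union> (\<Union>B \<inter> \<Union>U)) + card ((\<Union>B \<inter> \<Union>Y) \<inter> (\<Union>B \<inter> \<Union>U))"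
        using finVB by (intro card_Un_Int) auto
      moreover have "(\<Union>B \<inter> \<Union>Y) \<union> (\<Union>B \<inter> \<Union>U) = \<Union>B \<inter> \<Union>Y1" unfolding Y1_def by auto
      moreover have "(\<Union>B \<inter> \<Union>Y) \<inter> (\<Union>B \<inter> \<Union>U) = \<Union>B \<inter> \<Union>U \<inter> \<Union>Y" by auto
      ultimately show ?thesis by simp
    qed
    have i1: "card (\<Union>B \<inter> \<Union>U \<inter> \<Union>Y) \<le> card (\<Union>Y \<inter> \<Union>U)"
      using finU by (intro card_mono) auto
    have i2: "card (\<Union>C) \<le> card (\<Union>B \<inter> \<Union>U)"
      using finVB UB by (intro card_mono) auto
    have thC: "\<theta> \<le> wt x C" using B(6)[OF CB C(2)] .
    \<comment> \<open>Three losses, none of them negative: the excess of C over \<theta> inside B,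
      the vertices where the cluster meets Y outside B, and the vertices of B that the cluster hits
      off C.\<close>
    have dl: "\<delta> \<le> \<theta> - wt x C - (real (card (\<Union>Y \<inter> \<Union>U)) - real (card (\<Union>B \<inter> \<Union>U \<inter> \<Union>Y)))
        - (real (card (\<Union>B \<inter> \<Union>U)) - real (card (\<Union>C)))"
      unfolding \<delta>_def w1 cC' wt_def[of x C] using vb C(3)[folded U_def] by linarith
    have d0: "\<delta> \<le> 0" using dl thC i1 i2 by linarith
    have dich: "\<delta> \<le> - \<epsilon> \<or> (\<exists>f. C = {f} \<and> \<Union>(A f) \<inter> \<Union>B = f \<and> \<Union>(A f) \<inter> \<Union>Y \<subseteq> \<Union>B)"
    proof (cases "2 \<le> card C")
      case True
      thus ?thesis using B(7)[OF CB' True] dl i1 i2 by linarith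
    next
      case False
      have "card C > 0" using finC C(2) by (simp add: card_gt_0_iff)
      hence "card C = 1" using False by linarith
      then obtain f where f: "C = {f}" using card_1_singletonE by auto
      have Uf: "U = A f" unfolding U_def f by simp
      show ?thesis
      proof (cases "\<delta> \<le> - \<epsilon>")
        case False
        have e1: "card (\<Union>B \<inter> \<Union>U \<inter> \<Union>Y) = card (\<Union>Y \<inter> \<Union>U)"
        proof (rule ccontr)
          assume "\<not> ?thesis"
          hence "card (\<Union>B \<inter> \<Union>U \<inter> \<Union>Y) + 1 \<le> card (\<Union>Y \<inter> \<Union>U)" using i1 by linarith
          thus False using False dl thC i2 eps by linarith
        qed
        have "\<Union>B \<inter> \<Union>U \<inter> \<Union>Y = \<Union>Y \<inter> \<Union>U"
          using e1 finU by (intro card_subset_eq) auto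
        hence p1: "\<Union>(A f) \<inter> \<Union>Y \<subseteq> \<Union>B" unfolding Uf by blast
        have e2: "card (\<Union>C) = card (\<Union>B \<inter> \<Union>U)"
        proof (rule ccontr)
          assume "\<not> ?thesis"
          hence "card (\<Union>C) + 1 \<le> card (\<Union>B \<inter> \<Union>U)" using i2 by linarith
          thus False using False dl thC i1 eps by linarith
        qed
        have "\<Union>C = \<Union>B \<inter> \<Union>U"
          using e2 finVB UB by (intro card_subset_eq) auto
        hence p2: "\<Union>(A f) \<inter> \<Union>B = f" unfolding Uf f by auto
        show ?thesis using f p1 p2 by blast
      qed simp
    qed
    show ?thesis
    proof (cases "D1 \<le> - \<epsilon> \<or> \<delta> \<le> - \<epsilon>")
      case True
      have "D1 \<le> 0" using IH eps by linarith
      thus ?thesis unfolding Dsum using True d0 by linarith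
    next
      case False
      then obtain f where f: "C = {f}" "\<Union>(A f) \<inter> \<Union>B = f" "\<Union>(A f) \<inter> \<Union>Y \<subseteq> \<Union>B"
        using dich by auto
      have reg: "D1 \<le> 0" "\<forall>h\<in>R - {f}. \<Union>(A h) \<inter> \<Union>B = h \<and> \<Union>(A h) \<inter> \<Union>Y1 \<subseteq> \<Union>B \<and>
            (\<forall>g\<in>R - {f}. g \<noteq> h \<longrightarrow> \<Union>(A h) \<inter> \<Union>(A g) \<subseteq> \<Union>B)"
        using False IH unfolding f(1) by auto
      have Y1': "\<Union>Y1 = \<Union>Y \<union> \<Union>(A f)" unfolding Y1_def U_def f(1) by auto
      have "\<forall>h\<in>R. \<Union>(A h) \<inter> \<Union>B = h \<and> \<Union>(A h) \<inter> \<Union>Y \<subseteq> \<Union>B \<and>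
            (\<forall>g\<in>R. g \<noteq> h \<longrightarrow> \<Union>(A h) \<inter> \<Union>(A g) \<subseteq> \<Union>B)"
      proof (intro ballI conjI impI)
        fix h assume h: "h \<in> R"
        have r1: "\<Union>(A k) \<inter> \<Union>B = k" "\<Union>(A k) \<inter> \<Union>Y1 \<subseteq> \<Union>B" if "k \<in> R" "k \<noteq> f" for k
          using reg(2) that by simp_all
        have r2: "\<Union>(A k) \<inter> \<Union>(A f) \<subseteq> \<Union>B" "\<Union>(A k) \<inter> \<Union>Y \<subseteq> \<Union>B" if "k \<in> R" "k \<noteq> f" for k
          using r1(2)[OF that] unfolding Y1' by (simp_all add: Int_Un_distrib)
        show "\<Union>(A h) \<inter> \<Union>B = h" using r1(1)[OF h] f(2) by (cases "h = f") simp_all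
        show "\<Union>(A h) \<inter> \<Union>Y \<subseteq> \<Union>B" using r2(2)[OF h] f(3) by (cases "h = f") simp_all
        fix g assume g: "g \<in> R" "g \<noteq> h"
        consider "h = f" | "g = f" | "h \<noteq> f" "g \<noteq> f" by auto
        thus "\<Union>(A h) \<inter> \<Union>(A g) \<subseteq> \<Union>B"
        proof cases
          case 1 thus ?thesis using r2(1)[OF g(1)] g by (simp add: Int_commute)
        next
          case 2 thus ?thesis using r2(1)[OF h] g by simp
        next
          case 3 thus ?thesis using reg(2) h g by simp
        qed
      qed
      thus ?thesis unfolding Dsum using reg(1) d0 by linarith
    qed
  qed
qed

end

section \<open>One step of the exploration\<close>

definition fresh :: "'a set set \<Rightarrow> 'a set set \<Rightarrow> 'a \<times> 'a set \<Rightarrow> bool" where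
  "fresh A S p \<longleftrightarrow> A \<subseteq> S \<and> snd p \<in> A \<and> fst p \<in> snd p \<and> (\<forall>g\<in>S. fst p \<in> g \<longrightarrow> g \<in> A)"

text \<open>Together with \<open>fst p \<in> snd p\<close> it makes the vertices of the entries
  distinct. New edges attached at the edge of one entry then avoid the vertices of all other
  entries, which stay fresh.\<close>

definition apart :: "'a \<times> 'a set \<Rightarrow> 'a \<times> 'a set \<Rightarrow> bool" where
  "apart p q \<longleftrightarrow> fst p \<notin> snd q \<and> fst q \<notin> snd p"

context core begin

text \<open>Copies sharing an edge with the structure so far are attached at no cost until there are
  none left or only the last missing edge of B remains; \<open>disjoint_attachments\<close> treats
  the others. If the weight does not drop, B meets S in a single edge and the new pieces meet only
  where B forces them to.\<close>

lemma flower: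
  assumes BF: "B \<in> F2" and S: "edge_set S" and BS: "B \<inter> S \<noteq> {}" and nB: "\<not> B \<subseteq> S"
    and A: "\<And>f. f \<in> B - S \<Longrightarrow> A f \<in> F1 \<and> A f \<inter> B = {f}"
  defines "T \<equiv> S \<union> (\<Union>f\<in>B - S. A f)"
  shows "wt m T \<le> wt m S - \<epsilon> \<or>
     (\<exists>e. B \<inter> S = {e} \<and> wt m T \<le> wt m S \<and> \<Union>(T - S) \<inter> \<Union>S \<subseteq> e \<and>
        (\<forall>f\<in>B - S. \<Union>(A f) \<inter> \<Union>B = f \<and> \<Union>(A f) \<inter> \<Union>S \<subseteq> \<Union>B \<and>
            (\<forall>g\<in>B - S. g \<noteq> f \<longrightarrow> \<Union>(A f) \<inter> \<Union>(A g) \<subseteq> \<Union>B)))"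
proof -
  note B = balancedD[OF bal2[OF BF]]
  define N where "N = B - S"
  have finN: "finite N" unfolding N_def using B by auto
  define U where "U C = S \<union> (\<Union>f\<in>C. A f)" for C
  have esU: "edge_set (U C)" if "C \<subseteq> N" for C
    unfolding U_def
    by (intro edge_set_Un S edge_set_UN) (use that finN A N_def balancedD(1)[OF bal1] in \<open>auto intro: finite_subset\<close>)
  have UB: "U C \<inter> B = (B \<inter> S) \<union> C" if "C \<subseteq> N" for C
  proof -
    have "U C \<inter> B = (S \<inter> B) \<union> (\<Union>f\<in>C. A f \<inter> B)" unfolding U_def by blast
    also have "(\<Union>f\<in>C. A f \<inter> B) = (\<Union>f\<in>C. {f})"
      by (intro SUP_cong refl) (use A that N_def in simp_all, blast?)
    also have "\<dots> = C" by simp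
    finally show ?thesis by (simp add: Int_commute)
  qed
  \<comment> \<open>C collects edges whose copies can be attached without raising the weight. It
    stays a proper part of N, so that the last missing edge of B is treated separately.\<close>
  define P where "P C \<longleftrightarrow> C \<subset> N \<and> wt m (U C) \<le> wt m S" for C
  have P0: "P {}" unfolding P_def U_def N_def using nB by auto
  have bd: "\<forall>C. P C \<longrightarrow> card C < Suc (card N)"
    unfolding P_def using finN by (auto intro!: le_imp_less_Suc card_mono)
  obtain C where C: "P C" "\<And>D. P D \<Longrightarrow> card D \<le> card C"
    using ex_has_greatest_nat[of P, OF P0 bd] by auto
  have CN: "C \<subset> N" and wC: "wt m (U C) \<le> wt m S" using C(1) unfolding P_def by auto
  have finC: "finite C" using CN finN finite_subset by auto
  have esUC: "edge_set (U C)" using esU CN by auto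
  have fU: "f \<notin> U C" if "f \<in> N - C" for f using UB[of C] CN that unfolding N_def by auto
  have TN: "T = U N" unfolding T_def U_def N_def by simp
  show ?thesis
  proof (cases "\<exists>f\<in>N - C. A f \<inter> U C \<noteq> {}")
    case True
    then obtain f where f: "f \<in> N - C" "A f \<inter> U C \<noteq> {}" by auto
    have AF: "A f \<in> F1" "A f \<inter> B = {f}" using A f N_def by auto
    have Uf: "U (insert f C) = U C \<union> A f" unfolding U_def by auto
    have "wt m (U (insert f C)) \<le> wt m S"
      using attach_le[OF AF(1) esUC f(2)] wC Uf by simp
    hence "\<not> insert f C \<subset> N" using C(2)[of "insert f C"] f finC unfolding P_def by auto
    hence NC: "N = insert f C" using f CN by auto
    have fB: "f \<in> B" using f N_def by auto
    \<comment> \<open>f is the last edge of B to be added. Both its ends lie on further edges of B,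
      which are present, so together with the shared edge g \<noteq> f there are three common
      vertices.\<close>
    have "f \<subseteq> \<Union>(U C)"
    proof
      fix u assume "u \<in> f"
      then obtain h where h: "h \<in> B" "h \<noteq> f" "u \<in> h"
        using balanced_second_edge[OF bal2[OF BF] x1 fB] by auto
      have "h \<in> U C" using UB[of C] CN h NC N_def by auto
      thus "u \<in> \<Union>(U C)" using h by auto
    qed
    obtain g where g: "g \<in> A f" "g \<in> U C" using f by auto
    have gf: "g \<noteq> f" using g fU f by auto
    have es: "edge_set {f, g}" using balancedD(1)[OF bal1[OF AF(1)]] AF(2) g unfolding edge_set_def by auto
    have "3 \<le> card (\<Union>{f, g})" by (rule card_Union_ge_3[OF es]) (use gf in auto)
    also have "\<dots> \<le> card (\<Union>(U C) \<inter> \<Union>(A f))"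
      using \<open>f \<subseteq> \<Union>(U C)\<close> g AF(2) edge_set_Union_finite[OF esUC] by (intro card_mono) auto
    finally have c3: "3 \<le> card (\<Union>(U C) \<inter> \<Union>(A f))" .
    have "wt m (U C \<union> A f) \<le> wt m (U C) - \<epsilon>"
      by (rule attach_strict[OF AF(1) esUC f(2) _ c3]) (use fU[OF f(1)] AF(2) in auto)
    thus ?thesis using wC Uf NC TN by simp
  next
    case False
    define R where "R = N - C"
    have RB: "R \<subset> B" unfolding R_def N_def using BS by auto
    have YB: "U C \<inter> B = B - R" using UB[of C] CN unfolding R_def N_def by auto
    have AR: "A f \<in> F1 \<and> A f \<inter> B = {f} \<and> A f \<inter> U C = {}" if "f \<in> R" for f
      using that A False unfolding R_def N_def by auto
    have TR: "U C \<union> (\<Union>f\<in>R. A f) = T" unfolding TN U_def R_def using CN by blast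
    note * = disjoint_attachments[OF BF _ RB esUC YB AR, unfolded TR]
    have finR: "finite R" unfolding R_def using finN by auto
    have sub: "B - R \<subset> B" using CN RB unfolding R_def N_def by auto
    have ne: "B - R \<noteq> {}" using RB by auto
    have finVB: "finite (\<Union>B)" using B edge_set_Union_finite by auto
    have le: "card (\<Union>(B - R)) \<le> card (\<Union>B \<inter> \<Union>(U C))"
      by (intro card_mono) (use YB finVB in auto)
    have wth: "\<theta> \<le> wt x (B - R)" using B(6)[of "B - R"] ne by auto
    define D where "D = wt m T - wt m (U C) - (\<theta> - (real (card (\<Union>B \<inter> \<Union>(U C))) - real (card (B - R)) / x))"
    have Dd: "D \<le> - \<epsilon> \<or> (D \<le> 0 \<and> (\<forall>f\<in>R. \<Union>(A f) \<inter> \<Union>B = f \<and> \<Union>(A f) \<inter> \<Union>(U C) \<subseteq> \<Union>B \<and>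
            (\<forall>g\<in>R. g \<noteq> f \<longrightarrow> \<Union>(A f) \<inter> \<Union>(A g) \<subseteq> \<Union>B)))"
      unfolding D_def by (rule *[OF finR])
    hence D0: "D \<le> 0" using eps by auto
    have wT: "wt m T \<le> wt m S + D + (\<theta> - wt x (B - R)) - (real (card (\<Union>B \<inter> \<Union>(U C))) - real (card (\<Union>(B - R))))"
      using wC unfolding D_def wt_def[of x] by linarith
    show ?thesis
    proof (cases "wt m T \<le> wt m S - \<epsilon>")
      \<comment> \<open>Every inequality is now tight up to less than \<epsilon>. So the edges of B
        present before the final attachment show no gap and reduce to a single edge, which leaves no
        room for C.\<close>
      case nst: False
      have Dn: "\<not> D \<le> - \<epsilon>" using nst wT wth le by linarith
      have "\<not> 2 \<le> card (B - R)"
      proof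
        assume "2 \<le> card (B - R)"
        from B(7)[OF sub this] show False using nst wT D0 le by linarith
      qed
      moreover have "card (B - R) > 0" using ne B by (auto simp: card_gt_0_iff)
      ultimately have "card (B - R) = 1" by linarith
      then obtain e where e: "B - R = {e}" using card_1_singletonE by blast
      have BRS: "B \<inter> S \<subseteq> B - R" unfolding R_def N_def by auto
      hence BSe: "B \<inter> S = {e}" using BS e by auto
      have "C \<subseteq> B - R" using CN unfolding R_def N_def by auto
      moreover have "e \<notin> C" using BSe CN N_def by auto
      ultimately have C0: "C = {}" using e by auto
      have UCS: "U C = S" unfolding U_def C0 by simp
      have RN: "R = B - S" unfolding R_def C0 N_def by simp
      have "card (\<Union>(B - R)) = card (\<Union>B \<inter> \<Union>(U C))"
      proof (rule ccontr)
        assume "\<not> ?thesis"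
        hence "card (\<Union>(B - R)) + 1 \<le> card (\<Union>B \<inter> \<Union>(U C))" using le by linarith
        thus False using nst wT D0 wth eps by linarith
      qed
      hence "\<Union>(B - R) = \<Union>B \<inter> \<Union>(U C)"
        by (intro card_subset_eq) (use YB finVB in auto)
      hence VBS: "\<Union>B \<inter> \<Union>S = e" unfolding e UCS by simp
      have reg: "\<forall>f\<in>B - S. \<Union>(A f) \<inter> \<Union>B = f \<and> \<Union>(A f) \<inter> \<Union>S \<subseteq> \<Union>B \<and>
            (\<forall>g\<in>B - S. g \<noteq> f \<longrightarrow> \<Union>(A f) \<inter> \<Union>(A g) \<subseteq> \<Union>B)"
        using Dd Dn unfolding UCS RN by simp
      have "\<Union>(A f) \<inter> \<Union>S \<subseteq> e" if "f \<in> B - S" for f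
        using reg that VBS by auto
      hence "\<Union>(T - S) \<inter> \<Union>S \<subseteq> e" unfolding T_def by blast
      moreover have "wt m T \<le> wt m S" using wT D0 wth le by linarith
      ultimately show ?thesis using BSe reg by (intro disjI2 exI[of _ e] conjI)
    qed simp
  qed
qed

text \<open>In the regular case each copy hanging from a new edge of B has a vertex off B all of
  whose edges lie in that copy. Edges of B at the two ends of e lead to two such copies, so the
  queue can trade one entry for two. The bound \<open>s * s\<close> stands for at most s copies with
  at most s edges each.\<close>

lemma extend_by_B:
  assumes BF: "B \<in> F2" and S: "edge_set S" "S \<subseteq> \<Union>(F1 \<union> F2)" and BS: "B \<inter> S \<noteq> {}" and nB: "\<not> B \<subseteq> S"
    and s: "\<forall>M\<in>F1 \<union> F2. card M \<le> s"
  shows "\<exists>T. S \<subset> T \<and> T \<subseteq> \<Union>(F1 \<union> F2) \<and> card (T - S) \<le> s * s \<and> (wt m T \<le> wt m S - \<epsilon> \<or>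
     (\<exists>e p1 p2 A1 A2. B \<inter> S = {e} \<and> wt m T \<le> wt m S \<and> \<Union>(T - S) \<inter> \<Union>S \<subseteq> e \<and>
        A1 \<in> F1 \<and> A2 \<in> F1 \<and> fresh A1 T p1 \<and> fresh A2 T p2 \<and> snd p1 \<in> T - S \<and> snd p2 \<in> T - S \<and>
        fst p1 \<notin> \<Union>S \<and> fst p2 \<notin> \<Union>S \<and> apart p1 p2))"
proof -
  note B = balancedD[OF bal2[OF BF]]
  obtain A where A: "\<And>f. f \<in> B - S \<Longrightarrow> A f \<in> F1 \<and> A f \<inter> B = {f}"
    using cover2[OF BF] by (metis DiffD1)
  define T where "T = S \<union> (\<Union>f\<in>B - S. A f)"
  have fA: "f \<in> A f" if "f \<in> B - S" for f using A[OF that] by auto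
  have BT: "B \<subseteq> T" unfolding T_def using fA by blast
  have ST: "S \<subset> T" using BT nB unfolding T_def by auto
  have TL: "T \<subseteq> \<Union>(F1 \<union> F2)" unfolding T_def using S(2) A by blast
  have "card (T - S) \<le> card (\<Union>f\<in>B - S. A f)"
    unfolding T_def using A balancedD(2)[OF bal1] B(2) by (intro card_mono) auto
  also have "\<dots> \<le> (\<Sum>f\<in>B - S. card (A f))" using B(2) by (intro card_UN_le) auto
  also have "\<dots> \<le> (\<Sum>f\<in>B - S. s)" using A s by (intro sum_mono) auto
  also have "\<dots> = card (B - S) * s" by simp
  also have "\<dots> \<le> s * s"
    using bspec[OF s, of B] BF card_mono[of B "B - S"] B(2) by (intro mult_right_mono) auto
  finally have cT: "card (T - S) \<le> s * s" .
  define RG where "RG \<longleftrightarrow> (\<forall>f\<in>B - S. \<Union>(A f) \<inter> \<Union>B = f \<and> \<Union>(A f) \<inter> \<Union>S \<subseteq> \<Union>B \<and>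
            (\<forall>g\<in>B - S. g \<noteq> f \<longrightarrow> \<Union>(A f) \<inter> \<Union>(A g) \<subseteq> \<Union>B))"
  have "wt m T \<le> wt m S - \<epsilon> \<or>
     (\<exists>e. B \<inter> S = {e} \<and> wt m T \<le> wt m S \<and> \<Union>(T - S) \<inter> \<Union>S \<subseteq> e \<and> RG)"
    unfolding RG_def T_def by (rule flower[OF BF S(1) BS nB A])
  then consider "wt m T \<le> wt m S - \<epsilon>" | e where "B \<inter> S = {e}" "wt m T \<le> wt m S" "\<Union>(T - S) \<inter> \<Union>S \<subseteq> e" RG
    by blast
  thus ?thesis
  proof cases
    case 1
    show ?thesis by (rule exI[of _ T], intro conjI) (rule ST TL cT disjI1[OF 1])+
  next
    case (2 e)
    have rg: "\<Union>(A f) \<inter> \<Union>B = f" "\<Union>(A f) \<inter> \<Union>S \<subseteq> \<Union>B" if "f \<in> B - S" for f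
      using 2(4) that unfolding RG_def by simp_all
    have rg3: "\<Union>(A f) \<inter> \<Union>(A g) \<subseteq> \<Union>B" if "f \<in> B - S" "g \<in> B - S" "g \<noteq> f" for f g
      using 2(4) that unfolding RG_def by simp
    have eB: "e \<in> B" using 2(1) by auto
    have ce: "card e = 2" using eB B(1) unfolding edge_set_def by auto
    then obtain u v where uv: "e = {u, v}" "u \<noteq> v" by (meson card_2_iff)
    obtain f1 where f1: "f1 \<in> B" "f1 \<noteq> e" "u \<in> f1"
      using balanced_second_edge[OF bal2[OF BF] x1 eB, of u] uv by auto
    obtain f2 where f2: "f2 \<in> B" "f2 \<noteq> e" "v \<in> f2"
      using balanced_second_edge[OF bal2[OF BF] x1 eB, of v] uv by auto
    have cf1: "card f1 = 2" using f1 B(1) unfolding edge_set_def by auto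
    have "f1 \<noteq> f2"
    proof
      assume "f1 = f2"
      hence "e \<subseteq> f1" using f1 f2 uv by auto
      hence "e = f1" using ce cf1 by (metis card_subset_eq card.infinite zero_neq_numeral)
      thus False using f1 by simp
    qed
    have fS: "f1 \<in> B - S" "f2 \<in> B - S" using f1 f2 2(1) by auto
    have fr: "\<exists>p. fresh (A f) T p \<and> snd p \<in> T - S \<and> fst p \<notin> \<Union>S \<and> fst p \<notin> \<Union>B \<and> snd p \<in> A f" if f: "f \<in> B - S" for f
    proof -
      note Af = balancedD[OF bal1[of "A f"]]
      have AF: "A f \<in> F1" "A f \<inter> B = {f}" using A f by auto
      have regf: "\<Union>(A f) \<inter> \<Union>B = f" "\<Union>(A f) \<inter> \<Union>S \<subseteq> \<Union>B" using rg f by auto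
      have "\<not> A f \<subseteq> {f}" using Af(3)[OF AF(1)] card_mono[of "{f}" "A f"] by fastforce
      then obtain h where h: "h \<in> A f" "h \<noteq> f" by auto
      have ch: "card h = 2" "card f = 2"
        using h Af(1)[OF AF(1)] fA[OF f] unfolding edge_set_def by auto
      have "\<not> h \<subseteq> f" using ch h(2) by (metis card_subset_eq card.infinite zero_neq_numeral)
      then obtain w where w: "w \<in> h" "w \<notin> f" by auto
      have wB: "w \<notin> \<Union>B" using regf(1) w h by auto
      have wS: "w \<notin> \<Union>S" using regf(2) wB w h by auto
      have "g \<in> A f" if g: "g \<in> T" "w \<in> g" for g
      proof -
        have "g \<notin> S" using wS g by auto
        then obtain k where k: "k \<in> B - S" "g \<in> A k" using g unfolding T_def by auto
        have "k = f"
        proof (rule ccontr)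
          assume "k \<noteq> f"
          hence "\<Union>(A f) \<inter> \<Union>(A k) \<subseteq> \<Union>B" using rg3 f k by auto
          thus False using wB w h k g by auto
        qed
        thus ?thesis using k by simp
      qed
      moreover have "h \<in> T - S" using h wS w f unfolding T_def by auto
      ultimately have "fresh (A f) T (w, h)" unfolding fresh_def using h w f T_def by auto
      thus ?thesis using wS wB h \<open>h \<in> T - S\<close> by (intro exI[of _ "(w,h)"]) auto
    qed
    obtain p1 where p1: "fresh (A f1) T p1" "snd p1 \<in> T - S" "fst p1 \<notin> \<Union>S" "fst p1 \<notin> \<Union>B" "snd p1 \<in> A f1" using fr[OF fS(1)] by auto
    obtain p2 where p2: "fresh (A f2) T p2" "snd p2 \<in> T - S" "fst p2 \<notin> \<Union>S" "fst p2 \<notin> \<Union>B" "snd p2 \<in> A f2" using fr[OF fS(2)] by auto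
    have dis: "\<Union>(A f1) \<inter> \<Union>(A f2) \<subseteq> \<Union>B" using rg3 fS \<open>f1 \<noteq> f2\<close> by auto
    have "fst p1 \<in> \<Union>(A f1)" "fst p2 \<in> \<Union>(A f2)" using p1 p2 unfolding fresh_def by auto
    hence ap: "apart p1 p2" unfolding apart_def using dis p1(4,5) p2(4,5) by blast
    have AF: "A f1 \<in> F1" "A f2 \<in> F1" using A fS by auto
    have ex: "\<exists>e p1 p2 A1 A2. B \<inter> S = {e} \<and> wt m T \<le> wt m S \<and> \<Union>(T - S) \<inter> \<Union>S \<subseteq> e \<and>
        A1 \<in> F1 \<and> A2 \<in> F1 \<and> fresh A1 T p1 \<and> fresh A2 T p2 \<and> snd p1 \<in> T - S \<and> snd p2 \<in> T - S \<and>
        fst p1 \<notin> \<Union>S \<and> fst p2 \<notin> \<Union>S \<and> apart p1 p2"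
      by (rule exI[of _ e], rule exI[of _ p1], rule exI[of _ p2], rule exI[of _ "A f1"],
          rule exI[of _ "A f2"], intro conjI) (rule 2 p1 p2 AF ap)+
    show ?thesis by (rule exI[of _ T], intro conjI) (rule ST TL cT disjI2[OF ex])+
  qed
qed

definition valid_state :: "'a set set \<Rightarrow> ('a \<times> 'a set) list \<Rightarrow> bool" where
  "valid_state S Q \<longleftrightarrow> S \<noteq> {} \<and> S \<subseteq> \<Union>(F1 \<union> F2) \<and>
     (\<forall>p\<in>set Q. \<exists>A\<in>F1. fresh A S p) \<and> sorted_wrt apart Q"

end

text \<open>A state consists of the explored edges and a queue of pairs of a vertex and an incident edge,
  the vertex lying in no explored edges but those of one copy.\<close>

definition queue_step :: "real \<Rightarrow> nat \<Rightarrow> 'a set set \<times> ('a \<times> 'a set) list \<Rightarrow> 'a set set \<times> ('a \<times> 'a set) list \<Rightarrow> bool" where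
  "queue_step m \<kappa> = (\<lambda>(S, Q) (T, Q'). S \<subset> T \<and> card (T - S) \<le> \<kappa> \<and> wt m T \<le> wt m S \<and>
     (\<exists>p Q0 p1 p2. Q = p # Q0 \<and> snd p \<in> S \<and> \<Union>(T - S) \<inter> \<Union>S \<subseteq> snd p \<and> Q' = Q0 @ [p1, p2] \<and>
        fst p1 \<in> snd p1 \<and> snd p1 \<in> T - S \<and> fst p2 \<in> snd p2 \<and> snd p2 \<in> T - S))"

text \<open>Reserved for an empty queue: the new edges may touch the explored set anywhere, so the
  number of possible outcomes grows with it. One new entry restarts the queue.\<close>

definition free_step :: "real \<Rightarrow> nat \<Rightarrow> 'a set set \<times> ('a \<times> 'a set) list \<Rightarrow> 'a set set \<times> ('a \<times> 'a set) list \<Rightarrow> bool" where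
  "free_step m \<kappa> = (\<lambda>(S, Q) (T, Q'). S \<subset> T \<and> card (T - S) \<le> \<kappa> \<and> wt m T \<le> wt m S \<and>
     Q = [] \<and> (\<exists>p. Q' = [p] \<and> fst p \<in> snd p \<and> snd p \<in> T - S))"

text \<open>The drop of \<epsilon> pays for attaching anywhere. Entries whose vertex is touched may
  cease to be fresh and are discarded; \<kappa> new edges touch at most 2 \<kappa> vertices, each
  belonging to at most one entry of a valid queue.\<close>

definition degenerate_step :: "real \<Rightarrow> nat \<Rightarrow> real \<Rightarrow> 'a set set \<times> ('a \<times> 'a set) list \<Rightarrow> 'a set set \<times> ('a \<times> 'a set) list \<Rightarrow> bool" where
  "degenerate_step m \<kappa> \<epsilon> = (\<lambda>(S, Q) (T, Q'). S \<subset> T \<and> card (T - S) \<le> \<kappa> \<and> wt m T \<le> wt m S - \<epsilon> \<and>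
     Q' = filter (\<lambda>p. fst p \<notin> \<Union>(T - S)) Q \<and> length Q \<le> length Q' + 2 * \<kappa>)"

section \<open>Progress of the exploration inside a core\<close>

lemma card_Union_edges_le:
  assumes "edge_set X"
  shows "card (\<Union>X) \<le> 2 * card X"
proof -
  have "card (\<Union>X) \<le> (\<Sum>e\<in>X. card e)"
    using card_UN_le[of X "\<lambda>e. e"] assms unfolding edge_set_def by auto
  also have "\<dots> = (\<Sum>e\<in>X. 2)" using assms unfolding edge_set_def by (intro sum.cong) auto
  finally show ?thesis by simp
qed

lemma fresh_mono:
  assumes "fresh A S p" "S \<subseteq> T" "fst p \<notin> \<Union>(T - S)"
  shows "fresh A T p"
  using assms unfolding fresh_def by blast

context core begin

lemma edge_set_L: "edge_set (\<Union>(F1 \<union> F2))"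
proof -
  have "edge_set (\<Union>A\<in>F1. A)" by (rule edge_set_UN[OF fin1]) (rule balancedD(1)[OF bal1])
  moreover have "edge_set (\<Union>A\<in>F2. A)" by (rule edge_set_UN[OF fin2]) (rule balancedD(1)[OF bal2])
  ultimately show ?thesis unfolding Union_Un_distrib by (simp add: edge_set_Un)
qed

lemma degenerate_stepI:
  assumes v: "valid_state S Q" and T: "S \<subset> T" "T \<subseteq> \<Union>(F1 \<union> F2)" "card (T - S) \<le> \<kappa>" "wt m T \<le> wt m S - \<epsilon>"
  shows "\<exists>Q'. valid_state T Q' \<and> degenerate_step m \<kappa> \<epsilon> (S, Q) (T, Q')"
proof -
  define Q' where "Q' = filter (\<lambda>p. fst p \<notin> \<Union>(T - S)) Q"
  have fr: "\<forall>p\<in>set Q. \<exists>A\<in>F1. fresh A S p" and ap: "sorted_wrt apart Q"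
    using v unfolding valid_state_def by auto
  have esX: "edge_set (T - S)" using edge_set_L T(2) by (meson Diff_subset edge_set_subset)
  have dist: "distinct (map fst Q)"
    unfolding distinct_map
  proof
    have "\<forall>p\<in>set Q. fst p \<in> snd p" using fr unfolding fresh_def by auto
    thus "distinct Q" using ap
      by (induction Q) (auto simp: apart_def)
    show "inj_on fst (set Q)" using ap \<open>\<forall>p\<in>set Q. fst p \<in> snd p\<close>
      by (induction Q) (auto simp: apart_def inj_on_def)
  qed
  have "length Q = length Q' + length (filter (\<lambda>p. \<not> fst p \<notin> \<Union>(T - S)) Q)"
    unfolding Q'_def using sum_length_filter_compl[of "\<lambda>p. fst p \<notin> \<Union>(T - S)" Q] by linarith
  also have "length (filter (\<lambda>p. \<not> fst p \<notin> \<Union>(T - S)) Q) = card (set (map fst (filter (\<lambda>p. \<not> fst p \<notin> \<Union>(T - S)) Q)))"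
    using distinct_card[of "map fst (filter (\<lambda>p. \<not> fst p \<notin> \<Union>(T - S)) Q)"] distinct_map_filter[OF dist] by simp
  also have "\<dots> \<le> card (\<Union>(T - S))"
    using edge_set_Union_finite[OF esX] by (intro card_mono) auto
  also have "\<dots> \<le> 2 * \<kappa>" using card_Union_edges_le[OF esX] T(3) by simp
  finally have len: "length Q \<le> length Q' + 2 * \<kappa>" by simp
  have "valid_state T Q'" unfolding valid_state_def
  proof (intro conjI)
    show "T \<noteq> {}" using T by auto
    show "T \<subseteq> \<Union>(F1 \<union> F2)" by fact
    show "\<forall>p\<in>set Q'. \<exists>A\<in>F1. fresh A T p"
      unfolding Q'_def using fr T(1) fresh_mono[of _ S _ T] by (auto; metis psubset_imp_subset)
    show "sorted_wrt apart Q'" unfolding Q'_def using ap by (rule sorted_wrt_filter)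
  qed
  moreover have "degenerate_step m \<kappa> \<epsilon> (S, Q) (T, Q')"
    unfolding degenerate_step_def using T len Q'_def by simp
  ultimately show ?thesis by blast
qed

text \<open>The covering property gives a copy B in F2 meeting A only in the queued edge. B has a
  second edge at the queued vertex; it is not in A, whereas freshness puts all explored edges at
  this vertex into A.\<close>

lemma leaves_fresh_copy:
  assumes v: "valid_state S Q" and p: "p \<in> set Q"
  shows "\<exists>B\<in>F2. snd p \<in> B \<and> snd p \<in> S \<and> \<not> B \<subseteq> S \<and> B \<inter> S \<noteq> {}"
proof -
  obtain A where A: "A \<in> F1" "fresh A S p" using v p unfolding valid_state_def by auto
  have e: "snd p \<in> A" "fst p \<in> snd p" "A \<subseteq> S" using A(2) unfolding fresh_def by auto
  obtain B where B: "B \<in> F2" "A \<inter> B = {snd p}" using cover1[OF A(1) e(1)] by auto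
  have eB: "snd p \<in> B" using B by auto
  obtain h where h: "h \<in> B" "h \<noteq> snd p" "fst p \<in> h"
    using balanced_second_edge[OF bal2[OF B(1)] x1 eB e(2)] by auto
  have "h \<notin> A" using B h by auto
  hence "h \<notin> S" using A(2) h unfolding fresh_def by auto
  thus ?thesis using B eB e h by blast
qed

lemma queue_empty_at_end: "valid_state (\<Union>(F1 \<union> F2)) Q \<Longrightarrow> Q = []"
proof (rule ccontr)
  assume v: "valid_state (\<Union>(F1 \<union> F2)) Q" and "Q \<noteq> []"
  then obtain p where "p \<in> set Q" by (cases Q) auto
  from leaves_fresh_copy[OF v this] obtain B where "B \<in> F2" "\<not> B \<subseteq> \<Union>(F1 \<union> F2)" by blast
  thus False by blast
qed

text \<open>With fewer than three common vertices, these are the two ends of a shared edge g. A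
  missing edge of A then has an end off g, which is new to S and so lies only on edges of A.\<close>

lemma extend_by_A:
  assumes AF: "A \<in> F1" and S: "edge_set S" and AS: "A \<inter> S \<noteq> {}" and nA: "\<not> A \<subseteq> S"
  shows "wt m (S \<union> A) \<le> wt m S - \<epsilon> \<or>
    (wt m (S \<union> A) \<le> wt m S \<and> (\<exists>p. fresh A (S \<union> A) p \<and> snd p \<in> A - S))"
proof (cases "3 \<le> card (\<Union>S \<inter> \<Union>A)")
  case True
  thus ?thesis using attach_strict[OF AF S AS nA] by simp
next
  case False
  note A = balancedD[OF bal1[OF AF]]
  obtain g where g: "g \<in> A" "g \<in> S" using AS by auto
  have cg: "card g = 2" using g A(1) unfolding edge_set_def by auto
  have sub: "g \<subseteq> \<Union>S \<inter> \<Union>A" using g by auto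
  have "finite (\<Union>S \<inter> \<Union>A)" using edge_set_Union_finite[OF S] by auto
  hence eq: "\<Union>S \<inter> \<Union>A = g" using sub False cg
    by (metis card_subset_eq card_mono le_antisym not_less_eq_eq numeral_3_eq_3 numeral_2_eq_2)
  obtain h where h: "h \<in> A" "h \<notin> S" using nA by auto
  have "card h = 2" using h A(1) unfolding edge_set_def by auto
  hence "\<not> h \<subseteq> g" using cg h g by (metis card_subset_eq card.infinite zero_neq_numeral)
  then obtain w where w: "w \<in> h" "w \<notin> g" by auto
  have "w \<notin> \<Union>S" using eq w h by auto
  hence "fresh A (S \<union> A) (w, h)" unfolding fresh_def using h w by auto
  thus ?thesis using attach_le[OF AF S AS] h by (metis DiffI snd_conv)
qed

text \<open>The front entry of a nonempty queue leads to a copy in F2 that is not fully explored;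
  for an empty queue, connectivity supplies a copy crossing the boundary of S.\<close>

lemma next_step:
  assumes v: "valid_state S Q" and SL: "S \<noteq> \<Union>(F1 \<union> F2)"
    and s: "\<forall>M\<in>F1 \<union> F2. card M \<le> s"
  shows "\<exists>T Q'. valid_state T Q' \<and> (queue_step m (s * s) (S, Q) (T, Q') \<or> free_step m (s * s) (S, Q) (T, Q') \<or>
            degenerate_step m (s * s) \<epsilon> (S, Q) (T, Q'))"
proof -
  have S: "S \<subseteq> \<Union>(F1 \<union> F2)" "S \<noteq> {}" and fr: "\<forall>p\<in>set Q. \<exists>A\<in>F1. fresh A S p" and ap: "sorted_wrt apart Q"
    using v unfolding valid_state_def by auto
  have esS: "edge_set S" using edge_set_L S edge_set_subset by auto
  show ?thesis
  proof (cases Q)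
    case (Cons p Q0)
    obtain B where B: "B \<in> F2" "snd p \<in> B" "snd p \<in> S" "\<not> B \<subseteq> S" "B \<inter> S \<noteq> {}"
      using leaves_fresh_copy[OF v, of p] Cons by auto
    obtain T where T: "S \<subset> T" "T \<subseteq> \<Union>(F1 \<union> F2)" "card (T - S) \<le> s * s" "wt m T \<le> wt m S - \<epsilon> \<or>
     (\<exists>e p1 p2 A1 A2. B \<inter> S = {e} \<and> wt m T \<le> wt m S \<and> \<Union>(T - S) \<inter> \<Union>S \<subseteq> e \<and>
        A1 \<in> F1 \<and> A2 \<in> F1 \<and> fresh A1 T p1 \<and> fresh A2 T p2 \<and> snd p1 \<in> T - S \<and> snd p2 \<in> T - S \<and>
        fst p1 \<notin> \<Union>S \<and> fst p2 \<notin> \<Union>S \<and> apart p1 p2)"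
      using extend_by_B[OF B(1) esS S(1) B(5,4) s] by (elim exE conjE) (rule that)
    show ?thesis
    proof (cases "wt m T \<le> wt m S - \<epsilon>")
      case True
      from degenerate_stepI[OF v T(1-3) True] obtain Q' where "valid_state T Q'" "degenerate_step m (s * s) \<epsilon> (S, Q) (T, Q')"
        by (elim exE conjE) (rule that)
      thus ?thesis by (intro exI[of _ T] exI[of _ Q'] conjI disjI2)
    next
      case False
      from mp[OF T(4)[unfolded disj_imp] False] obtain e p1 p2 A1 A2 where r: "B \<inter> S = {e}" "wt m T \<le> wt m S" "\<Union>(T - S) \<inter> \<Union>S \<subseteq> e"
        "A1 \<in> F1" "A2 \<in> F1" "fresh A1 T p1" "fresh A2 T p2" "snd p1 \<in> T - S" "snd p2 \<in> T - S"
        "fst p1 \<notin> \<Union>S" "fst p2 \<notin> \<Union>S" "apart p1 p2"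
        by (elim exE conjE) (rule that)
      have e: "e = snd p" using r(1) B by auto
      \<comment> \<open>Entries are pairwise apart, hence no other queued vertex lies on e; the new
        edges meet S only in e, so the other entries stay fresh.\<close>
      have q0: "fst q \<notin> e" if "q \<in> set Q0" for q
        using ap that unfolding Cons e by (auto simp: apart_def)
      have qS: "fst q \<in> snd q" "snd q \<in> S" "snd q \<subseteq> \<Union>S" "fst q \<in> \<Union>S" if "q \<in> set Q0" for q
        using fr that unfolding Cons fresh_def by auto
      have qT: "fst q \<notin> \<Union>(T - S)" if "q \<in> set Q0" for q
        using q0[OF that] qS(4)[OF that] r(3) by blast
      have apq: "apart q p1" "apart q p2" if "q \<in> set Q0" for q
        using qT[OF that] qS[OF that] r(8-11) unfolding apart_def by blast+
      have "valid_state T (Q0 @ [p1, p2])"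
        unfolding valid_state_def
      proof (intro conjI)
        show "T \<noteq> {}" using T by auto
        show "T \<subseteq> \<Union>(F1 \<union> F2)" by fact
        have "\<exists>A\<in>F1. fresh A T q" if "q \<in> set Q0" for q
        proof -
          obtain A where "A \<in> F1" "fresh A S q" using fr \<open>q \<in> set Q0\<close> unfolding Cons by auto
          thus ?thesis using fresh_mono[OF _ psubset_imp_subset[OF T(1)] qT[OF that]] by blast
        qed
        thus "\<forall>q\<in>set (Q0 @ [p1, p2]). \<exists>A\<in>F1. fresh A T q" using r by auto
        show "sorted_wrt apart (Q0 @ [p1, p2])"
          using ap apq r(12) unfolding Cons by (simp add: sorted_wrt_append)
      qed
      moreover have "queue_step m (s * s) (S, Q) (T, Q0 @ [p1, p2])"
      proof -
        have in1: "fst p1 \<in> snd p1" "fst p2 \<in> snd p2" using r(6,7) unfolding fresh_def by auto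
        show ?thesis
          unfolding queue_step_def prod.case
          by (intro conjI exI[of _ p] exI[of _ Q0] exI[of _ p1] exI[of _ p2])
            (rule T r(2) r(3)[unfolded e] Cons B r(8,9) in1 refl)+
      qed
      ultimately show ?thesis by (intro exI[of _ T] exI[of _ "Q0 @ [p1, p2]"] conjI disjI1)
    qed
  next
    case Nil
    obtain M where M: "M \<in> F1 \<union> F2" "M \<inter> S \<noteq> {}" "\<not> M \<subseteq> S"
      using conn[OF S(2)] SL S(1) by blast
    have fs: ?thesis if T: "S \<subset> T" "T \<subseteq> \<Union>(F1 \<union> F2)" "card (T - S) \<le> s * s" "wt m T \<le> wt m S"
        "A \<in> F1" "fresh A T p" "snd p \<in> T - S" for T A p
    proof -
      have "valid_state T [p]" unfolding valid_state_def using T by auto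
      moreover have "free_step m (s * s) (S, Q) (T, [p])"
      proof -
        have in1: "fst p \<in> snd p" using T(6) unfolding fresh_def by auto
        show ?thesis unfolding free_step_def prod.case
          by (intro conjI exI[of _ p]) (rule T(1,3,4,7) Nil in1 refl)+
      qed
      ultimately show ?thesis by (intro exI[of _ T] exI[of _ "[p]"] conjI disjI2[OF disjI1])
    qed
    have ds: ?thesis if T: "S \<subset> T" "T \<subseteq> \<Union>(F1 \<union> F2)" "card (T - S) \<le> s * s" "wt m T \<le> wt m S - \<epsilon>" for T
    proof -
      from degenerate_stepI[OF v that] obtain Q' where "valid_state T Q'" "degenerate_step m (s * s) \<epsilon> (S, Q) (T, Q')"
        by (elim exE conjE) (rule that)
      thus ?thesis by (intro exI[of _ T] exI[of _ Q'] conjI disjI2)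
    qed
    show ?thesis
    proof (cases "M \<in> F1")
      case True
      have st1: "S \<subset> S \<union> M" and st2: "S \<union> M \<subseteq> \<Union>(F1 \<union> F2)" using S M by auto
      have "card (S \<union> M - S) \<le> card M"
        using balancedD(2)[OF bal1[OF True]] by (intro card_mono) auto
      hence st3: "card (S \<union> M - S) \<le> s * s" using bspec[OF s M(1)] le_square[of s] by linarith
      show ?thesis
      proof (cases "wt m (S \<union> M) \<le> wt m S - \<epsilon>")
        case le: True
        show ?thesis by (rule ds[OF st1 st2 st3 le])
      next
        case nle: False
        from mp[OF extend_by_A[OF True esS M(2,3), unfolded disj_imp] nle] obtain p where
          p: "wt m (S \<union> M) \<le> wt m S" "fresh M (S \<union> M) p" "snd p \<in> M - S" by (elim exE conjE) (rule that)
        have "snd p \<in> S \<union> M - S" using p(3) by simp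
        thus ?thesis by (rule fs[OF st1 st2 st3 p(1) True p(2)])
      qed
    next
      case False
      hence MF: "M \<in> F2" using M by auto
      obtain T where T: "S \<subset> T" "T \<subseteq> \<Union>(F1 \<union> F2)" "card (T - S) \<le> s * s" "wt m T \<le> wt m S - \<epsilon> \<or>
     (\<exists>e p1 p2 A1 A2. M \<inter> S = {e} \<and> wt m T \<le> wt m S \<and> \<Union>(T - S) \<inter> \<Union>S \<subseteq> e \<and>
        A1 \<in> F1 \<and> A2 \<in> F1 \<and> fresh A1 T p1 \<and> fresh A2 T p2 \<and> snd p1 \<in> T - S \<and> snd p2 \<in> T - S \<and>
        fst p1 \<notin> \<Union>S \<and> fst p2 \<notin> \<Union>S \<and> apart p1 p2)"
        using extend_by_B[OF MF esS S(1) M(2,3) s] by (elim exE conjE) (rule that)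
      show ?thesis
      proof (cases "wt m T \<le> wt m S - \<epsilon>")
        case True
        thus ?thesis by (rule ds[OF T(1-3)])
      next
        case False
        \<comment> \<open>Of the two fresh pairs only one is kept, as a free step creates a single
          entry.\<close>
        from mp[OF T(4)[unfolded disj_imp] False] show ?thesis
          by (elim exE conjE) (rule fs[OF T(1-3)])
      qed
    qed
  qed
qed

end

section \<open>First moments in the binomial random graph\<close>

lemma finite_all_pairs [simp]: "finite (all_pairs n)"
  unfolding all_pairs_def by (rule finite_subset[of _ "Pow {1..n}"]) auto

lemma edge_set_all_pairs: "S \<subseteq> all_pairs n \<Longrightarrow> edge_set S"
  unfolding edge_set_def using finite_subset[OF _ finite_all_pairs, of S n] by (auto simp: all_pairs_def)

lemma Union_all_pairs: "S \<subseteq> all_pairs n \<Longrightarrow> \<Union>S \<subseteq> {1..n}"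
  unfolding all_pairs_def by auto

lemma prob_gnp_contains:
  assumes "A \<subseteq> all_pairs n" "0 \<le> p" "p \<le> 1"
  shows "measure_pmf.prob (gnp n p) {G. A \<subseteq> edges G} = p ^ card A"
proof -
  have "measure_pmf.prob (gnp n p) {G. A \<subseteq> edges G} =
      measure_pmf.prob (Pi_pmf (all_pairs n) False (\<lambda>_. bernoulli_pmf p)) (Pi (all_pairs n) (\<lambda>e. if e \<in> A then {True} else UNIV))"
    unfolding gnp_def measure_map_pmf
    by (intro arg_cong2[where f = measure] refl) (use assms(1) in \<open>auto simp: Pi_def split: if_splits\<close>)
  also have "\<dots> = (\<Prod>e\<in>all_pairs n. measure_pmf.prob (bernoulli_pmf p) (if e \<in> A then {True} else UNIV))"
    by (intro measure_Pi_pmf_Pi) auto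
  also have "\<dots> = (\<Prod>e\<in>all_pairs n. if e \<in> A then p else 1)"
    using assms by (intro prod.cong refl) (auto simp: measure_pmf_single)
  also have "\<dots> = (\<Prod>e\<in>A. p)"
    using assms(1) by (subst prod.inter_restrict[symmetric]) (auto simp: Int_absorb1)
  finally show ?thesis by simp
qed

lemma prob_gnp_Bex_le:
  assumes "finite I" "\<And>i. i \<in> I \<Longrightarrow> f i \<subseteq> all_pairs n" "0 \<le> p" "p \<le> 1"
  shows "measure_pmf.prob (gnp n p) {G. \<exists>i\<in>I. f i \<subseteq> edges G} \<le> (\<Sum>i\<in>I. p ^ card (f i))"
proof -
  have "{G. \<exists>i\<in>I. f i \<subseteq> edges G} = (\<Union>i\<in>I. {G. f i \<subseteq> edges G})" by auto
  hence "measure_pmf.prob (gnp n p) {G. \<exists>i\<in>I. f i \<subseteq> edges G} \<le> (\<Sum>i\<in>I. measure_pmf.prob (gnp n p) {G. f i \<subseteq> edges G})"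
    using measure_pmf.finite_measure_subadditive_finite[of I "\<lambda>i. {G. f i \<subseteq> edges G}" "gnp n p"] assms(1) by simp
  also have "\<dots> = (\<Sum>i\<in>I. p ^ card (f i))"
    using assms by (intro sum.cong refl prob_gnp_contains) auto
  finally show ?thesis .
qed

section \<open>Expected number of extensions\<close>

lemma card_small_subsets_le:
  assumes "finite P"
  shows "card {X. X \<subseteq> P \<and> X \<noteq> {} \<and> card X \<le> k} \<le> card P ^ k"
proof -
  have "{X. X \<subseteq> P \<and> X \<noteq> {} \<and> card X \<le> k} \<subseteq> (\<lambda>f. f ` {..<k}) ` (PiE {..<k} (\<lambda>_. P))"
  proof
    fix X assume "X \<in> {X. X \<subseteq> P \<and> X \<noteq> {} \<and> card X \<le> k}"
    hence X: "X \<subseteq> P" "X \<noteq> {}" "card X \<le> k" by auto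
    have fX: "finite X" using X(1) assms finite_subset by auto
    obtain h where h: "bij_betw h {0..<card X} X" using ex_bij_betw_nat_finite[OF fX] by auto
    have hX: "h i \<in> X" if "i < card X" for i using bij_betwE[OF h] that by auto
    \<comment> \<open>Sets with fewer than k elements are enumerated by repeating a member
      a.\<close>
    obtain a where a: "a \<in> X" using X by auto
    define f where "f = (\<lambda>i. if i < k then (if i < card X then h i else a) else undefined)"
    have "f \<in> PiE {..<k} (\<lambda>_. P)"
      unfolding f_def using hX X(1) a by (auto simp: PiE_def extensional_def)
    moreover have "f ` {..<k} = X"
    proof
      show "f ` {..<k} \<subseteq> X" unfolding f_def using a hX by auto
      show "X \<subseteq> f ` {..<k}"
      proof
        fix y assume "y \<in> X"
        hence "y \<in> h ` {0..<card X}" using h unfolding bij_betw_def by simp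
        then obtain i where "i < card X" "h i = y" by auto
        thus "y \<in> f ` {..<k}" unfolding f_def using X(3) by (intro image_eqI[of _ _ i]) auto
      qed
    qed
    ultimately show "X \<in> (\<lambda>f. f ` {..<k}) ` (PiE {..<k} (\<lambda>_. P))" by blast
  qed
  moreover have fin: "finite (PiE {..<k} (\<lambda>_. P))" using assms by (intro finite_PiE) auto
  ultimately have "card {X. X \<subseteq> P \<and> X \<noteq> {} \<and> card X \<le> k} \<le> card (PiE {..<k} (\<lambda>_. P))"
    by (meson card_image_le card_mono finite_imageI le_trans)
  thus ?thesis by (simp add: card_PiE)
qed

lemma sum_UN_le:
  fixes f :: "'b \<Rightarrow> real"
  assumes "finite I" "\<And>i. i \<in> I \<Longrightarrow> finite (A i)" "\<And>x. 0 \<le> f x"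
  shows "sum f (\<Union>i\<in>I. A i) \<le> (\<Sum>i\<in>I. sum f (A i))"
  using assms(1,2)
proof (induction I rule: finite_induct)
  case (insert i I)
  have "sum f (A i \<union> (\<Union>i\<in>I. A i)) \<le> sum f (A i) + sum f (\<Union>i\<in>I. A i)"
    using insert assms(3) by (subst sum.union_inter[symmetric]) (auto intro: sum_nonneg)
  thus ?case using insert by auto
qed simp

text \<open>The new edges may meet the old vertices only inside F. Limiting F, instead of counting
  contacts with all of S, keeps the number of outcomes of a queue step independent of the size of
  S.\<close>

definition extensions :: "real \<Rightarrow> nat \<Rightarrow> real \<Rightarrow> nat \<Rightarrow> nat set set \<Rightarrow> nat set \<Rightarrow> nat set set set" where
  "extensions m \<kappa> \<eta> n S F = {X. X \<subseteq> all_pairs n \<and> X \<inter> S = {} \<and> X \<noteq> {} \<and> card X \<le> \<kappa> \<and>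
     \<Union>X \<inter> \<Union>S \<subseteq> F \<and> wt m (S \<union> X) \<le> wt m S - \<eta>}"

lemma finite_extensions: "finite (extensions m \<kappa> \<eta> n S F)"
  by (rule finite_subset[of _ "Pow (all_pairs n)"]) (auto simp: extensions_def)

text \<open>Of the a factors c one is kept, by c \<le> 1 and a \<ge> 1; it is the source of all
  decay in regular steps.\<close>

lemma power_le_powr:
  assumes "0 \<le> p" "p \<le> c * real n powr (- 1 / m)" "0 < c" "c \<le> 1" "n \<ge> 1" "a \<ge> 1"
  shows "p ^ a \<le> c * real n powr (- real a / m)"
proof -
  have "p ^ a \<le> (c * real n powr (- 1 / m)) ^ a" using assms by (intro power_mono) auto
  also have "\<dots> = c ^ a * real n powr (- real a / m)"
    using assms(5) by (simp add: power_mult_distrib powr_power)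
  also have "\<dots> \<le> c * real n powr (- real a / m)"
    using assms power_decreasing[of 1 a c] by (intro mult_right_mono) auto
  finally show ?thesis .
qed

text \<open>Choose b new vertices in at most n^b ways and then X among the pairs of F and these
  vertices, in a number of ways independent of n. The weight condition reads b - card X / m \<le>
  -\<eta>, so p^(card X) is at most c n^(-\<eta> - b) and the powers n^b cancel.\<close>

lemma sum_extensions_le:
  assumes S: "S \<subseteq> all_pairs n" and F: "finite F"
    and p: "0 \<le> p" "p \<le> c * real n powr (- 1 / m)" "0 < c" "c \<le> 1" and n: "n \<ge> 1" and m: "0 < m"
  shows "(\<Sum>X\<in>extensions m \<kappa> \<eta> n S F. p ^ card X)
    \<le> real (2 * \<kappa> + 1) * real (card F + 2 * \<kappa>) ^ (2 * \<kappa>) * c * real n powr (- \<eta>)"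
proof -
  define prs where "prs Z = {e. e \<subseteq> F \<union> Z \<and> card e = 2}" for Z
  define ZS where "ZS b = {Z. Z \<subseteq> {1..n} \<and> card Z = b}" for b
  define G where "G b Z = {X. X \<subseteq> prs Z \<and> X \<noteq> {} \<and> card X \<le> \<kappa> \<and> real b - real (card X) / m \<le> - \<eta>}" for b Z
  have esS: "edge_set S" and finVS: "finite (\<Union>S)"
    using edge_set_all_pairs[OF S] edge_set_Union_finite by auto
  have finZS: "finite (ZS b)" for b unfolding ZS_def by (rule finite_subset[of _ "Pow {1..n}"]) auto
  have finprs: "finite (prs Z)" if "finite Z" for Z
    unfolding prs_def by (rule finite_subset[of _ "Pow (F \<union> Z)"]) (use that F in auto)
  have finZ: "finite Z" if "Z \<in> ZS b" for Z b using that finite_subset[of Z "{1..n}"] unfolding ZS_def by simp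
  have finG: "finite (G b Z)" if "Z \<in> ZS b" for Z b
    unfolding G_def by (rule finite_subset[of _ "Pow (prs Z)"]) (use finprs[OF finZ[OF that]] in auto)
  have sub: "extensions m \<kappa> \<eta> n S F \<subseteq> (\<Union>b\<in>{..2*\<kappa>}. \<Union>Z\<in>ZS b. G b Z)"
  proof
    fix X assume "X \<in> extensions m \<kappa> \<eta> n S F"
    hence X: "X \<subseteq> all_pairs n" "X \<inter> S = {}" "X \<noteq> {}" "card X \<le> \<kappa>"
     "\<Union>X \<inter> \<Union>S \<subseteq> F" "wt m (S \<union> X) \<le> wt m S - \<eta>" unfolding extensions_def by auto
    have esX: "edge_set X" using X(1) by (rule edge_set_all_pairs)
    define Z where "Z = \<Union>X - \<Union>S"
    have finX: "finite (\<Union>X)" using esX by (rule edge_set_Union_finite)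
    have Zn: "Z \<subseteq> {1..n}" unfolding Z_def using Union_all_pairs[OF X(1)] by auto
    have "card Z \<le> card (\<Union>X)" unfolding Z_def using finX by (intro card_mono) auto
    also have "\<dots> \<le> 2 * card X" using card_Union_edges_le[OF esX] .
    finally have b: "card Z \<le> 2 * \<kappa>" using X(4) by simp
    have "X \<subseteq> prs Z"
    proof
      fix e assume e: "e \<in> X"
      hence "card e = 2" using esX unfolding edge_set_def by auto
      moreover have "e \<subseteq> F \<union> Z" unfolding Z_def using X(5) e by blast
      ultimately show "e \<in> prs Z" unfolding prs_def by auto
    qed
    moreover have "real (card Z) - real (card X) / m \<le> - \<eta>"
    proof -
      have "\<Union>(S \<union> X) = \<Union>S \<union> Z" unfolding Z_def by auto
      moreover have "card (\<Union>S \<union> Z) = card (\<Union>S) + card Z"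
        by (intro card_Un_disjoint) (use finVS finX Z_def in auto)
      ultimately have "card (\<Union>(S \<union> X)) = card (\<Union>S) + card Z" by simp
      moreover have "card (S \<union> X) = card S + card X"
        using esS esX X(2) unfolding edge_set_def by (intro card_Un_disjoint) auto
      hence "real (card (S \<union> X)) / m = real (card S) / m + real (card X) / m" by (simp add: add_divide_distrib)
      ultimately show ?thesis using X(6) unfolding wt_def by linarith
    qed
    ultimately have "X \<in> G (card Z) Z" unfolding G_def using X by simp
    moreover have "Z \<in> ZS (card Z)" unfolding ZS_def using Zn by simp
    ultimately show "X \<in> (\<Union>b\<in>{..2*\<kappa>}. \<Union>Z\<in>ZS b. G b Z)" using b by blast
  qed
  let ?M = "real (card F + 2 * \<kappa>) ^ (2 * \<kappa>)"
  have one: "(\<Sum>X\<in>G b Z. p ^ card X) \<le> ?M * (c * real n powr (- \<eta> - real b))"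
    if b: "b \<le> 2 * \<kappa>" and Z: "Z \<in> ZS b" for b Z
  proof -
    have "(\<Sum>X\<in>G b Z. p ^ card X) \<le> (\<Sum>X\<in>G b Z. c * real n powr (- \<eta> - real b))"
    proof (rule sum_mono)
      fix X assume X: "X \<in> G b Z"
      have "finite X" using X finprs[OF finZ[OF Z]] unfolding G_def by (auto intro: finite_subset)
      hence "card X \<ge> 1" using X unfolding G_def by (simp add: Suc_le_eq card_gt_0_iff)
      hence "p ^ card X \<le> c * real n powr (- real (card X) / m)" using p n by (intro power_le_powr) auto
      also have "\<dots> \<le> c * real n powr (- \<eta> - real b)"
        using X p n unfolding G_def by (intro mult_left_mono powr_mono) (auto simp: algebra_simps)
      finally show "p ^ card X \<le> c * real n powr (- \<eta> - real b)" .
    qed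
    also have "\<dots> = real (card (G b Z)) * (c * real n powr (- \<eta> - real b))" by simp
    also have "\<dots> \<le> ?M * (c * real n powr (- \<eta> - real b))"
    proof (rule mult_right_mono)
      have fFZ: "finite (F \<union> Z)" using F finZ[OF Z] by auto
      have "card (F \<union> Z) \<le> card F + card Z" by (rule card_Un_le)
      also have "card Z = b" using Z unfolding ZS_def by auto
      finally have cFZ: "card (F \<union> Z) \<le> card F + 2 * \<kappa>" using b by simp
      have "card (prs Z) = card (F \<union> Z) choose 2" unfolding prs_def using fFZ by (rule n_subsets)
      also have "\<dots> \<le> card (F \<union> Z) ^ 2"
        by (cases "2 \<le> card (F \<union> Z)") (auto intro: binomial_le_pow simp: binomial_eq_0)
      also have "\<dots> \<le> (card F + 2 * \<kappa>) ^ 2" using cFZ by (intro power_mono) auto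
      finally have cp: "card (prs Z) \<le> (card F + 2 * \<kappa>) ^ 2" .
      have "card (G b Z) \<le> card {X. X \<subseteq> prs Z \<and> X \<noteq> {} \<and> card X \<le> \<kappa>}"
        unfolding G_def using finprs[OF finZ[OF Z]]
        by (intro card_mono; (rule finite_subset[of "{X. X \<subseteq> prs Z \<and> X \<noteq> {} \<and> card X \<le> \<kappa>}" "Pow (prs Z)"])?) auto
      also have "\<dots> \<le> card (prs Z) ^ \<kappa>" using finprs[OF finZ[OF Z]] by (rule card_small_subsets_le)
      also have "\<dots> \<le> ((card F + 2 * \<kappa>) ^ 2) ^ \<kappa>" using cp by (intro power_mono) auto
      finally have "card (G b Z) \<le> (card F + 2 * \<kappa>) ^ (2 * \<kappa>)" by (simp add: power_mult)
      thus "real (card (G b Z)) \<le> ?M" by (metis of_nat_le_iff of_nat_power)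
    qed (use p in auto)
    finally show ?thesis .
  qed
  have "(\<Sum>X\<in>extensions m \<kappa> \<eta> n S F. p ^ card X) \<le> (\<Sum>X\<in>(\<Union>b\<in>{..2*\<kappa>}. \<Union>Z\<in>ZS b. G b Z). p ^ card X)"
    using sub p finZS finG by (intro sum_mono2) auto
  also have "\<dots> \<le> (\<Sum>b\<in>{..2*\<kappa>}. \<Sum>X\<in>(\<Union>Z\<in>ZS b. G b Z). p ^ card X)"
    using finZS finG p by (intro sum_UN_le) auto
  also have "\<dots> \<le> (\<Sum>b\<in>{..2*\<kappa>}. \<Sum>Z\<in>ZS b. \<Sum>X\<in>G b Z. p ^ card X)"
    using finZS finG p by (intro sum_mono sum_UN_le) auto
  also have "\<dots> \<le> (\<Sum>b\<in>{..2*\<kappa>}. \<Sum>Z\<in>ZS b. ?M * (c * real n powr (- \<eta> - real b)))"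
    by (intro sum_mono one) auto
  also have "\<dots> \<le> (\<Sum>b\<in>{..2*\<kappa>}. ?M * (c * real n powr (- \<eta>)))"
  proof (rule sum_mono)
    fix b
    have "card (ZS b) = n choose b" unfolding ZS_def by (subst n_subsets) auto
    also have "\<dots> \<le> n ^ b" by (cases "b \<le> n") (auto intro: binomial_le_pow simp: binomial_eq_0)
    finally have "real (card (ZS b)) \<le> real n ^ b" by (metis of_nat_le_iff of_nat_power)
    hence "real (card (ZS b)) \<le> real n powr real b" using n by (simp add: powr_realpow)
    hence "real (card (ZS b)) * (?M * (c * real n powr (- \<eta> - real b))) \<le> real n powr real b * (?M * (c * real n powr (- \<eta> - real b)))"
      using p by (intro mult_right_mono) auto
    also have "\<dots> = ?M * (c * (real n powr real b * real n powr (- \<eta> - real b)))" by simp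
    also have "real n powr real b * real n powr (- \<eta> - real b) = real n powr (- \<eta>)"
      by (simp add: powr_add[symmetric])
    finally show "(\<Sum>Z\<in>ZS b. ?M * (c * real n powr (- \<eta> - real b))) \<le> ?M * (c * real n powr (- \<eta>))"
      by simp
  qed
  also have "\<dots> = real (2 * \<kappa> + 1) * ?M * c * real n powr (- \<eta>)" by simp
  finally show ?thesis .
qed

section \<open>Histories of the exploration in the complete graph, without reference to a
  core\<close>

inductive reach :: "nat \<Rightarrow> real \<Rightarrow> nat \<Rightarrow> real \<Rightarrow> nat \<Rightarrow> nat \<Rightarrow> nat set set \<times> (nat \<times> nat set) list \<Rightarrow> bool"
  for n m \<kappa> \<epsilon> where
  start: "e \<in> all_pairs n \<Longrightarrow> reach n m \<kappa> \<epsilon> 0 0 ({e}, [])"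
| regular: "reach n m \<kappa> \<epsilon> t d s \<Longrightarrow> queue_step m \<kappa> s s' \<or> free_step m \<kappa> s s' \<Longrightarrow> fst s' \<subseteq> all_pairs n \<Longrightarrow>
    reach n m \<kappa> \<epsilon> (Suc t) d s'"
| degenerate: "reach n m \<kappa> \<epsilon> t d s \<Longrightarrow> degenerate_step m \<kappa> \<epsilon> s s' \<Longrightarrow> fst s' \<subseteq> all_pairs n \<Longrightarrow>
    reach n m \<kappa> \<epsilon> (Suc t) (Suc d) s'"

lemma reach_edges: "reach n m \<kappa> \<epsilon> t d s \<Longrightarrow> fst s \<subseteq> all_pairs n"
  by (induction rule: reach.induct) auto

lemma card_fst_step:
  assumes "S \<subset> T" "card (T - S) \<le> \<kappa>" "finite T"
  shows "card T \<le> card S + \<kappa>"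
proof -
  have "card T = card S + card (T - S)"
    using assms by (metis card_Diff_subset card_mono finite_subset le_add_diff_inverse psubset_imp_subset)
  thus ?thesis using assms by simp
qed

lemma step_cases:
  assumes "queue_step m \<kappa> s s' \<or> free_step m \<kappa> s s' \<or> degenerate_step m \<kappa> \<epsilon> s s'"
  shows "fst s \<subset> fst s'" "card (fst s' - fst s) \<le> \<kappa>"
  using assms unfolding queue_step_def free_step_def degenerate_step_def by (auto split: prod.splits)

lemma reach_card: "reach n m \<kappa> \<epsilon> t d s \<Longrightarrow> card (fst s) \<le> 1 + \<kappa> * t"
proof (induction rule: reach.induct)
  case (regular t d s s')
  have "card (fst s') \<le> card (fst s) + \<kappa>"
    using step_cases[of m \<kappa> s s'] regular by (intro card_fst_step finite_subset[OF regular(3)]) auto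
  thus ?case using regular by simp
next
  case (degenerate t d s s')
  have "card (fst s') \<le> card (fst s) + \<kappa>"
    using step_cases[of m \<kappa> s s' \<epsilon>] degenerate by (intro card_fst_step finite_subset[OF degenerate(3)]) auto
  thus ?case using degenerate by simp
qed auto

text \<open>t counts all steps and d the degenerate ones. A regular step adds an entry and a
  degenerate one removes at most 2 \<kappa>. An empty queue therefore bounds the number of steps,
  and with it the explored set, in terms of d.\<close>

lemma reach_length: "reach n m \<kappa> \<epsilon> t d s \<Longrightarrow> t \<le> length (snd s) + (2 * \<kappa> + 1) * d"
proof (induction rule: reach.induct)
  case (regular t d s s')
  have "length (snd s') \<ge> length (snd s) + 1"
    using regular(2) unfolding queue_step_def free_step_def by (auto split: prod.splits)
  thus ?case using regular by simp
next
  case (degenerate t d s s')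
  have "length (snd s) \<le> length (snd s') + 2 * \<kappa>"
    using degenerate(2) unfolding degenerate_step_def by (auto split: prod.splits)
  thus ?case using degenerate by simp
qed auto

text \<open>Every successor state is coded by its new edges X and a tag from \<open>Y X\<close>,
  from which the new queue is computed. Several codes for one state only increase the bound.\<close>

lemma sum_tagged_extensions_le:
  fixes K :: nat
  assumes N: "N \<subseteq> (\<lambda>(X, y). (S \<union> X, g X y)) ` (SIGMA X:extensions m \<kappa> \<eta> n S F. Y X)"
    and Y: "\<And>X. X \<in> extensions m \<kappa> \<eta> n S F \<Longrightarrow> finite (Y X) \<and> card (Y X) \<le> K"
    and S: "S \<subseteq> all_pairs n" and p: "0 \<le> p"
  shows "finite N" "(\<Sum>s\<in>N. p ^ card (fst s)) \<le> p ^ card S * (real K * (\<Sum>X\<in>extensions m \<kappa> \<eta> n S F. p ^ card X))"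
proof -
  let ?E = "extensions m \<kappa> \<eta> n S F"
  let ?D = "SIGMA X:?E. Y X"
  have finD: "finite ?D" using Y finite_extensions by (intro finite_SigmaI) auto
  thus "finite N" using N finite_subset by blast
  have "(\<Sum>s\<in>N. p ^ card (fst s)) \<le> (\<Sum>s\<in>(\<lambda>(X, y). (S \<union> X, g X y)) ` ?D. p ^ card (fst s))"
    using N finD p by (intro sum_mono2) auto
  also have "\<dots> \<le> (\<Sum>z\<in>?D. p ^ card (S \<union> fst z))"
    using sum_image_le[OF finD, of "\<lambda>s. p ^ card (fst s)" "\<lambda>(X, y). (S \<union> X, g X y)"] p
    by (auto simp: o_def case_prod_beta)
  also have "\<dots> = (\<Sum>X\<in>?E. \<Sum>y\<in>Y X. p ^ card (S \<union> X))"
    using Y finite_extensions by (subst sum.Sigma) (auto simp: case_prod_beta)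
  also have "\<dots> \<le> (\<Sum>X\<in>?E. real K * (p ^ card S * p ^ card X))"
  proof (rule sum_mono)
    fix X assume X: "X \<in> ?E"
    have fin: "finite S" "finite X" using S X finite_subset[OF _ finite_all_pairs] unfolding extensions_def by auto
    have "card (S \<union> X) = card S + card X" using fin X unfolding extensions_def by (intro card_Un_disjoint) auto
    hence "(\<Sum>y\<in>Y X. p ^ card (S \<union> X)) = real (card (Y X)) * (p ^ card S * p ^ card X)" by (simp add: power_add)
    also have "\<dots> \<le> real K * (p ^ card S * p ^ card X)" using Y[OF X] p by (intro mult_right_mono) auto
    finally show "(\<Sum>y\<in>Y X. p ^ card (S \<union> X)) \<le> real K * (p ^ card S * p ^ card X)" .
  qed
  also have "\<dots> = p ^ card S * (real K * (\<Sum>X\<in>?E. p ^ card X))"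
    by (simp add: sum_distrib_left mult_ac)
  finally show "(\<Sum>s\<in>N. p ^ card (fst s)) \<le> p ^ card S * (real K * (\<Sum>X\<in>?E. p ^ card X))" .
qed

lemma extensionsI:
  assumes "S \<subset> T" "T \<subseteq> all_pairs n" "card (T - S) \<le> \<kappa>" "\<Union>(T - S) \<inter> \<Union>S \<subseteq> F" "wt m T \<le> wt m S - \<eta>"
  shows "T - S \<in> extensions m \<kappa> \<eta> n S F"
proof -
  have "S \<union> (T - S) = T" using assms by auto
  thus ?thesis using assms unfolding extensions_def by auto
qed

text \<open>A crude superset of the possible new queue entries, of size bounded in terms of
  \<kappa>.\<close>

definition tags :: "nat set set \<Rightarrow> (nat \<times> nat set) set" where
  "tags X = \<Union>X \<times> X"

lemma tags_bound:
  assumes "X \<in> extensions m \<kappa> \<eta> n S F"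
  shows "finite (tags X) \<and> card (tags X) \<le> 2 * \<kappa> * \<kappa>"
proof -
  have es: "edge_set X" using assms edge_set_all_pairs unfolding extensions_def by auto
  have k: "card X \<le> \<kappa>" using assms unfolding extensions_def by auto
  have "card (\<Union>X) \<le> 2 * \<kappa>" using card_Union_edges_le[OF es] k by simp
  hence "card (tags X) \<le> 2 * \<kappa> * \<kappa>" unfolding tags_def card_cartesian_product using k by (intro mult_mono) auto
  thus ?thesis unfolding tags_def using es edge_set_Union_finite unfolding edge_set_def by auto
qed

lemma sum_queue_step_le:
  fixes \<kappa> :: nat and Q :: "(nat \<times> nat set) list"
  assumes S: "S \<subseteq> all_pairs n" and p: "0 \<le> p" "p \<le> c * real n powr (- 1 / m)" "0 < c" "c \<le> 1"
    and n: "n \<ge> 1" and m: "0 < m"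
  defines "N \<equiv> {s'. queue_step m \<kappa> (S, Q) s' \<and> fst s' \<subseteq> all_pairs n}"
  shows "finite N" "(\<Sum>s\<in>N. p ^ card (fst s)) \<le>
     p ^ card S * (real ((2 * \<kappa> * \<kappa>) ^ 2) * (real (2 * \<kappa> + 1) * real (2 + 2 * \<kappa>) ^ (2 * \<kappa>) * c))"
proof -
  \<comment> \<open>Only the edge at the front of the queue may be touched. It has two vertices, so
    the size of S does not affect the number of choices; the default value {} covers queues that
    permit no queue step.\<close>
  define F where "F = (if Q \<noteq> [] \<and> snd (hd Q) \<in> S then snd (hd Q) else {})"
  let ?E = "extensions m \<kappa> 0 n S F"
  have F: "finite F \<and> card F \<le> 2"
  proof (cases "Q \<noteq> [] \<and> snd (hd Q) \<in> S")
    case True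
    hence "card F = 2" using edge_set_all_pairs[OF S] unfolding F_def edge_set_def by auto
    thus ?thesis by (metis card.infinite le_refl zero_neq_numeral)
  qed (simp only: F_def if_False, simp)
  have N: "N \<subseteq> (\<lambda>(X, y). (S \<union> X, tl Q @ [fst y, snd y])) ` (SIGMA X:?E. tags X \<times> tags X)"
  proof
    fix s' assume s': "s' \<in> N"
    obtain T Q' where TQ: "s' = (T, Q')" by (cases s')
    have "queue_step m \<kappa> (S, Q) (T, Q')" and TA: "T \<subseteq> all_pairs n" using s' TQ unfolding N_def by auto
    then obtain q Q0 p1 p2 where st: "S \<subset> T" "card (T - S) \<le> \<kappa>" "wt m T \<le> wt m S" "Q = q # Q0" "snd q \<in> S"
      "\<Union>(T - S) \<inter> \<Union>S \<subseteq> snd q" "Q' = Q0 @ [p1, p2]"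
        "fst p1 \<in> snd p1" "snd p1 \<in> T - S" "fst p2 \<in> snd p2" "snd p2 \<in> T - S"
      unfolding queue_step_def prod.case by (elim exE conjE) (rule that)
    have "F = snd q" unfolding F_def using st by simp
    hence X: "T - S \<in> ?E" using st TA by (intro extensionsI) auto
    have "p1 \<in> tags (T - S)" "p2 \<in> tags (T - S)"
      unfolding tags_def using st by (cases p1; cases p2; auto)+
    moreover have "s' = (\<lambda>(X, y). (S \<union> X, tl Q @ [fst y, snd y])) (T - S, (p1, p2))"
      using TQ st by auto
    ultimately show "s' \<in> (\<lambda>(X, y). (S \<union> X, tl Q @ [fst y, snd y])) ` (SIGMA X:?E. tags X \<times> tags X)"
      using X by (intro image_eqI[of _ _ "(T - S, (p1, p2))"]) auto
  qed
  have Y: "finite (tags X \<times> tags X) \<and> card (tags X \<times> tags X) \<le> (2 * \<kappa> * \<kappa>) ^ 2" if "X \<in> ?E" for X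
  proof -
    have "card (tags X \<times> tags X) = card (tags X) ^ 2" by (simp add: card_cartesian_product power2_eq_square)
    also have "\<dots> \<le> (2 * \<kappa> * \<kappa>) ^ 2" using tags_bound[OF that] by (intro power_mono) auto
    finally show ?thesis using tags_bound[OF that] by auto
  qed
  show "finite N" by (rule sum_tagged_extensions_le(1)[OF N Y S p(1)])
  have "(\<Sum>X\<in>?E. p ^ card X) \<le> real (2 * \<kappa> + 1) * real (card F + 2 * \<kappa>) ^ (2 * \<kappa>) * c * real n powr (- 0)"
    using F by (intro sum_extensions_le S p n m) auto
  also have "\<dots> \<le> real (2 * \<kappa> + 1) * real (2 + 2 * \<kappa>) ^ (2 * \<kappa>) * c * 1"
    using F p n by (intro mult_mono power_mono) auto
  finally have sX: "(\<Sum>X\<in>?E. p ^ card X) \<le> real (2 * \<kappa> + 1) * real (2 + 2 * \<kappa>) ^ (2 * \<kappa>) * c" by simp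
  show "(\<Sum>s\<in>N. p ^ card (fst s)) \<le>
     p ^ card S * (real ((2 * \<kappa> * \<kappa>) ^ 2) * (real (2 * \<kappa> + 1) * real (2 + 2 * \<kappa>) ^ (2 * \<kappa>) * c))"
    by (rule order.trans[OF sum_tagged_extensions_le(2)[OF N Y S p(1)]], assumption)
       (intro mult_left_mono sX, use p in auto)
qed

lemma card_Union_state_le:
  assumes "S \<subseteq> all_pairs n" shows "finite (\<Union>S)" "card (\<Union>S) \<le> 2 * card S"
  using edge_set_all_pairs[OF assms] edge_set_Union_finite card_Union_edges_le by auto

text \<open>New edges may touch every vertex of S, so the bound contains a power of
  \<open>card S\<close>. It is meant for an empty queue, where S has bounded size.\<close>

lemma sum_free_step_le:
  fixes \<kappa> :: nat and Q :: "(nat \<times> nat set) list"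
  assumes S: "S \<subseteq> all_pairs n" and p: "0 \<le> p" "p \<le> c * real n powr (- 1 / m)" "0 < c" "c \<le> 1"
    and n: "n \<ge> 1" and m: "0 < m"
  defines "N \<equiv> {s'. free_step m \<kappa> (S, Q) s' \<and> fst s' \<subseteq> all_pairs n}"
  shows "finite N" "(\<Sum>s\<in>N. p ^ card (fst s)) \<le>
     p ^ card S * (real (2 * \<kappa> * \<kappa>) * (real (2 * \<kappa> + 1) * real (2 * card S + 2 * \<kappa>) ^ (2 * \<kappa>) * c))"
proof -
  let ?E = "extensions m \<kappa> 0 n S (\<Union>S)"
  have N: "N \<subseteq> (\<lambda>(X, y). (S \<union> X, [y])) ` (SIGMA X:?E. tags X)"
  proof
    fix s' assume s': "s' \<in> N"
    obtain T Q' where TQ: "s' = (T, Q')" by (cases s')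
    have "free_step m \<kappa> (S, Q) (T, Q')" and TA: "T \<subseteq> all_pairs n" using s' TQ unfolding N_def by auto
    then obtain q where st: "S \<subset> T" "card (T - S) \<le> \<kappa>" "wt m T \<le> wt m S" "Q' = [q]"
        "fst q \<in> snd q" "snd q \<in> T - S"
      unfolding free_step_def prod.case by (elim exE conjE) (rule that)
    have X: "T - S \<in> ?E" using st TA by (intro extensionsI) auto
    have "q \<in> tags (T - S)" unfolding tags_def using st by (cases q) auto
    moreover have "s' = (\<lambda>(X, y). (S \<union> X, [y])) (T - S, q)"
      using TQ st by auto
    ultimately show "s' \<in> (\<lambda>(X, y). (S \<union> X, [y])) ` (SIGMA X:?E. tags X)"
      using X by (intro image_eqI[of _ _ "(T - S, q)"]) auto
  qed
  have Y: "finite (tags X) \<and> card (tags X) \<le> 2 * \<kappa> * \<kappa>" if "X \<in> ?E" for X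
    using that by (rule tags_bound)
  show "finite N" by (rule sum_tagged_extensions_le(1)[OF N Y S p(1)])
  have "(\<Sum>X\<in>?E. p ^ card X) \<le> real (2 * \<kappa> + 1) * real (card (\<Union>S) + 2 * \<kappa>) ^ (2 * \<kappa>) * c * real n powr (- 0)"
    using card_Union_state_le[OF S] by (intro sum_extensions_le S p n m) auto
  also have "\<dots> \<le> real (2 * \<kappa> + 1) * real (2 * card S + 2 * \<kappa>) ^ (2 * \<kappa>) * c * 1"
    using card_Union_state_le[OF S] p n by (intro mult_mono power_mono) auto
  finally have sX: "(\<Sum>X\<in>?E. p ^ card X) \<le> real (2 * \<kappa> + 1) * real (2 * card S + 2 * \<kappa>) ^ (2 * \<kappa>) * c" by simp
  show "(\<Sum>s\<in>N. p ^ card (fst s)) \<le>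
     p ^ card S * (real (2 * \<kappa> * \<kappa>) * (real (2 * \<kappa> + 1) * real (2 * card S + 2 * \<kappa>) ^ (2 * \<kappa>) * c))"
    by (rule order.trans[OF sum_tagged_extensions_le(2)[OF N Y S p(1)]], assumption)
       (intro mult_left_mono sX, use p in auto)
qed

text \<open>Here c is estimated by 1: the factor n^(-\<epsilon>) outweighs the power of
  \<open>card S\<close>, which is at most polylogarithmic for histories of logarithmic
  length.\<close>

lemma sum_degenerate_step_le:
  fixes \<kappa> :: nat and Q :: "(nat \<times> nat set) list" and \<epsilon> :: real
  assumes S: "S \<subseteq> all_pairs n" and p: "0 \<le> p" "p \<le> c * real n powr (- 1 / m)" "0 < c" "c \<le> 1"
    and n: "n \<ge> 1" and m: "0 < m"
  defines "N \<equiv> {s'. degenerate_step m \<kappa> \<epsilon> (S, Q) s' \<and> fst s' \<subseteq> all_pairs n}"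
  shows "finite N" "(\<Sum>s\<in>N. p ^ card (fst s)) \<le>
     p ^ card S * (real (2 * \<kappa> + 1) * real (2 * card S + 2 * \<kappa>) ^ (2 * \<kappa>) * real n powr (- \<epsilon>))"
proof -
  let ?E = "extensions m \<kappa> \<epsilon> n S (\<Union>S)"
  \<comment> \<open>The new queue is determined by X, so the tag carries no information.\<close>
  define g where "g X y = filter (\<lambda>p. fst p \<notin> \<Union>X) Q" for X and y :: unit
  have N: "N \<subseteq> (\<lambda>(X, y). (S \<union> X, g X y)) ` (SIGMA X:?E. {()})"
  proof
    fix s' assume s': "s' \<in> N"
    obtain T Q' where TQ: "s' = (T, Q')" by (cases s')
    have "degenerate_step m \<kappa> \<epsilon> (S, Q) (T, Q')" and TA: "T \<subseteq> all_pairs n" using s' TQ unfolding N_def by auto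
    then have st: "S \<subset> T" "card (T - S) \<le> \<kappa>" "wt m T \<le> wt m S - \<epsilon>" "Q' = g (T - S) ()"
      unfolding degenerate_step_def prod.case g_def by blast+
    have X: "T - S \<in> ?E" using st TA by (intro extensionsI) auto
    have "s' = (\<lambda>(X, y). (S \<union> X, g X y)) (T - S, ())"
      using TQ st by auto
    thus "s' \<in> (\<lambda>(X, y). (S \<union> X, g X y)) ` (SIGMA X:?E. {()})"
      using X by (intro image_eqI[of _ _ "(T - S, ())"]) auto
  qed
  have Y: "finite {()} \<and> card {()} \<le> 1" by simp
  show "finite N" by (rule sum_tagged_extensions_le(1)[OF N Y S p(1)])
  have "(\<Sum>X\<in>?E. p ^ card X) \<le> real (2 * \<kappa> + 1) * real (card (\<Union>S) + 2 * \<kappa>) ^ (2 * \<kappa>) * c * real n powr (- \<epsilon>)"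
    using card_Union_state_le[OF S] by (intro sum_extensions_le S p n m) auto
  also have "\<dots> \<le> real (2 * \<kappa> + 1) * real (2 * card S + 2 * \<kappa>) ^ (2 * \<kappa>) * 1 * real n powr (- \<epsilon>)"
    using card_Union_state_le[OF S] p n by (intro mult_mono power_mono) auto
  finally have sX: "real 1 * (\<Sum>X\<in>?E. p ^ card X) \<le> real (2 * \<kappa> + 1) * real (2 * card S + 2 * \<kappa>) ^ (2 * \<kappa>) * real n powr (- \<epsilon>)" by simp
  show "(\<Sum>s\<in>N. p ^ card (fst s)) \<le>
     p ^ card S * (real (2 * \<kappa> + 1) * real (2 * card S + 2 * \<kappa>) ^ (2 * \<kappa>) * real n powr (- \<epsilon>))"
    by (rule order.trans[OF sum_tagged_extensions_le(2)[OF N Y S p(1)]])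
       (intro mult_left_mono sX, use p in auto)
qed

definition reachable :: "nat \<Rightarrow> real \<Rightarrow> nat \<Rightarrow> real \<Rightarrow> nat \<Rightarrow> nat \<Rightarrow> (nat set set \<times> (nat \<times> nat set) list) set" where
  "reachable n m \<kappa> \<epsilon> t d = {s. reach n m \<kappa> \<epsilon> t d s}"

lemma sum_over_steps_le:
  fixes R :: "'s set" and N :: "'s \<Rightarrow> 's set" and w :: "'s \<Rightarrow> real"
  assumes "finite R" "\<And>s. s \<in> R \<Longrightarrow> finite (N s)" "\<And>s. 0 \<le> w s" "\<And>s. s \<in> R \<Longrightarrow> sum w (N s) \<le> b * w s"
  shows "sum w (\<Union>s\<in>R. N s) \<le> b * sum w R"
proof -
  have "sum w (\<Union>s\<in>R. N s) \<le> (\<Sum>s\<in>R. sum w (N s))" using assms by (intro sum_UN_le) auto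
  also have "\<dots> \<le> (\<Sum>s\<in>R. b * w s)" using assms by (intro sum_mono) auto
  finally show ?thesis by (simp add: sum_distrib_left)
qed

text \<open>A regular step multiplies the expected number by at most \<gamma>/2 and a degenerate one
  by at most q. With the bound \<gamma>^t (2q/\<gamma>)^d, each of the two possibilities for the
  last step accounts for one half of the next bound. The factor n^2 stands for the starting edges,
  and \<open>s0\<close> bounds the explored set whenever the queue is empty.\<close>

lemma sum_reachable_le:
  fixes \<kappa> D :: nat
  assumes p: "0 \<le> p" "p \<le> 1" "p \<le> c * real n powr (- 1 / m)" "0 < c" "c \<le> 1"
    and n: "n \<ge> 1" and m: "0 < m" and g: "0 < \<gamma>"
    and s0: "s0 = 1 + \<kappa> * ((2 * \<kappa> + 1) * D)"
    and c: "real ((2 * \<kappa> * \<kappa>) ^ 2) * (real (2 * \<kappa> + 1) * real (2 + 2 * \<kappa>) ^ (2 * \<kappa>) * c) \<le> \<gamma> / 2"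
      "real (2 * \<kappa> * \<kappa>) * (real (2 * \<kappa> + 1) * real (2 * s0 + 2 * \<kappa>) ^ (2 * \<kappa>) * c) \<le> \<gamma> / 2"
    and q: "real (2 * \<kappa> + 1) * real (2 * (1 + \<kappa> * T) + 2 * \<kappa>) ^ (2 * \<kappa>) * real n powr (- \<epsilon>) \<le> q"
  shows "t \<le> T \<Longrightarrow> d \<le> D \<Longrightarrow> finite (reachable n m \<kappa> \<epsilon> t d) \<and>
     (\<Sum>s\<in>reachable n m \<kappa> \<epsilon> t d. p ^ card (fst s)) \<le> real n ^ 2 * \<gamma> ^ t * (2 * q / \<gamma>) ^ d"
proof (induction t arbitrary: d)
  case 0
  have q0: "0 \<le> q" by (rule order.trans[OF _ q]) auto
  have sub: "reachable n m \<kappa> \<epsilon> 0 d \<subseteq> (\<lambda>e. ({e}, [] :: (nat \<times> nat set) list)) ` all_pairs n"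
  proof
    fix s assume "s \<in> reachable n m \<kappa> \<epsilon> 0 d"
    hence "reach n m \<kappa> \<epsilon> 0 d s" unfolding reachable_def by simp
    thus "s \<in> (\<lambda>e. ({e}, [] :: (nat \<times> nat set) list)) ` all_pairs n" by cases auto
  qed
  have fin: "finite (reachable n m \<kappa> \<epsilon> 0 d)" using finite_subset[OF sub] by simp
  show ?case
  proof (cases "d = 0")
    case True
    have "(\<Sum>s\<in>reachable n m \<kappa> \<epsilon> 0 d. p ^ card (fst s)) \<le> (\<Sum>s\<in>(\<lambda>e. ({e}, [] :: (nat \<times> nat set) list)) ` all_pairs n. p ^ card (fst s))"
      using sub p by (intro sum_mono2) auto
    also have "\<dots> \<le> (\<Sum>e\<in>all_pairs n. p ^ card {e})"
      using sum_image_le[of "all_pairs n" "\<lambda>s. p ^ card (fst s)" "\<lambda>e. ({e}, [] :: (nat \<times> nat set) list)"] p by (simp add: o_def)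
    also have "\<dots> \<le> (\<Sum>e\<in>all_pairs n. 1)" using p by (intro sum_mono) auto
    also have "\<dots> = real (card (all_pairs n))" by simp
    also have "card (all_pairs n) = n choose 2" unfolding all_pairs_def by (subst n_subsets) auto
    also have "real (n choose 2) \<le> real n ^ 2"
    proof -
      have "n choose 2 \<le> n ^ 2" by (cases "2 \<le> n") (auto intro: binomial_le_pow simp: binomial_eq_0)
      thus ?thesis by (metis of_nat_le_iff of_nat_power)
    qed
    finally show ?thesis using fin True by simp
  next
    case False
    have "\<not> reach n m \<kappa> \<epsilon> 0 d s" for s
    proof
      assume "reach n m \<kappa> \<epsilon> 0 d s"
      thus False using False by cases auto
    qed
    hence "reachable n m \<kappa> \<epsilon> 0 d = {}" unfolding reachable_def by simp
    thus ?thesis using g q0 by simp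
  qed
next
  case (Suc t)
  define w where "w s = p ^ card (fst s)" for s :: "nat set set \<times> (nat \<times> nat set) list"
  have w0: "0 \<le> w s" for s unfolding w_def using p by simp
  have q0: "0 \<le> q" by (rule order.trans[OF _ q]) auto
  define N1 where "N1 s = {s'. (queue_step m \<kappa> s s' \<or> free_step m \<kappa> s s') \<and> fst s' \<subseteq> all_pairs n}" for s
  define N2 where "N2 s = {s'. degenerate_step m \<kappa> \<epsilon> s s' \<and> fst s' \<subseteq> all_pairs n}" for s
  have b1: "finite (N1 s) \<and> sum w (N1 s) \<le> \<gamma> / 2 * w s" if "s \<in> reachable n m \<kappa> \<epsilon> t d" for s
  proof -
    obtain S Q where s: "s = (S, Q)" by (cases s)
    have r: "reach n m \<kappa> \<epsilon> t d (S, Q)" using that unfolding s reachable_def by simp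
    have S: "S \<subseteq> all_pairs n" using reach_edges[OF r] by simp
    show ?thesis
    proof (cases "Q = []")
      case True
      have "t \<le> (2 * \<kappa> + 1) * d" using reach_length[OF r] True by simp
      also have "\<dots> \<le> (2 * \<kappa> + 1) * D" using Suc.prems by (intro mult_left_mono) auto
      finally have t: "t \<le> (2 * \<kappa> + 1) * D" .
      have "card S \<le> 1 + \<kappa> * t" using reach_card[OF r] by simp
      also have "\<dots> \<le> s0" unfolding s0 using t by (intro add_left_mono mult_left_mono) auto
      finally have cS: "card S \<le> s0" .
      have N: "N1 s = {s'. free_step m \<kappa> (S, Q) s' \<and> fst s' \<subseteq> all_pairs n}"
        unfolding N1_def s using True by (auto simp: queue_step_def)
      have "sum w (N1 s) \<le> p ^ card S * (real (2 * \<kappa> * \<kappa>) * (real (2 * \<kappa> + 1) * real (2 * card S + 2 * \<kappa>) ^ (2 * \<kappa>) * c))"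
        unfolding N w_def by (rule sum_free_step_le(2)[OF S p(1,3-5) n m])
      also have "\<dots> \<le> p ^ card S * (real (2 * \<kappa> * \<kappa>) * (real (2 * \<kappa> + 1) * real (2 * s0 + 2 * \<kappa>) ^ (2 * \<kappa>) * c))"
        using cS p by (intro mult_left_mono mult_right_mono power_mono) auto
      also have "\<dots> \<le> p ^ card S * (\<gamma> / 2)" using c(2) p by (intro mult_left_mono) auto
      finally show ?thesis using sum_free_step_le(1)[OF S p(1,3-5) n m, of \<kappa> Q] N s
        by (simp add: w_def mult.commute)
    next
      case False
      have N: "N1 s = {s'. queue_step m \<kappa> (S, Q) s' \<and> fst s' \<subseteq> all_pairs n}"
        unfolding N1_def s using False by (auto simp: free_step_def)
      have "sum w (N1 s) \<le> p ^ card S * (real ((2 * \<kappa> * \<kappa>) ^ 2) * (real (2 * \<kappa> + 1) * real (2 + 2 * \<kappa>) ^ (2 * \<kappa>) * c))"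
        unfolding N w_def by (rule sum_queue_step_le(2)[OF S p(1,3-5) n m])
      also have "\<dots> \<le> p ^ card S * (\<gamma> / 2)" using c(1) p by (intro mult_left_mono) auto
      finally show ?thesis using sum_queue_step_le(1)[OF S p(1,3-5) n m, of \<kappa> Q] N s
        by (simp add: w_def mult.commute)
    qed
  qed
  have b2: "finite (N2 s) \<and> sum w (N2 s) \<le> q * w s" if "s \<in> reachable n m \<kappa> \<epsilon> t d'" for s d'
  proof -
    obtain S Q where s: "s = (S, Q)" by (cases s)
    have r: "reach n m \<kappa> \<epsilon> t d' (S, Q)" using that unfolding s reachable_def by simp
    have S: "S \<subseteq> all_pairs n" using reach_edges[OF r] by simp
    have "card S \<le> 1 + \<kappa> * t" using reach_card[OF r] by simp
    also have "\<dots> \<le> 1 + \<kappa> * T" using Suc.prems by (intro add_left_mono mult_left_mono) auto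
    finally have cS: "card S \<le> 1 + \<kappa> * T" .
    have N: "N2 s = {s'. degenerate_step m \<kappa> \<epsilon> (S, Q) s' \<and> fst s' \<subseteq> all_pairs n}"
      unfolding N2_def s by simp
    have "sum w (N2 s) \<le> p ^ card S * (real (2 * \<kappa> + 1) * real (2 * card S + 2 * \<kappa>) ^ (2 * \<kappa>) * real n powr (- \<epsilon>))"
      unfolding N w_def by (rule sum_degenerate_step_le(2)[OF S p(1,3-5) n m])
    also have "\<dots> \<le> p ^ card S * (real (2 * \<kappa> + 1) * real (2 * (1 + \<kappa> * T) + 2 * \<kappa>) ^ (2 * \<kappa>) * real n powr (- \<epsilon>))"
      using cS p by (intro mult_left_mono mult_right_mono power_mono) (auto simp del: of_nat_add of_nat_mult)
    also have "\<dots> \<le> p ^ card S * q" using q p by (intro mult_left_mono) auto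
    finally show ?thesis using sum_degenerate_step_le(1)[OF S p(1,3-5) n m, of \<kappa> \<epsilon> Q] N s
      by (simp add: w_def mult.commute)
  qed
  define U1 where "U1 = (\<Union>s\<in>reachable n m \<kappa> \<epsilon> t d. N1 s)"
  define U2 where "U2 = (if d = 0 then {} else (\<Union>s\<in>reachable n m \<kappa> \<epsilon> t (d - 1). N2 s))"
  have sub: "reachable n m \<kappa> \<epsilon> (Suc t) d \<subseteq> U1 \<union> U2"
  proof
    fix s' assume "s' \<in> reachable n m \<kappa> \<epsilon> (Suc t) d"
    hence "reach n m \<kappa> \<epsilon> (Suc t) d s'" unfolding reachable_def by simp
    thus "s' \<in> U1 \<union> U2"
    proof cases
      case (regular s)
      thus ?thesis unfolding U1_def N1_def reachable_def by blast
    next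
      case (degenerate d0 s)
      hence "s' \<in> N2 s" "s \<in> reachable n m \<kappa> \<epsilon> t (d - 1)" "d \<noteq> 0" unfolding N2_def reachable_def by simp_all
      hence "s' \<in> U2" unfolding U2_def by (simp only: if_False) blast
      thus ?thesis by simp
    qed
  qed
  have IH: "finite (reachable n m \<kappa> \<epsilon> t d)" "sum w (reachable n m \<kappa> \<epsilon> t d) \<le> real n ^ 2 * \<gamma> ^ t * (2 * q / \<gamma>) ^ d"
    using Suc.IH[of d] Suc.prems unfolding w_def by auto
  have IH2: "finite (reachable n m \<kappa> \<epsilon> t (d - 1))" "sum w (reachable n m \<kappa> \<epsilon> t (d - 1)) \<le> real n ^ 2 * \<gamma> ^ t * (2 * q / \<gamma>) ^ (d - 1)"
    using Suc.IH[of "d - 1"] Suc.prems unfolding w_def by auto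
  have f1: "finite U1" unfolding U1_def using IH b1 by auto
  have f2: "finite U2" unfolding U2_def using IH2 b2 by auto
  let ?Z = "real n ^ 2 * \<gamma> ^ Suc t * (2 * q / \<gamma>) ^ d"
  have s1: "sum w U1 \<le> ?Z / 2"
  proof -
    have "sum w U1 \<le> \<gamma> / 2 * sum w (reachable n m \<kappa> \<epsilon> t d)"
      unfolding U1_def using IH b1 w0 by (intro sum_over_steps_le) auto
    also have "\<dots> \<le> \<gamma> / 2 * (real n ^ 2 * \<gamma> ^ t * (2 * q / \<gamma>) ^ d)" using IH g by (intro mult_left_mono) auto
    finally show ?thesis by (simp add: mult_ac)
  qed
  have s2: "sum w U2 \<le> ?Z / 2"
  proof (cases "d = 0")
    case True
    thus ?thesis unfolding U2_def using g by simp
  next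
    case False
    then obtain d0 where d0: "d = Suc d0" by (cases d) auto
    have "sum w U2 \<le> q * sum w (reachable n m \<kappa> \<epsilon> t (d - 1))"
      unfolding U2_def using False IH2 b2 w0 by (auto intro!: sum_over_steps_le)
    also have "\<dots> \<le> q * (real n ^ 2 * \<gamma> ^ t * (2 * q / \<gamma>) ^ (d - 1))" using IH2 q0 by (intro mult_left_mono) auto
    also have "\<dots> = ?Z / 2" using g unfolding d0 by (simp add: field_simps)
    finally show ?thesis .
  qed
  have "sum w (reachable n m \<kappa> \<epsilon> (Suc t) d) \<le> sum w (U1 \<union> U2)"
    using sub f1 f2 w0 by (intro sum_mono2) auto
  also have "\<dots> \<le> sum w U1 + sum w U2"
    using f1 f2 w0 sum.union_inter[of U1 U2 w] sum_nonneg[of "U1 \<inter> U2" w] by simp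
  also have "\<dots> \<le> ?Z" using s1 s2 by linarith
  finally have "sum w (reachable n m \<kappa> \<epsilon> (Suc t) d) \<le> ?Z" .
  moreover have "finite (reachable n m \<kappa> \<epsilon> (Suc t) d)" using sub f1 f2 finite_subset[OF sub] by simp
  ultimately show ?case unfolding w_def by simp
qed

section \<open>Ramsey cores\<close>

definition copy :: "'a set set \<Rightarrow> 'b set set \<Rightarrow> bool" where
  "copy E A \<longleftrightarrow> (\<exists>f. inj_on f (\<Union>E) \<and> A = (\<lambda>e. f ` e) ` E)"

text \<open>R is the set of red edges. Only edges are recorded, so isolated vertices are invisible;
  this is harmless because the balanced graphs considered have none.\<close>

definition arrows :: "'c set set \<Rightarrow> 'a set set \<Rightarrow> 'b set set \<Rightarrow> bool" where
  "arrows G E1 E2 \<longleftrightarrow> (\<forall>R\<subseteq>G. (\<exists>A\<subseteq>R. copy E1 A) \<or> (\<exists>B\<subseteq>G - R. copy E2 B))"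

lemma inj_on_image_edges:
  assumes "inj_on f (\<Union>E)"
  shows "inj_on (\<lambda>e. f ` e) E"
proof (rule inj_onI)
  fix a b assume "a \<in> E" "b \<in> E" "f ` a = f ` b"
  thus "a = b" using inj_on_image_eq_iff[OF assms, of a b] by auto
qed

lemma copy_sub:
  assumes "inj_on f (\<Union>E)" "J \<subseteq> E"
  shows "card ((\<lambda>e. f ` e) ` J) = card J" "card (\<Union>((\<lambda>e. f ` e) ` J)) = card (\<Union>J)"
    "wt \<mu> ((\<lambda>e. f ` e) ` J) = wt \<mu> J"
proof -
  have inj: "inj_on f (\<Union>J)" using assms by (meson Union_mono inj_on_subset)
  show 1: "card ((\<lambda>e. f ` e) ` J) = card J" by (rule card_image[OF inj_on_image_edges[OF inj]])
  have "\<Union>((\<lambda>e. f ` e) ` J) = f ` \<Union>J" by auto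
  thus 2: "card (\<Union>((\<lambda>e. f ` e) ` J)) = card (\<Union>J)" using card_image[OF inj] by simp
  show "wt \<mu> ((\<lambda>e. f ` e) ` J) = wt \<mu> J" unfolding wt_def 1 2 ..
qed

lemma balanced_copy:
  assumes "balanced \<mu> \<theta> \<epsilon> E" "copy E A"
  shows "balanced \<mu> \<theta> \<epsilon> A" "card A = card E"
proof -
  obtain f where f: "inj_on f (\<Union>E)" "A = (\<lambda>e. f ` e) ` E" using assms(2) unfolding copy_def by auto
  note E = balancedD[OF assms(1)]
  show cA: "card A = card E" unfolding f(2) using copy_sub(1)[OF f(1)] by simp
  have J: "\<exists>I\<subseteq>E. J = (\<lambda>e. f ` e) ` I \<and> card J = card I \<and> wt \<mu> J = wt \<mu> I" if JA: "J \<subseteq> A" for J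
  proof -
    obtain I where I: "I \<subseteq> E" "J = (\<lambda>e. f ` e) ` I" using JA[unfolded f(2)] subset_imageE by metis
    show ?thesis using I copy_sub(1,3)[OF f(1) I(1)] by (intro exI[of _ I]) simp
  qed
  have "card (f ` e) = 2" if "e \<in> E" for e
  proof -
    have "inj_on f e" by (rule inj_on_subset[OF f(1)]) (use that in auto)
    hence "card (f ` e) = card e" by (rule card_image)
    thus ?thesis using E(1) that unfolding edge_set_def by simp
  qed
  hence es: "edge_set A" unfolding f(2) using E(1) unfolding edge_set_def by auto
  show "balanced \<mu> \<theta> \<epsilon> A" unfolding balanced_def
  proof (intro conjI allI impI)
    show "edge_set A" by fact
    show "2 \<le> card A" using cA E by simp
    show "wt \<mu> A = \<theta>" using copy_sub(3)[OF f(1), of E \<mu>] E f(2) by simp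
  next
    fix J assume JA: "J \<subseteq> A" and ne: "J \<noteq> {}"
    obtain I where "I \<subseteq> E" "J = (\<lambda>e. f ` e) ` I" "wt \<mu> J = wt \<mu> I" using J[OF JA] by auto
    thus "\<theta> \<le> wt \<mu> J" using E(6)[of I] ne by auto
  next
    fix J assume a: "J \<subset> A \<and> 2 \<le> card J"
    obtain I where I: "I \<subseteq> E" "J = (\<lambda>e. f ` e) ` I" "wt \<mu> J = wt \<mu> I" "card J = card I" using J[of J] a by auto
    hence "I \<noteq> E" using a f(2) by auto
    thus "\<theta> + \<epsilon> \<le> wt \<mu> J" using E(7)[of I] a I by auto
  qed
qed

text \<open>Choose an unavoidable pair of families of copies of least total size. Dropping any
  member makes the rest avoidable, and an avoiding set, changed at one edge, must be caught by a
  copy that meets the dropped one in this edge alone.\<close>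

lemma exists_core:
  fixes G :: "'c set set"
  assumes b1: "balanced m \<theta> \<epsilon> E1" and b2: "balanced x \<theta> \<epsilon> E2"
    and par: "1 < x" "x \<le> m" "\<theta> = 2 - 1 / x" "0 < \<epsilon>" "\<epsilon> \<le> 1"
    and G: "finite G" "arrows G E1 E2"
  shows "\<exists>F1 F2. core F1 F2 m x \<theta> \<epsilon> \<and> \<Union>(F1 \<union> F2) \<subseteq> G \<and> \<Union>(F1 \<union> F2) \<noteq> {} \<and> arrows (\<Union>(F1 \<union> F2)) E1 E2 \<and>
    (\<forall>A\<in>F1. copy E1 A) \<and> (\<forall>B\<in>F2. copy E2 B)"
proof -
  \<comment> \<open>R ranges over all sets of edges, including those not inside G; red copies are
    contained in R and blue ones are disjoint from it.\<close>
  define NC where "NC F1 F2 \<longleftrightarrow> (\<forall>R. (\<exists>A\<in>F1. A \<subseteq> R) \<or> (\<exists>B\<in>F2. B \<inter> R = {}))" for F1 F2 :: "'c set set set"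
  define C1 where "C1 = {A. A \<subseteq> G \<and> copy E1 A}"
  define C2 where "C2 = {A. A \<subseteq> G \<and> copy E2 A}"
  define P where "P F \<longleftrightarrow> fst F \<subseteq> C1 \<and> snd F \<subseteq> C2 \<and> NC (fst F) (snd F)" for F
  define \<mu> where "\<mu> F = card (fst F) + card (snd F)" for F :: "'c set set set \<times> 'c set set set"
  have finC: "finite C1" "finite C2" unfolding C1_def C2_def using G(1) by auto
  have "NC C1 C2" unfolding NC_def
  proof
    fix R
    have "(\<exists>A\<subseteq>R \<inter> G. copy E1 A) \<or> (\<exists>B\<subseteq>G - (R \<inter> G). copy E2 B)"
      by (rule G(2)[unfolded arrows_def, rule_format]) simp
    thus "(\<exists>A\<in>C1. A \<subseteq> R) \<or> (\<exists>B\<in>C2. B \<inter> R = {})"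
    proof (elim disjE exE conjE)
      fix A assume "A \<subseteq> R \<inter> G" "copy E1 A"
      hence "A \<in> C1" "A \<subseteq> R" unfolding C1_def by auto
      thus ?thesis by blast
    next
      fix B assume "B \<subseteq> G - R \<inter> G" "copy E2 B"
      hence "B \<in> C2" "B \<inter> R = {}" unfolding C2_def by auto
      thus ?thesis by blast
    qed
  qed
  hence "P (C1, C2)" unfolding P_def by simp
  then obtain F where F: "P F" "\<And>F'. P F' \<Longrightarrow> \<mu> F \<le> \<mu> F'" using ex_has_least_nat[of P "(C1, C2)" \<mu>] by blast
  obtain F1 F2 where FF: "F = (F1, F2)" by (cases F)
  have F12: "F1 \<subseteq> C1" "F2 \<subseteq> C2" "NC F1 F2" using F(1) unfolding P_def FF by auto
  have fin: "finite F1" "finite F2" using F12 finC finite_subset by auto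
  have min: "\<not> NC F1' F2'" if "F1' \<subseteq> F1" "F2' \<subseteq> F2" "F1' \<noteq> F1 \<or> F2' \<noteq> F2" for F1' F2'
  proof
    assume "NC F1' F2'"
    hence "P (F1', F2')" unfolding P_def using that F12 by auto
    hence le: "card F1 + card F2 \<le> card F1' + card F2'" using F(2)[of "(F1', F2')"] unfolding FF \<mu>_def by simp
    have "card F1' \<le> card F1" "card F2' \<le> card F2" using that fin by (auto intro: card_mono)
    hence "card F1' = card F1" "card F2' = card F2" using le by linarith+
    thus False using that fin card_subset_eq by metis
  qed
  have nc: "(\<exists>A\<in>F1. A \<subseteq> R) \<or> (\<exists>B\<in>F2. B \<inter> R = {})" for R
    using F12(3) unfolding NC_def by (rule spec)
  have cp: "\<forall>A\<in>F1. copy E1 A" "\<forall>B\<in>F2. copy E2 B" using F12 unfolding C1_def C2_def by auto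
  have bF1: "balanced m \<theta> \<epsilon> A" if "A \<in> F1" for A using balanced_copy[OF b1] cp that by auto
  have bF2: "balanced x \<theta> \<epsilon> B" if "B \<in> F2" for B using balanced_copy[OF b2] cp that by auto
  let ?L = "\<Union>(F1 \<union> F2)"
  have cov1: "\<exists>B\<in>F2. A \<inter> B = {e}" if A: "A \<in> F1" "e \<in> A" for A e
  proof -
    have "\<not> NC (F1 - {A}) F2" using A by (intro min) auto
    then obtain R where R: "\<forall>A'\<in>F1 - {A}. \<not> A' \<subseteq> R" "\<forall>B\<in>F2. B \<inter> R \<noteq> {}" unfolding NC_def by auto
    have "(\<exists>A\<in>F1. A \<subseteq> R) \<or> (\<exists>B\<in>F2. B \<inter> R = {})" by (rule nc)
    hence AR: "A \<subseteq> R" using R by auto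
    \<comment> \<open>A is the only red copy inside R, so recolouring e blue destroys it and must
      create a blue copy, which meets R only in e.\<close>
    have "(\<exists>A\<in>F1. A \<subseteq> R - {e}) \<or> (\<exists>B\<in>F2. B \<inter> (R - {e}) = {})" by (rule nc)
    thus ?thesis
    proof (elim disjE bexE)
      fix A' assume A': "A' \<in> F1" "A' \<subseteq> R - {e}"
      hence "A' = A" using R(1) by auto
      thus ?thesis using A' A by auto
    next
      fix B assume B: "B \<in> F2" "B \<inter> (R - {e}) = {}"
      have "B \<inter> R \<noteq> {}" using R(2) B(1) by auto
      hence "A \<inter> B = {e}" using B(2) AR A(2) by auto
      thus ?thesis using B by auto
    qed
  qed
  have cov2: "\<exists>A\<in>F1. A \<inter> B = {e}" if B: "B \<in> F2" "e \<in> B" for B e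
  proof -
    have "\<not> NC F1 (F2 - {B})" using B by (intro min) auto
    then obtain R where R: "\<forall>A\<in>F1. \<not> A \<subseteq> R" "\<forall>B'\<in>F2 - {B}. B' \<inter> R \<noteq> {}" unfolding NC_def by auto
    have "(\<exists>A\<in>F1. A \<subseteq> R) \<or> (\<exists>B\<in>F2. B \<inter> R = {})" by (rule nc)
    hence BR: "B \<inter> R = {}" using R by auto
    have "(\<exists>A\<in>F1. A \<subseteq> insert e R) \<or> (\<exists>B\<in>F2. B \<inter> insert e R = {})" by (rule nc)
    thus ?thesis
    proof (elim disjE bexE)
      fix A assume A: "A \<in> F1" "A \<subseteq> insert e R"
      have "\<not> A \<subseteq> R" using R(1) A(1) by auto
      hence "A \<inter> B = {e}" using A(2) BR B(2) by auto
      thus ?thesis using A by auto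
    next
      fix B' assume B': "B' \<in> F2" "B' \<inter> insert e R = {}"
      hence "B' = B" using R(2) by auto
      thus ?thesis using B' B by auto
    qed
  qed
  have con: "\<exists>M\<in>F1 \<union> F2. M \<inter> S \<noteq> {} \<and> \<not> M \<subseteq> S" if S: "S \<noteq> {}" "S \<subset> ?L" for S
  proof (rule ccontr)
    assume neg: "\<not> ?thesis"
    obtain e where e: "e \<in> S" using S by auto
    then obtain M where M: "M \<in> F1 \<union> F2" "e \<in> M" using S by auto
    have MS: "M \<subseteq> S" using neg M e by auto
    obtain h where h: "h \<in> ?L" "h \<notin> S" using S by auto
    then obtain M' where M': "M' \<in> F1 \<union> F2" "h \<in> M'" by auto
    have M'S: "M' \<inter> S = {}" using neg M' h by auto
    define F1S where "F1S = {M\<in>F1. M \<subseteq> S}"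
    define F2S where "F2S = {M\<in>F2. M \<subseteq> S}"
    define F1T where "F1T = {M\<in>F1. M \<inter> S = {}}"
    define F2T where "F2T = {M\<in>F2. M \<inter> S = {}}"
    have "\<not> NC F1S F2S"
      using M' h unfolding F1S_def F2S_def by (intro min) auto
    then obtain R1 where R1: "\<forall>A\<in>F1S. \<not> A \<subseteq> R1" "\<forall>B\<in>F2S. B \<inter> R1 \<noteq> {}" unfolding NC_def by auto
    have "\<not> NC F1T F2T"
      using M e unfolding F1T_def F2T_def by (intro min) auto
    then obtain R2 where R2: "\<forall>A\<in>F1T. \<not> A \<subseteq> R2" "\<forall>B\<in>F2T. B \<inter> R2 \<noteq> {}" unfolding NC_def by auto
    \<comment> \<open>If no copy crosses the boundary of S, the copies inside S and those off S are
      smaller pairs of families, each avoidable by minimality. The two avoiding sets do not interact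
      and combine to one avoiding all copies.\<close>
    define R where "R = (R1 \<inter> S) \<union> (R2 - S)"
    have "(\<exists>A\<in>F1. A \<subseteq> R) \<or> (\<exists>B\<in>F2. B \<inter> R = {})" by (rule nc)
    thus False
    proof (elim disjE bexE)
      fix A assume A: "A \<in> F1" "A \<subseteq> R"
      show False
      proof (cases "A \<subseteq> S")
        case True
        hence "A \<subseteq> R1" using A unfolding R_def by auto
        thus False using R1 A True unfolding F1S_def by auto
      next
        case False
        hence "A \<inter> S = {}" using neg A by auto
        moreover from this have "A \<subseteq> R2" using A unfolding R_def by auto
        ultimately show False using R2 A unfolding F1T_def by auto
      qed
    next
      fix B assume B: "B \<in> F2" "B \<inter> R = {}"
      show False
      proof (cases "B \<subseteq> S")
        case True
        hence "B \<inter> R1 = {}" using B unfolding R_def by auto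
        thus False using R1 B True unfolding F2S_def by auto
      next
        case False
        hence "B \<inter> S = {}" using neg B by auto
        moreover from this have "B \<inter> R2 = {}" using B unfolding R_def by auto
        ultimately show False using R2 B unfolding F2T_def by auto
      qed
    qed
  qed
  have "core F1 F2 m x \<theta> \<epsilon>"
    by unfold_locales (use fin bF1 bF2 par cov1 cov2 con in simp_all)
  moreover have "?L \<subseteq> G" using F12 unfolding C1_def C2_def by auto
  moreover have "arrows ?L E1 E2" unfolding arrows_def
  proof (intro allI impI)
    fix R
    have "(\<exists>A\<in>F1. A \<subseteq> R) \<or> (\<exists>B\<in>F2. B \<inter> R = {})" by (rule nc)
    thus "(\<exists>A\<subseteq>R. copy E1 A) \<or> (\<exists>B\<subseteq>?L - R. copy E2 B)"
    proof (elim disjE bexE)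
      fix A assume "A \<in> F1" "A \<subseteq> R"
      thus ?thesis using cp(1) by auto
    next
      fix B assume "B \<in> F2" "B \<inter> R = {}"
      hence "B \<subseteq> ?L - R" "copy E2 B" using cp(2) by auto
      thus ?thesis by blast
    qed
  qed
  moreover have "?L \<noteq> {}"
  proof -
    have "F1 \<noteq> {} \<or> F2 \<noteq> {}" using F12(3) unfolding NC_def by auto
    thus ?thesis using balancedD(4)[OF bF1] balancedD(4)[OF bF2] by auto
  qed
  ultimately show ?thesis using cp by (intro exI[of _ F1] exI[of _ F2] conjI)
qed

text \<open>The exploration stops early only by reaching D degenerate steps or by exhausting the
  core. In the latter case the queue is empty, and \<open>reach_length\<close> bounds the number of
  steps and thus the size of the core by \<open>s0\<close>.\<close>

lemma core_explored:
  fixes F1 F2 :: "nat set set set"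
  assumes core: "core F1 F2 m x \<theta> \<epsilon>" and L: "\<Union>(F1 \<union> F2) \<subseteq> all_pairs n" "\<Union>(F1 \<union> F2) \<noteq> {}"
    and s: "\<forall>M\<in>F1 \<union> F2. card M \<le> s" and D: "0 < D"
    and k: "\<kappa> = s * s" and s0: "s0 = 1 + \<kappa> * ((2 * \<kappa> + 1) * D)"
  shows "(\<exists>t'\<le>t. \<exists>st\<in>reachable n m \<kappa> \<epsilon> t' D. fst st \<subseteq> \<Union>(F1 \<union> F2)) \<or>
    (\<exists>d<D. \<exists>S Q. (S, Q) \<in> reachable n m \<kappa> \<epsilon> t d \<and> core.valid_state F1 F2 S Q) \<or> card (\<Union>(F1 \<union> F2)) \<le> s0"
proof -
  interpret core F1 F2 m x \<theta> \<epsilon> by (rule core)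
  let ?L = "\<Union>(F1 \<union> F2)"
  show ?thesis
  proof (induction t)
    case 0
    obtain e where e: "e \<in> ?L" using L by auto
    have "({e}, []) \<in> reachable n m \<kappa> \<epsilon> 0 0" unfolding reachable_def using e L by (auto intro: reach.start)
    moreover have "valid_state {e} []" unfolding valid_state_def using e by simp
    ultimately show ?case using D by blast
  next
    case (Suc t)
    show ?case
    proof (cases "(\<exists>t'\<le>t. \<exists>st\<in>reachable n m \<kappa> \<epsilon> t' D. fst st \<subseteq> ?L) \<or> card ?L \<le> s0")
      case True
      thus ?thesis by (meson le_SucI)
    next
      case False
      then obtain d S Q where d: "d < D" and r: "(S, Q) \<in> reachable n m \<kappa> \<epsilon> t d" and v: "valid_state S Q"
        using Suc.IH by auto
      have rr: "reach n m \<kappa> \<epsilon> t d (S, Q)" using r unfolding reachable_def by simp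
      have SL: "S \<noteq> ?L"
      proof
        assume SL: "S = ?L"
        hence "Q = []" using queue_empty_at_end v by simp
        hence "t \<le> (2 * \<kappa> + 1) * d" using reach_length[OF rr] by simp
        also have "\<dots> \<le> (2 * \<kappa> + 1) * D" using d by (intro mult_left_mono) auto
        finally have t: "t \<le> (2 * \<kappa> + 1) * D" .
        have "card S \<le> 1 + \<kappa> * t" using reach_card[OF rr] by simp
        also have "\<dots> \<le> s0" unfolding s0 using t by (intro add_left_mono mult_left_mono) auto
        finally show False using False SL by simp
      qed
      obtain T Q' where T: "valid_state T Q'" "queue_step m \<kappa> (S, Q) (T, Q') \<or> free_step m \<kappa> (S, Q) (T, Q') \<or>
            degenerate_step m \<kappa> \<epsilon> (S, Q) (T, Q')"
        using next_step[OF v SL s, folded k] by (elim exE conjE) (rule that)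
      have TL: "T \<subseteq> ?L" using T(1) unfolding valid_state_def by simp
      hence TA: "fst (T, Q') \<subseteq> all_pairs n" using order.trans[OF TL L(1)] by (simp only: fst_conv)
      show ?thesis
      proof (cases "degenerate_step m \<kappa> \<epsilon> (S, Q) (T, Q')")
        case True
        hence r': "(T, Q') \<in> reachable n m \<kappa> \<epsilon> (Suc t) (Suc d)"
          unfolding reachable_def using reach.degenerate[OF rr True TA] by simp
        show ?thesis
        proof (cases "Suc d = D")
          case True
          have "\<exists>st\<in>reachable n m \<kappa> \<epsilon> (Suc t) D. fst st \<subseteq> ?L"
            using r' TL unfolding True by (intro bexI[of _ "(T, Q')"]) simp_all
          thus ?thesis by (intro disjI1 exI[of _ "Suc t"]) simp
        next
          case False
          hence "Suc d < D" using d by simp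
          thus ?thesis using r' T(1) by (intro disjI2 disjI1 exI[of _ "Suc d"]) auto
        qed
      next
        case False
        hence "(T, Q') \<in> reachable n m \<kappa> \<epsilon> (Suc t) d"
          unfolding reachable_def using reach.regular[OF rr _ TA] T(2) by simp
        thus ?thesis using d T(1) by (intro disjI2 disjI1 exI[of _ d]) auto
      qed
    qed
  qed
qed

section \<open>The probabilistic lemma\<close>

text \<open>Provides the gap \<epsilon> of a balanced graph as well as the exponent \<eta> by which
  graphs of bounded size and too high density fail to appear.\<close>

lemma finite_negative_gap:
  fixes V :: "real set"
  assumes "finite V"
  shows "\<exists>\<eta>>0. \<forall>v\<in>V. v < 0 \<longrightarrow> v \<le> - \<eta>"
proof -
  let ?W = "insert 1 (uminus ` {v\<in>V. v < 0})"
  have fin: "finite ?W" using assms by simp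
  have "Min ?W \<in> ?W" using fin by (intro Min_in) auto
  hence "Min ?W > 0" by auto
  moreover have "v \<le> - Min ?W" if "v \<in> V" "v < 0" for v
    using Min_le[OF fin, of "- v"] that by auto
  ultimately show ?thesis by blast
qed

text \<open>The decaying power is split into k + 1 equal shares: k of them tame one logarithmic
  factor each, and the last one sends the product to 0.\<close>

lemma polylog_bound:
  fixes C a b \<delta> :: real
  assumes "\<delta> > 0"
  shows "(\<lambda>n. C * (a * ln (real n) + b) ^ k * real n powr (- \<delta>)) \<longlonglongrightarrow> 0"
proof -
  define \<eta> where "\<eta> = \<delta> / real (Suc k)"
  have e: "\<eta> > 0" unfolding \<eta>_def using assms by simp
  have 1: "(\<lambda>n. (a * ln (real n) + b) * real n powr (- \<eta>)) \<longlonglongrightarrow> 0"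
  proof -
    have l1: "(\<lambda>n. ln (real n) * real n powr (- \<eta>)) \<longlonglongrightarrow> 0" using e by real_asymp
    have l2: "(\<lambda>n. real n powr (- \<eta>)) \<longlonglongrightarrow> 0" using e by real_asymp
    have "(\<lambda>n. a * (ln (real n) * real n powr (- \<eta>)) + b * real n powr (- \<eta>)) \<longlonglongrightarrow> a * 0 + b * 0"
      by (intro tendsto_intros l1 l2)
    thus ?thesis by (simp add: algebra_simps)
  qed
  have 2: "(\<lambda>n. real n powr (- \<eta>)) \<longlonglongrightarrow> 0" using e by real_asymp
  have 3: "(\<lambda>n. C * ((a * ln (real n) + b) * real n powr (- \<eta>)) ^ k * real n powr (- \<eta>)) \<longlonglongrightarrow> C * 0 ^ k * 0"
    by (intro tendsto_intros 1 2)
  have 4: "\<forall>\<^sub>F n in sequentially. C * ((a * ln (real n) + b) * real n powr (- \<eta>)) ^ k * real n powr (- \<eta>)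
     = C * (a * ln (real n) + b) ^ k * real n powr (- \<delta>)"
    using eventually_gt_at_top[of 0]
  proof eventually_elim
    case (elim n)
    have "real (Suc k) * \<eta> = \<delta>" unfolding \<eta>_def by simp
    hence d: "- \<eta> - \<eta> * real k = - \<delta>" by (simp add: algebra_simps)
    have "(real n powr (- \<eta>)) ^ k * real n powr (- \<eta>) = real n powr (- \<eta> - \<eta> * real k)"
      using elim by (simp add: powr_power powr_add[symmetric] algebra_simps)
    hence "(real n powr (- \<eta>)) ^ k * real n powr (- \<eta>) = real n powr (- \<delta>)" unfolding d .
    thus ?case by (simp add: power_mult_distrib mult_ac)
  qed
  show ?thesis using Lim_transform_eventually[OF 3 4] by simp
qed

text \<open>A Ramsey graph contains a core, and every core exhibits one of three witnesses: a
  history of \<open>T n\<close> steps, a history with D degenerate steps, or an edge set with at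
  most \<open>s0\<close> edges and density above m. A first moment bound is summed over all of
  them.\<close>

theorem prob_arrows_tendsto_0:
  fixes E1 :: "'a set set" and E2 :: "'b set set"
  assumes b1: "balanced m \<theta> \<epsilon> E1" and b2: "balanced x \<theta> \<epsilon> E2"
    and par: "1 < x" "x \<le> m" "\<theta> = 2 - 1 / x" "0 < \<epsilon>" "\<epsilon> \<le> 1"
    and dense: "\<And>L :: nat set set. edge_set L \<Longrightarrow> arrows L E1 E2 \<Longrightarrow> \<exists>J\<subseteq>L. m * real (card (\<Union>J)) < real (card J)"
  shows "\<exists>c>0. \<forall>p. (\<forall>n. 0 \<le> p n \<and> p n \<le> 1) \<and> (\<forall>n\<ge>1. p n \<le> c * real n powr (- 1 / m)) \<longrightarrow>
           (\<lambda>n. measure_pmf.prob (gnp n (p n)) {G. edges G \<subseteq> all_pairs n \<and> arrows (edges G) E1 E2}) \<longlonglongrightarrow> 0"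
proof -
  have m: "0 < m" using par by simp
  define s where "s = max (card E1) (card E2)"
  define \<kappa> where "\<kappa> = s * s"
  \<comment> \<open>A degenerate step will contribute at most n^(-\<epsilon>/2), so 8/\<epsilon> of
    them give n^(-4), enough against the n^2 starting edges and the logarithmic number of lengths
    t.\<close>
  define D where "D = nat \<lceil>8 / \<epsilon>\<rceil>"
  have D: "real D \<ge> 8 / \<epsilon>" unfolding D_def by linarith
  have D0: "0 < D"
  proof -
    have "0 < 8 / \<epsilon>" using par by simp
    thus ?thesis using D by linarith
  qed
  define s0 where "s0 = 1 + \<kappa> * ((2 * \<kappa> + 1) * D)"
  \<comment> \<open>With \<gamma> = 1/e, a history of 4 ln n steps gains n^(-4) as well.\<close>
  define \<gamma> :: real where "\<gamma> = exp (- 1)"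
  have g: "0 < \<gamma>" "\<gamma> \<le> 1" unfolding \<gamma>_def by auto
  define K1 where "K1 = real ((2 * \<kappa> * \<kappa>) ^ 2) * (real (2 * \<kappa> + 1) * real (2 + 2 * \<kappa>) ^ (2 * \<kappa>))"
  define K2 where "K2 = real (2 * \<kappa> * \<kappa>) * (real (2 * \<kappa> + 1) * real (2 * s0 + 2 * \<kappa>) ^ (2 * \<kappa>))"
  have K: "0 \<le> K1" "0 \<le> K2" unfolding K1_def K2_def by auto
  \<comment> \<open>This makes both \<open>K1 * c\<close> and \<open>K2 * c\<close> at most
    \<gamma>/2, as required for queue steps and free steps.\<close>
  define c where "c = min 1 (\<gamma> / 2 / (K1 + K2 + 1))"
  have c0: "0 < c" "c \<le> 1" unfolding c_def using g K by auto
  have "(K1 + K2 + 1) * c \<le> (K1 + K2 + 1) * (\<gamma> / 2 / (K1 + K2 + 1))"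
    unfolding c_def using K by (intro mult_left_mono) auto
  also have "(K1 + K2 + 1) * (\<gamma> / 2 / (K1 + K2 + 1)) = \<gamma> / 2" 
  proof -
    have "k * (\<gamma> / 2 / k) = \<gamma> / 2" if "k \<noteq> 0" for k :: real using that by simp
    thus ?thesis using K by (metis add_nonneg_pos add_nonneg_nonneg less_irrefl zero_less_one)
  qed
  finally have cc: "(K1 + K2 + 1) * c \<le> \<gamma> / 2" .
  have c1: "K1 * c \<le> \<gamma> / 2" and c2: "K2 * c \<le> \<gamma> / 2"
    using cc mult_nonneg_nonneg[OF K(1), of c] mult_nonneg_nonneg[OF K(2), of c] c0 by (simp_all add: algebra_simps)
  \<comment> \<open>Only finitely many pairs of an edge number and a vertex number occur for cores
    of bounded size, so a negative weight is bounded away from 0.\<close>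
  obtain \<eta> where eta: "\<eta> > 0" "\<forall>v\<in>(\<lambda>(a, b). real b - real a / m) ` ({..s0} \<times> {..2 * s0}). v < 0 \<longrightarrow> v \<le> - \<eta>"
    using finite_negative_gap[of "(\<lambda>(a, b). real b - real a / m) ` ({..s0} \<times> {..2 * s0})"] by auto
  define T where "T n = nat \<lceil>4 * ln (real n)\<rceil>" for n
  define q where "q n = real (2 * \<kappa> + 1) * real (2 * (1 + \<kappa> * T n) + 2 * \<kappa>) ^ (2 * \<kappa>) * real n powr (- \<epsilon>)" for n
  define K3 where "K3 = real (2 * s0 + 1) * real (card ({}::nat set) + 2 * s0) ^ (2 * s0) * c"
  \<comment> \<open>One summand for each kind of witness: long histories, histories with many
    degenerate steps, dense edge sets.\<close>
  define bnd where "bnd n = real (D + 1) * real n powr (- 2) + (4 * ln (real n) + 2) * real n powr (- 2) + K3 * real n powr (- \<eta>)" for n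
  have bnd0: "bnd \<longlonglongrightarrow> 0"
  proof -
    have 1: "(\<lambda>n. real (D + 1) * real n powr (- 2)) \<longlonglongrightarrow> 0" by real_asymp
    have 2: "(\<lambda>n. (4 * ln (real n) + 2) * real n powr (- 2)) \<longlonglongrightarrow> 0" by real_asymp
    have 3: "(\<lambda>n. real n powr (- \<eta>)) \<longlonglongrightarrow> 0" using eta(1) by real_asymp
    show ?thesis unfolding bnd_def
      using tendsto_add[OF tendsto_add[OF 1 2] tendsto_mult_left[OF 3, of K3]] by simp
  qed
  have Tle: "real (T n) \<le> 4 * ln (real n) + 1" if "n \<ge> 1" for n
    unfolding T_def using that by (simp add: of_nat_nat) linarith?
  have Tge: "real (T n) \<ge> 4 * ln (real n)" for n unfolding T_def by linarith
  \<comment> \<open>\<open>q n\<close> is n^(-\<epsilon>) times a power of a logarithmic term; half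
    of the exponent absorbs this power and the constants.\<close>
  have evq: "\<forall>\<^sub>F n in sequentially. 2 * q n / \<gamma> \<le> real n powr (- (\<epsilon> / 2))"
  proof -
    have "(\<lambda>n. (2 * real (2 * \<kappa> + 1) / \<gamma>) * (real (8 * \<kappa>) * ln (real n) + real (2 + 4 * \<kappa>)) ^ (2 * \<kappa>) * real n powr (- (\<epsilon> / 2))) \<longlonglongrightarrow> 0"
      using par by (intro polylog_bound) auto
    hence "\<forall>\<^sub>F n in sequentially. (2 * real (2 * \<kappa> + 1) / \<gamma>) * (real (8 * \<kappa>) * ln (real n) + real (2 + 4 * \<kappa>)) ^ (2 * \<kappa>) * real n powr (- (\<epsilon> / 2)) < 1"
      by (rule order_tendstoD) simp
    thus ?thesis using eventually_ge_at_top[of 1]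
    proof eventually_elim
      case (elim n)
      have "real (2 * (1 + \<kappa> * T n) + 2 * \<kappa>) = 2 + 2 * real \<kappa> * real (T n) + 2 * real \<kappa>" by simp
      also have "\<dots> \<le> 2 + 2 * real \<kappa> * (4 * ln (real n) + 1) + 2 * real \<kappa>"
        using Tle[OF elim(2)] by (intro add_mono mult_left_mono) auto
      also have "\<dots> = real (8 * \<kappa>) * ln (real n) + real (2 + 4 * \<kappa>)" by (simp add: algebra_simps)
      finally have 1: "real (2 * (1 + \<kappa> * T n) + 2 * \<kappa>) ^ (2 * \<kappa>) \<le> (real (8 * \<kappa>) * ln (real n) + real (2 + 4 * \<kappa>)) ^ (2 * \<kappa>)"
        by (intro power_mono) auto
      have "2 * q n / \<gamma> = (2 * real (2 * \<kappa> + 1) / \<gamma>) * real (2 * (1 + \<kappa> * T n) + 2 * \<kappa>) ^ (2 * \<kappa>) * real n powr (- \<epsilon>)"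
        unfolding q_def by simp
      also have "\<dots> \<le> (2 * real (2 * \<kappa> + 1) / \<gamma>) * (real (8 * \<kappa>) * ln (real n) + real (2 + 4 * \<kappa>)) ^ (2 * \<kappa>) * real n powr (- \<epsilon>)"
        using 1 g by (intro mult_left_mono mult_right_mono) auto
      also have "real n powr (- \<epsilon>) = real n powr (- (\<epsilon> / 2)) * real n powr (- (\<epsilon> / 2))"
        by (simp add: powr_add[symmetric])
      also have "(2 * real (2 * \<kappa> + 1) / \<gamma>) * (real (8 * \<kappa>) * ln (real n) + real (2 + 4 * \<kappa>)) ^ (2 * \<kappa>) * (real n powr (- (\<epsilon> / 2)) * real n powr (- (\<epsilon> / 2)))
        = ((2 * real (2 * \<kappa> + 1) / \<gamma>) * (real (8 * \<kappa>) * ln (real n) + real (2 + 4 * \<kappa>)) ^ (2 * \<kappa>) * real n powr (- (\<epsilon> / 2))) * real n powr (- (\<epsilon> / 2))"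
        by (simp only: mult.assoc)
      also have "\<dots> \<le> 1 * real n powr (- (\<epsilon> / 2))" using elim(1) by (intro mult_right_mono) auto
      finally show ?case by simp
    qed
  qed
  show ?thesis
  proof (rule exI[of _ c], intro conjI allI impI)
    show "0 < c" by fact
    fix p :: "nat \<Rightarrow> real"
    assume p: "(\<forall>n. 0 \<le> p n \<and> p n \<le> 1) \<and> (\<forall>n\<ge>1. p n \<le> c * real n powr (- 1 / m))"
    have "\<forall>\<^sub>F n in sequentially. measure_pmf.prob (gnp n (p n)) {G. edges G \<subseteq> all_pairs n \<and> arrows (edges G) E1 E2} \<le> bnd n"
      using evq eventually_ge_at_top[of 1]
    proof eventually_elim
      case (elim n)
      have p1: "0 \<le> p n" "p n \<le> 1" "p n \<le> c * real n powr (- 1 / m)" using p elim by auto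
      let ?T = "T n"
      define R where "R t d = reachable n m \<kappa> \<epsilon> t d" for t d
      have q0: "0 \<le> q n" unfolding q_def by simp
      have W: "finite (R t d) \<and> (\<Sum>st\<in>R t d. p n ^ card (fst st)) \<le> real n ^ 2 * \<gamma> ^ t * (2 * q n / \<gamma>) ^ d"
        if "t \<le> ?T" "d \<le> D" for t d
        unfolding R_def
        by (rule sum_reachable_le[OF p1 c0 elim(2) m g(1) s0_def _ _ _ that])
          (use c1 c2 in \<open>simp_all add: K1_def K2_def q_def mult.assoc\<close>)
      \<comment> \<open>Extensions of the empty set are the nonempty edge sets with at most
        \<open>s0\<close> edges and weight at most -\<eta>, in particular of density above
        m.\<close>
      define X where "X = extensions m s0 \<eta> n {} {}"
      define I where "I = (Inl ` (\<Union>d\<in>{..D}. R ?T d) \<union> Inl ` (\<Union>t\<in>{..?T}. R t D)) \<union> Inr ` X"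
      define f where "f i = (case i of Inl st \<Rightarrow> fst st | Inr J \<Rightarrow> J)" for i :: "(nat set set \<times> (nat \<times> nat set) list) + nat set set"
      have sub: "G \<in> {G. \<exists>i\<in>I. f i \<subseteq> edges G}" if G: "edges G \<subseteq> all_pairs n" "arrows (edges G) E1 E2" for G :: "nat graph"
      proof -
        have finG: "finite (edges G)" by (rule finite_subset[OF G(1) finite_all_pairs])
        obtain F1 F2 where F: "core F1 F2 m x \<theta> \<epsilon>" "\<Union>(F1 \<union> F2) \<subseteq> edges G" "\<Union>(F1 \<union> F2) \<noteq> {}" "arrows (\<Union>(F1 \<union> F2)) E1 E2"
          "\<forall>A\<in>F1. copy E1 A" "\<forall>B\<in>F2. copy E2 B"
          using exists_core[OF b1 b2 par finG G(2)] by (elim exE conjE) (rule that)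
        let ?L = "\<Union>(F1 \<union> F2)"
        have LA: "?L \<subseteq> all_pairs n" using order.trans[OF F(2) G(1)] .
        have sb: "\<forall>M\<in>F1 \<union> F2. card M \<le> s"
        proof
          fix M assume "M \<in> F1 \<union> F2"
          hence "card M = card E1 \<or> card M = card E2"
            using F(5,6) balanced_copy(2)[OF b1] balanced_copy(2)[OF b2] by blast
          thus "card M \<le> s" unfolding s_def by auto
        qed
        from core_explored[OF F(1) LA F(3) sb D0 \<kappa>_def s0_def, of ?T]
        show ?thesis
        proof (elim disjE exE conjE bexE)
          fix t' st assume a: "t' \<le> ?T" "st \<in> reachable n m \<kappa> \<epsilon> t' D" "fst st \<subseteq> ?L"
          hence "Inl st \<in> I" unfolding I_def R_def by auto
          moreover have "f (Inl st) \<subseteq> edges G" unfolding f_def using order.trans[OF a(3) F(2)] by simp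
          ultimately show ?thesis by blast
        next
          fix d S Q assume a: "d < D" "(S, Q) \<in> reachable n m \<kappa> \<epsilon> ?T d" "core.valid_state F1 F2 S Q"
          have "d \<in> {..D}" using a(1) by simp
          hence "(S, Q) \<in> (\<Union>d\<in>{..D}. R ?T d)" unfolding R_def using a(2) by blast
          hence "Inl (S, Q) \<in> I" unfolding I_def by (intro UnI1 imageI)
          moreover have "S \<subseteq> ?L" using a(3) unfolding core.valid_state_def[OF F(1)] by simp
          hence "f (Inl (S, Q)) \<subseteq> edges G" unfolding f_def using order.trans[OF _ F(2)] by simp
          ultimately show ?thesis by blast
        next
          assume cL: "card ?L \<le> s0"
          have esL: "edge_set ?L" using edge_set_all_pairs[OF LA] .
          obtain J where J: "J \<subseteq> ?L" "m * real (card (\<Union>J)) < real (card J)" using dense[OF esL F(4)] by auto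
          have esJ: "edge_set J" using edge_set_subset[OF esL J(1)] .
          have finL: "finite ?L" using esL unfolding edge_set_def by simp
          have cJ: "card J \<le> s0" using card_mono[OF finL J(1)] cL by simp
          have cv: "card (\<Union>J) \<le> 2 * s0" using card_Union_edges_le[OF esJ] cJ by simp
          have "real (card (\<Union>J)) - real (card J) / m < 0" using J(2) m by (simp add: field_simps)
          hence "real (card (\<Union>J)) - real (card J) / m \<le> - \<eta>" using eta(2) cJ cv by auto
          hence wJ: "wt m ({} \<union> J) \<le> wt m {} - \<eta>" unfolding wt_def by simp
          have Jn: "J \<noteq> {}" using J(2) by auto
          have "J \<in> X" unfolding X_def extensions_def using order.trans[OF J(1) LA] cJ wJ Jn by simp
          hence "Inr J \<in> I" unfolding I_def by simp
          moreover have "f (Inr J) \<subseteq> edges G" unfolding f_def using order.trans[OF J(1) F(2)] by simp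
          ultimately show ?thesis by blast
        qed
      qed
      have finX: "finite X" unfolding X_def by (rule finite_extensions)
      have finI: "finite I" unfolding I_def using W finX by auto
      have RA: "fst st \<subseteq> all_pairs n" if "st \<in> R t d" for st t d
        using that reach_edges[of n m \<kappa> \<epsilon> t d st] unfolding R_def reachable_def by simp
      have fI: "f i \<subseteq> all_pairs n" if "i \<in> I" for i
        using that unfolding I_def f_def X_def extensions_def by (auto dest!: RA)
      have w0: "0 \<le> p n ^ k" for k using p1 by simp
      have "measure_pmf.prob (gnp n (p n)) {G. edges G \<subseteq> all_pairs n \<and> arrows (edges G) E1 E2}
          \<le> measure_pmf.prob (gnp n (p n)) {G. \<exists>i\<in>I. f i \<subseteq> edges G}"
        using sub by (intro measure_pmf.finite_measure_mono subsetI) simp_all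
      also have "\<dots> \<le> (\<Sum>i\<in>I. p n ^ card (f i))"
        by (rule prob_gnp_Bex_le[OF finI fI p1(1,2)])
      also have "\<dots> \<le> (\<Sum>d\<in>{..D}. \<Sum>st\<in>R ?T d. p n ^ card (fst st)) + (\<Sum>t\<in>{..?T}. \<Sum>st\<in>R t D. p n ^ card (fst st))
            + (\<Sum>J\<in>X. p n ^ card J)"
      proof -
        have un: "sum g (A \<union> B) \<le> sum g A + sum g B" if "finite A" "finite B" "\<And>i. 0 \<le> g i" for g :: "(nat set set \<times> (nat \<times> nat set) list) + nat set set \<Rightarrow> real" and A B
          using that sum.union_inter[of A B g] sum_nonneg[of "A \<inter> B" g] by simp
        have i1: "(\<Sum>i\<in>Inl ` (\<Union>d\<in>{..D}. R ?T d). p n ^ card (f i)) \<le> (\<Sum>d\<in>{..D}. \<Sum>st\<in>R ?T d. p n ^ card (fst st))"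
        proof -
          have "(\<Sum>i\<in>Inl ` (\<Union>d\<in>{..D}. R ?T d). p n ^ card (f i)) = (\<Sum>st\<in>(\<Union>d\<in>{..D}. R ?T d). p n ^ card (fst st))"
            by (subst sum.reindex) (auto simp: f_def)
          also have "\<dots> \<le> (\<Sum>d\<in>{..D}. \<Sum>st\<in>R ?T d. p n ^ card (fst st))" using W w0 by (intro sum_UN_le) auto
          finally show ?thesis .
        qed
        have i2: "(\<Sum>i\<in>Inl ` (\<Union>t\<in>{..?T}. R t D). p n ^ card (f i)) \<le> (\<Sum>t\<in>{..?T}. \<Sum>st\<in>R t D. p n ^ card (fst st))"
        proof -
          have "(\<Sum>i\<in>Inl ` (\<Union>t\<in>{..?T}. R t D). p n ^ card (f i)) = (\<Sum>st\<in>(\<Union>t\<in>{..?T}. R t D). p n ^ card (fst st))"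
            by (subst sum.reindex) (auto simp: f_def)
          also have "\<dots> \<le> (\<Sum>t\<in>{..?T}. \<Sum>st\<in>R t D. p n ^ card (fst st))" using W w0 by (intro sum_UN_le) auto
          finally show ?thesis .
        qed
        have i3: "(\<Sum>i\<in>Inr ` X. p n ^ card (f i)) = (\<Sum>J\<in>X. p n ^ card J)"
          by (subst sum.reindex) (auto simp: f_def)
        have fin: "finite (Inl ` (\<Union>d\<in>{..D}. R ?T d))" "finite (Inl ` (\<Union>t\<in>{..?T}. R t D))" "finite (Inr ` X)"
          using W finX by auto
        have fin': "finite (Inl ` (\<Union>d\<in>{..D}. R ?T d) \<union> Inl ` (\<Union>t\<in>{..?T}. R t D))" using fin by simp
        show ?thesis
          unfolding I_def
          using un[OF fin' fin(3), of "\<lambda>i. p n ^ card (f i)", OF w0] un[OF fin(1,2), of "\<lambda>i. p n ^ card (f i)", OF w0] i1 i2 i3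
          by linarith
      qed
      also have "\<dots> \<le> bnd n"
      proof -
        have npos: "0 < real n" using elim by simp
        have y: "0 \<le> 2 * q n / \<gamma>" "2 * q n / \<gamma> \<le> 1"
        proof -
          show "0 \<le> 2 * q n / \<gamma>" using q0 g by simp
          have "real n powr (- (\<epsilon> / 2)) \<le> real n powr 0" using elim par by (intro powr_mono) auto
          thus "2 * q n / \<gamma> \<le> 1" using elim npos by simp
        qed
        have gT: "\<gamma> ^ ?T \<le> real n powr (- 4)"
        proof -
          have "\<gamma> ^ ?T = exp (- real ?T)" unfolding \<gamma>_def by (simp add: exp_of_nat_mult[symmetric])
          also have "\<dots> \<le> exp (- (4 * ln (real n)))" using Tge[of n] by simp
          also have "\<dots> = real n powr (- 4)" using npos by (simp add: powr_def)
          finally show ?thesis .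
        qed
        have n2: "real n ^ 2 * real n powr (- 4) = real n powr (- 2)"
        proof -
          have 1: "real n ^ 2 = real n powr 2" using npos by simp
          have "real n powr 2 * real n powr (- 4) = real n powr (2 + - 4)" by (simp only: powr_add)
          thus ?thesis unfolding 1 by simp
        qed
        have a1: "(\<Sum>d\<in>{..D}. \<Sum>st\<in>R ?T d. p n ^ card (fst st)) \<le> real (D + 1) * real n powr (- 2)"
        proof -
          have "(\<Sum>d\<in>{..D}. \<Sum>st\<in>R ?T d. p n ^ card (fst st)) \<le> (\<Sum>d\<in>{..D}. real n powr (- 2))"
          proof (rule sum_mono)
            fix d assume "d \<in> {..D}"
            hence "(\<Sum>st\<in>R ?T d. p n ^ card (fst st)) \<le> real n ^ 2 * \<gamma> ^ ?T * (2 * q n / \<gamma>) ^ d" using W by simp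
            also have "\<dots> \<le> real n ^ 2 * real n powr (- 4) * 1"
              using gT y g by (intro mult_mono power_le_one) auto
            finally show "(\<Sum>st\<in>R ?T d. p n ^ card (fst st)) \<le> real n powr (- 2)" using n2 by simp
          qed
          thus ?thesis by simp
        qed
        have a2: "(\<Sum>t\<in>{..?T}. \<Sum>st\<in>R t D. p n ^ card (fst st)) \<le> (4 * ln (real n) + 2) * real n powr (- 2)"
        proof -
          have yD: "(2 * q n / \<gamma>) ^ D \<le> real n powr (- 4)"
          proof -
            have "(2 * q n / \<gamma>) ^ D \<le> (real n powr (- (\<epsilon> / 2))) ^ D" using elim y by (intro power_mono) auto
            also have "\<dots> = real n powr (- (\<epsilon> / 2) * real D)" using npos by (simp add: powr_power mult.commute)
            also have "\<dots> \<le> real n powr (- 4)"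
            proof (rule powr_mono)
              have "\<epsilon> / 2 * (8 / \<epsilon>) \<le> \<epsilon> / 2 * real D" using D par by (intro mult_left_mono) auto
              thus "- (\<epsilon> / 2) * real D \<le> - 4" using par by simp
            qed (use elim in simp)
            finally show ?thesis .
          qed
          have "(\<Sum>t\<in>{..?T}. \<Sum>st\<in>R t D. p n ^ card (fst st)) \<le> (\<Sum>t\<in>{..?T}. real n powr (- 2))"
          proof (rule sum_mono)
            fix t assume "t \<in> {..?T}"
            hence "(\<Sum>st\<in>R t D. p n ^ card (fst st)) \<le> real n ^ 2 * \<gamma> ^ t * (2 * q n / \<gamma>) ^ D" using W by simp
            also have "\<dots> \<le> real n ^ 2 * 1 * real n powr (- 4)"
              using yD y g by (intro mult_mono power_le_one) auto
            finally show "(\<Sum>st\<in>R t D. p n ^ card (fst st)) \<le> real n powr (- 2)" using n2 by simp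
          qed
          also have "\<dots> = (real ?T + 1) * real n powr (- 2)" by (simp add: algebra_simps)
          also have "\<dots> \<le> (4 * ln (real n) + 2) * real n powr (- 2)"
            using Tle[OF elim(2)] by (intro mult_right_mono) auto
          finally show ?thesis .
        qed
        have a3: "(\<Sum>J\<in>X. p n ^ card J) \<le> K3 * real n powr (- \<eta>)"
          unfolding X_def K3_def by (rule sum_extensions_le[OF _ _ p1(1,3) c0 elim(2) m]) auto
        show ?thesis unfolding bnd_def using a1 a2 a3 by linarith
      qed
      finally show ?case .
    qed
    thus "(\<lambda>n. measure_pmf.prob (gnp n (p n)) {G. edges G \<subseteq> all_pairs n \<and> arrows (edges G) E1 E2}) \<longlonglongrightarrow> 0"
      by (intro tendsto_sandwich[OF _ _ tendsto_const bnd0]) auto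
  qed
qed

section \<open>Copies of a fixed graph\<close>

text \<open>Cauchy-Schwarz for the number X of events that occur and the indicator U of their union.
  It is obtained from E (X - t U)^2 \<ge> 0, using X U = X.\<close>

lemma second_moment:
  fixes M :: "'a pmf" and A :: "'i \<Rightarrow> 'a set"
  assumes fin: "finite I"
  shows "(\<Sum>i\<in>I. measure_pmf.prob M (A i)) ^ 2
    \<le> measure_pmf.prob M (\<Union>i\<in>I. A i) * (\<Sum>i\<in>I. \<Sum>j\<in>I. measure_pmf.prob M (A i \<inter> A j))"
proof -
  define S1 where "S1 = (\<Sum>i\<in>I. measure_pmf.prob M (A i))"
  define S2 where "S2 = (\<Sum>i\<in>I. \<Sum>j\<in>I. measure_pmf.prob M (A i \<inter> A j))"
  define P where "P = measure_pmf.prob M (\<Union>i\<in>I. A i)"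
  have S10: "0 \<le> S1" unfolding S1_def by (intro sum_nonneg) auto
  have S12: "S1 \<le> S2" unfolding S1_def S2_def
  proof (rule sum_mono)
    fix i assume i: "i \<in> I"
    have "measure_pmf.prob M (A i) = measure_pmf.prob M (A i \<inter> A i)" by simp
    also have "\<dots> \<le> (\<Sum>j\<in>I. measure_pmf.prob M (A i \<inter> A j))"
      by (rule member_le_sum[OF i, of "\<lambda>j. measure_pmf.prob M (A i \<inter> A j)"]) (use fin in auto)
    finally show "measure_pmf.prob M (A i) \<le> (\<Sum>j\<in>I. measure_pmf.prob M (A i \<inter> A j))" .
  qed
  have key: "0 \<le> S2 - 2 * t * S1 + t ^ 2 * P" for t :: real
  proof -
    define X where "X \<omega> = (\<Sum>i\<in>I. indicator (A i) \<omega> :: real)" for \<omega> :: 'a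
    define U :: "'a \<Rightarrow> real" where "U = indicator (\<Union>i\<in>I. A i)"
    have XX: "X \<omega> ^ 2 = (\<Sum>i\<in>I. \<Sum>j\<in>I. indicator (A i \<inter> A j) \<omega>)" for \<omega>
      unfolding X_def power2_eq_square sum_product by (simp add: indicator_inter_arith)
    have XU: "X \<omega> * U \<omega> = X \<omega>" "U \<omega> ^ 2 = U \<omega>" for \<omega>
      unfolding X_def U_def by (auto simp: indicator_def intro!: sum.neutral)
    have int: "integrable M (indicator B :: 'a \<Rightarrow> real)" for B :: "'a set"
      by (rule measure_pmf.integrable_const_bound[where B = 1]) auto
    have ind: "(\<integral>\<omega>. indicator B \<omega> \<partial>M) = measure_pmf.prob M B" for B :: "'a set" by simp
    have "0 \<le> (\<integral>\<omega>. (X \<omega> - t * U \<omega>) ^ 2 \<partial>M)" by (rule integral_nonneg_AE) simp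
    also have "(\<lambda>\<omega>. (X \<omega> - t * U \<omega>) ^ 2) = (\<lambda>\<omega>. (\<Sum>i\<in>I. \<Sum>j\<in>I. indicator (A i \<inter> A j) \<omega>) - 2 * t * (\<Sum>i\<in>I. indicator (A i) \<omega>) + t ^ 2 * U \<omega>)"
    proof
      fix \<omega>
      have "(X \<omega> - t * U \<omega>) ^ 2 = X \<omega> ^ 2 - 2 * t * (X \<omega> * U \<omega>) + t ^ 2 * U \<omega> ^ 2"
        by (simp add: power2_eq_square algebra_simps)
      thus "(X \<omega> - t * U \<omega>) ^ 2 = (\<Sum>i\<in>I. \<Sum>j\<in>I. indicator (A i \<inter> A j) \<omega>) - 2 * t * (\<Sum>i\<in>I. indicator (A i) \<omega>) + t ^ 2 * U \<omega>"
        unfolding XU XX by (simp add: X_def)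
    qed
    also have "(\<integral>\<omega>. (\<Sum>i\<in>I. \<Sum>j\<in>I. indicator (A i \<inter> A j) \<omega>) - 2 * t * (\<Sum>i\<in>I. indicator (A i) \<omega>) + t ^ 2 * U \<omega> \<partial>M)
       = S2 - 2 * t * S1 + t ^ 2 * P"
      unfolding U_def S1_def S2_def P_def
      by (subst Bochner_Integration.integral_add Bochner_Integration.integral_diff Bochner_Integration.integral_mult_right_zero
          Bochner_Integration.integral_sum; (intro Bochner_Integration.integrable_diff Bochner_Integration.integrable_sum integrable_mult_right int)?)+
         (simp add: Bochner_Integration.integral_sum Bochner_Integration.integrable_sum int ind)
    finally show ?thesis .
  qed
  show ?thesis
  proof (cases "S1 = 0")
    case True
    have "0 \<le> P * S2" unfolding P_def using S10 S12 by (intro mult_nonneg_nonneg) auto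
    thus ?thesis using True unfolding S1_def[symmetric] S2_def[symmetric] P_def[symmetric] by simp
  next
    case False
    hence pos: "0 < S1" "0 < S2" using S10 S12 by auto
    \<comment> \<open>The choice t = S2/S1 avoids dividing by the probability P, whose positivity is
      not yet known.\<close>
    have "0 \<le> S2 - 2 * (S2 / S1) * S1 + (S2 / S1) ^ 2 * P" by (rule key)
    also have "\<dots> = S2 * (P * S2 - S1 ^ 2) / S1 ^ 2" using pos by (simp add: field_simps power2_eq_square)
    finally have "0 \<le> P * S2 - S1 ^ 2" using pos by (simp add: zero_le_divide_iff zero_le_mult_iff)
    thus ?thesis unfolding S1_def[symmetric] S2_def[symmetric] P_def[symmetric] by simp
  qed
qed

lemma block_unique:
  fixes a b k i j :: nat
  assumes "a * k + i = b * k + j" "1 \<le> i" "i \<le> k" "1 \<le> j" "j \<le> k"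
  shows "a = b \<and> i = j"
proof -
  have "\<not> a < b" if "a * k + i = b * k + j" "i \<le> k" "1 \<le> j" for a b i j
  proof
    assume "a < b"
    hence "(a + 1) * k \<le> b * k" by (intro mult_right_mono) auto
    thus False using that by (simp add: algebra_simps)
  qed
  from this[of a i b j] this[of b j a i] assms show ?thesis by auto
qed

text \<open>Only embeddings that send the \<open>i\<close>-th vertex into the \<open>i\<close>-th of \<open>card V\<close> blocks of length \<open>k\<close> are
  counted: all these maps are injective, and two of them can meet only in images of the same vertex.\<close>

lemma prob_contains_copy:
  fixes E :: "'a set set" and m c :: real
  assumes es: "edge_set E" and ne: "E \<noteq> {}" and m: "0 < m" and c: "0 < c"
    and sparse: "\<And>J. J \<subseteq> E \<Longrightarrow> real (card J) \<le> m * real (card (\<Union>J))"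
  shows "\<exists>\<delta>>0. \<forall>\<^sub>F n in sequentially. \<delta> \<le> measure_pmf.prob (gnp n (min 1 (c * real n powr (- 1 / m)))) {\<Gamma>. \<exists>A\<subseteq>edges \<Gamma>. copy E A}"
proof -
  define V where "V = \<Union>E"
  have finV: "finite V" unfolding V_def using es by (rule edge_set_Union_finite)
  define v where "v = card V"
  obtain e0 where e0: "e0 \<in> E" using ne by auto
  have "e0 \<noteq> {}" using es e0 unfolding edge_set_def by auto
  hence Vne: "V \<noteq> {}" unfolding V_def using e0 by auto
  have v1: "1 \<le> v" unfolding v_def using Vne finV by (simp add: Suc_le_eq card_gt_0_iff)
  obtain h where h: "bij_betw h V {0..<v}" using ex_bij_betw_finite_nat[OF finV] unfolding v_def by auto
  have hlt: "h u < v" if "u \<in> V" for u using bij_betwE[OF h] that by auto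
  have hinj: "u = u'" if "u \<in> V" "u' \<in> V" "h u = h u'" for u u'
    using h that unfolding bij_betw_def inj_on_def by auto
  \<comment> \<open>For n \<ge> v one has n \<le> 2 v k, so p is at least c' k^(-1/m), and the block
    length k can take the role of n.\<close>
  define c' where "c' = min 1 (c * (2 * real v) powr (- 1 / m))"
  have c': "0 < c'" "c' \<le> 1" unfolding c'_def using c v1 by auto
  define C where "C = c' powr (- (m * real v))"
  have C: "0 < C" unfolding C_def using c' by simp
  define \<delta> where "\<delta> = 1 / (C * 2 ^ v)"
  have "\<delta> \<le> measure_pmf.prob (gnp n (min 1 (c * real n powr (- 1 / m)))) {\<Gamma>. \<exists>A\<subseteq>edges \<Gamma>. copy E A}" if n: "n \<ge> v" for n
  proof -
    define k where "k = n div v"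
    define p where "p = min 1 (c * real n powr (- 1 / m))"
    have k1: "1 \<le> k" unfolding k_def using n v1 by (simp add: Suc_le_eq div_greater_zero_iff)
    have n1: "1 \<le> n" using n v1 by simp
    have p: "0 < p" "p \<le> 1" unfolding p_def using c n1 by auto
    have vk: "v * k \<le> n" unfolding k_def by simp
    have nk: "n \<le> 2 * v * k"
    proof -
      have "n = v * k + n mod v" unfolding k_def by simp
      also have "\<dots> \<le> v * k + v * k" using mod_less_divisor[of v n] v1 k1
        by (intro add_left_mono) (metis less_imp_le_nat mult.right_neutral mult_le_mono2 le_trans less_le_trans zero_less_one)
      finally show ?thesis by simp
    qed
    have pk: "c' * real k powr (- 1 / m) \<le> p" unfolding p_def
    proof (rule min.boundedI)
      have "real k powr (- 1 / m) \<le> real k powr 0" using k1 m by (intro powr_mono) auto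
      hence "real k powr (- 1 / m) \<le> 1" using k1 by simp
      hence "c' * real k powr (- 1 / m) \<le> 1 * 1" using c' by (intro mult_mono) auto
      thus "c' * real k powr (- 1 / m) \<le> 1" by simp
      have "c' * real k powr (- 1 / m) \<le> c * (2 * real v) powr (- 1 / m) * real k powr (- 1 / m)"
        unfolding c'_def by (intro mult_right_mono) auto
      also have "\<dots> = c * (2 * real v * real k) powr (- 1 / m)" by (simp add: powr_mult)
      also have "\<dots> \<le> c * real n powr (- 1 / m)"
      proof -
        have "real n \<le> 2 * real v * real k" using nk by (metis of_nat_le_iff of_nat_mult of_nat_numeral)
        thus ?thesis using c m n1 by (intro mult_left_mono powr_mono2') auto
      qed
      finally show "c' * real k powr (- 1 / m) \<le> c * real n powr (- 1 / m)" .
    qed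
    define I where "I = PiE V (\<lambda>_. {1..k})"
    define \<phi> where "\<phi> y u = h u * k + y u" for y u
    define f where "f y = (\<lambda>e. \<phi> y ` e) ` E" for y
    have finI: "finite I" unfolding I_def using finV by (intro finite_PiE) auto
    have yb: "1 \<le> y u" "y u \<le> k" if "y \<in> I" "u \<in> V" for y u using that unfolding I_def by (auto dest: PiE_mem)
    have uniq: "u = u' \<and> y u = z u'" if "y \<in> I" "z \<in> I" "u \<in> V" "u' \<in> V" "\<phi> y u = \<phi> z u'" for y z u u'
    proof -
      have "h u = h u' \<and> y u = z u'" using that yb unfolding \<phi>_def by (intro block_unique[of _ k]) auto
      thus ?thesis using hinj that by auto
    qed
    have inj: "inj_on (\<phi> y) V" if "y \<in> I" for y using uniq[OF that that] by (auto simp: inj_on_def)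
    have fsub: "f y \<subseteq> all_pairs n" if y: "y \<in> I" for y
    proof
      fix a assume "a \<in> f y"
      then obtain e where e: "e \<in> E" "a = \<phi> y ` e" unfolding f_def by auto
      have eV: "e \<subseteq> V" unfolding V_def using e by auto
      have "card a = card e" unfolding e(2) using inj_on_subset[OF inj[OF y] eV] by (rule card_image)
      moreover have "card e = 2" using es e unfolding edge_set_def by auto
      moreover have "a \<subseteq> {1..n}"
      proof
        fix b assume "b \<in> a"
        then obtain u where u: "u \<in> V" "b = \<phi> y u" using e eV by auto
        have "(h u + 1) * k \<le> v * k" using hlt[OF u(1)] by (intro mult_right_mono) auto
        hence "h u * k + k \<le> n" using vk by (simp add: algebra_simps)
        thus "b \<in> {1..n}" using yb[OF y u(1)] u(2) unfolding \<phi>_def by auto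
      qed
      ultimately show "a \<in> all_pairs n" unfolding all_pairs_def by auto
    qed
    have cardf: "card (f y) = card E" if "y \<in> I" for y
      unfolding f_def by (rule copy_sub(1)[of "\<phi> y" E E]) (use inj[OF that] V_def in auto)
    define W where "W y z = {u\<in>V. y u = z u}" for y z :: "'a \<Rightarrow> nat"
    \<comment> \<open>The blocks identify the vertices, so on a common edge both maps agree. Common
      edges thus come from a subgraph J of E living on the agreement set W, and the sparseness of E
      bounds their number.\<close>
    have inter: "real (card (f y \<inter> f z)) \<le> m * real (card (W y z))" if y: "y \<in> I" and z: "z \<in> I" for y z
    proof -
      define J where "J = {e\<in>E. \<forall>u\<in>e. y u = z u}"
      have JE: "J \<subseteq> E" unfolding J_def by auto
      have "f y \<inter> f z \<subseteq> (\<lambda>e. \<phi> y ` e) ` J"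
      proof
        fix a assume "a \<in> f y \<inter> f z"
        then obtain e e' where e: "e \<in> E" "a = \<phi> y ` e" "e' \<in> E" "a = \<phi> z ` e'" unfolding f_def by auto
        have "y u = z u" if u: "u \<in> e" for u
        proof -
          have "\<phi> y u \<in> \<phi> z ` e'" using e u by auto
          then obtain u' where u': "u' \<in> e'" "\<phi> y u = \<phi> z u'" by auto
          have "u \<in> V" "u' \<in> V" using u u' e unfolding V_def by auto
          thus ?thesis using uniq[OF y z _ _ u'(2)] by auto
        qed
        thus "a \<in> (\<lambda>e. \<phi> y ` e) ` J" using e unfolding J_def by auto
      qed
      moreover have finE: "finite E" using es unfolding edge_set_def by simp
      ultimately have "card (f y \<inter> f z) \<le> card J"
        using JE by (meson card_image_le card_mono finite_imageI finite_subset le_trans)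
      hence "real (card (f y \<inter> f z)) \<le> real (card J)" by simp
      also have "\<dots> \<le> m * real (card (\<Union>J))" by (rule sparse[OF JE])
      also have "\<dots> \<le> m * real (card (W y z))"
      proof -
        have "\<Union>J \<subseteq> W y z" unfolding W_def J_def V_def by auto
        hence "card (\<Union>J) \<le> card (W y z)" using finV unfolding W_def by (intro card_mono) auto
        thus ?thesis using m by simp
      qed
      finally show ?thesis .
    qed
    \<comment> \<open>Each common edge gains a factor 1/p; by the previous bound the total gain is
      at most a constant times k to the number of agreements.\<close>
    have pw: "p ^ card (f y \<union> f z) \<le> p ^ (2 * card E) * (C * real k ^ card (W y z))" if y: "y \<in> I" and z: "z \<in> I" for y z
    proof -
      have finf: "finite (f y)" for y unfolding f_def using es unfolding edge_set_def by simp
      have "card (f y) + card (f z) = card (f y \<union> f z) + card (f y \<inter> f z)" by (rule card_Un_Int[OF finf finf])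
      hence "2 * card E = card (f y \<union> f z) + card (f y \<inter> f z)" using cardf y z by simp
      hence "p ^ (2 * card E) = p ^ card (f y \<union> f z) * p ^ card (f y \<inter> f z)" by (simp add: power_add)
      hence "p ^ card (f y \<union> f z) = p ^ (2 * card E) * p powr (- real (card (f y \<inter> f z)))"
        using p by (simp add: powr_minus powr_realpow field_simps)
      also have "p powr (- real (card (f y \<inter> f z))) \<le> p powr (- (m * real (card (W y z))))"
        using p inter[OF y z] by (intro powr_mono') auto
      also have "\<dots> \<le> (c' * real k powr (- 1 / m)) powr (- (m * real (card (W y z))))"
        using pk c' k1 m by (intro powr_mono2') auto
      also have "\<dots> = c' powr (- (m * real (card (W y z)))) * real k powr real (card (W y z))"
        using c' m by (simp add: powr_mult powr_powr)
      also have "\<dots> \<le> C * real k powr real (card (W y z))"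
      proof -
        have "card (W y z) \<le> v" unfolding v_def W_def using finV by (intro card_mono) auto
        hence "- (m * real v) \<le> - (m * real (card (W y z)))" using m by simp
        thus ?thesis unfolding C_def using c' by (intro mult_right_mono powr_mono') auto
      qed
      also have "real k powr real (card (W y z)) = real k ^ card (W y z)" using k1 by (simp add: powr_realpow)
      finally show ?thesis using p by (simp add: mult_left_mono)
    qed
    \<comment> \<open>The sum over z factorises over the vertices: the one image that agrees with y
      contributes k, and the remaining k - 1 contribute 1 each.\<close>
    have sumW: "(\<Sum>z\<in>I. real k ^ card (W y z)) \<le> (2 * real k) ^ v" if y: "y \<in> I" for y
    proof -
      have "real k ^ card (W y z) = (\<Prod>u\<in>V. if y u = z u then real k else 1)" for z
      proof -
        have "(\<Prod>u\<in>V. if y u = z u then real k else 1) = (\<Prod>u\<in>W y z. real k)"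
          unfolding W_def by (rule prod.inter_filter[OF finV, symmetric])
        thus ?thesis by simp
      qed
      hence "(\<Sum>z\<in>I. real k ^ card (W y z)) = (\<Sum>z\<in>I. \<Prod>u\<in>V. if y u = z u then real k else 1)" by simp
      also have "\<dots> = (\<Prod>u\<in>V. \<Sum>b\<in>{1..k}. if y u = b then real k else 1)"
        unfolding I_def using finV by (subst prod_sum_PiE) auto
      also have "\<dots> \<le> (\<Prod>u\<in>V. 2 * real k)"
      proof (rule prod_mono, rule conjI)
        fix u assume u: "u \<in> V"
        show "0 \<le> (\<Sum>b\<in>{1..k}. if y u = b then real k else 1)" by (intro sum_nonneg) auto
        have "(\<Sum>b\<in>{1..k}. if y u = b then real k else 1) \<le> (\<Sum>b\<in>{1..k}. (if y u = b then real k else 0) + 1)"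
          by (intro sum_mono) auto
        also have "\<dots> = 2 * real k" using yb[OF y u] by (simp add: sum.distrib)
        finally show "(\<Sum>b\<in>{1..k}. if y u = b then real k else 1) \<le> 2 * real k" .
      qed
      finally show ?thesis unfolding v_def by simp
    qed
    define M where "M = gnp n p"
    define A where "A y = {\<Gamma> :: nat graph. f y \<subseteq> edges \<Gamma>}" for y
    have PA: "measure_pmf.prob M (A y) = p ^ card E" if "y \<in> I" for y
      unfolding M_def A_def using prob_gnp_contains[OF fsub[OF that], of p] p cardf[OF that] by simp
    have PAA: "measure_pmf.prob M (A y \<inter> A z) = p ^ card (f y \<union> f z)" if "y \<in> I" "z \<in> I" for y z
    proof -
      have "A y \<inter> A z = {\<Gamma>. f y \<union> f z \<subseteq> edges \<Gamma>}" unfolding A_def by auto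
      thus ?thesis unfolding M_def using prob_gnp_contains[of "f y \<union> f z" n p] fsub that p by simp
    qed
    have cI: "real (card I) = real k ^ v" unfolding I_def v_def using finV by (simp add: card_PiE)
    have "(\<Sum>y\<in>I. measure_pmf.prob M (A y)) = real k ^ v * p ^ card E" using PA cI by simp
    hence "(real k ^ v * p ^ card E) ^ 2 \<le> measure_pmf.prob M (\<Union>y\<in>I. A y) * (\<Sum>y\<in>I. \<Sum>z\<in>I. measure_pmf.prob M (A y \<inter> A z))"
      using second_moment[OF finI, of M A] by simp
    also have "\<dots> \<le> measure_pmf.prob M (\<Union>y\<in>I. A y) * (real k ^ v * (p ^ (2 * card E) * (C * (2 * real k) ^ v)))"
    proof (rule mult_left_mono)
      have "(\<Sum>y\<in>I. \<Sum>z\<in>I. measure_pmf.prob M (A y \<inter> A z)) \<le> (\<Sum>y\<in>I. p ^ (2 * card E) * (C * (2 * real k) ^ v))"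
      proof (rule sum_mono)
        fix y assume y: "y \<in> I"
        have "(\<Sum>z\<in>I. measure_pmf.prob M (A y \<inter> A z)) \<le> (\<Sum>z\<in>I. p ^ (2 * card E) * (C * real k ^ card (W y z)))"
          using PAA[OF y] pw[OF y] by (intro sum_mono) simp
        also have "\<dots> = p ^ (2 * card E) * (C * (\<Sum>z\<in>I. real k ^ card (W y z)))" by (simp add: sum_distrib_left)
        also have "\<dots> \<le> p ^ (2 * card E) * (C * (2 * real k) ^ v)" using sumW[OF y] C p by (intro mult_left_mono) auto
        finally show "(\<Sum>z\<in>I. measure_pmf.prob M (A y \<inter> A z)) \<le> p ^ (2 * card E) * (C * (2 * real k) ^ v)" .
      qed
      also have "\<dots> = real k ^ v * (p ^ (2 * card E) * (C * (2 * real k) ^ v))" using cI by simp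
      finally show "(\<Sum>y\<in>I. \<Sum>z\<in>I. measure_pmf.prob M (A y \<inter> A z)) \<le> real k ^ v * (p ^ (2 * card E) * (C * (2 * real k) ^ v))" .
    qed simp
    also have "p ^ (2 * card E) = p ^ card E * p ^ card E" by (simp add: mult_2 power_add)
    also have "(2 * real k) ^ v = 2 ^ v * real k ^ v" by (simp add: power_mult_distrib)
    finally have "(real k ^ v * p ^ card E) ^ 2 \<le> (measure_pmf.prob M (\<Union>y\<in>I. A y) * (C * 2 ^ v)) * (real k ^ v * p ^ card E) ^ 2"
      by (simp only: power2_eq_square mult_ac)
    moreover have "0 < (real k ^ v * p ^ card E) ^ 2" using k1 p by simp
    ultimately have "1 \<le> measure_pmf.prob M (\<Union>y\<in>I. A y) * (C * 2 ^ v)"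
      using mult_le_cancel_right_pos[of "(real k ^ v * p ^ card E) ^ 2" 1] by simp
    hence "\<delta> \<le> measure_pmf.prob M (\<Union>y\<in>I. A y)" unfolding \<delta>_def using C by (simp add: field_simps)
    also have "\<dots> \<le> measure_pmf.prob M {\<Gamma>. \<exists>A\<subseteq>edges \<Gamma>. copy E A}"
    proof (rule measure_pmf.finite_measure_mono)
      show "(\<Union>y\<in>I. A y) \<subseteq> {\<Gamma>. \<exists>A\<subseteq>edges \<Gamma>. copy E A}"
      proof
        fix \<Gamma> assume "\<Gamma> \<in> (\<Union>y\<in>I. A y)"
        then obtain y where y: "y \<in> I" "f y \<subseteq> edges \<Gamma>" unfolding A_def by auto
        have "copy E (f y)" unfolding copy_def f_def using inj[OF y(1)] V_def by auto
        thus "\<Gamma> \<in> {\<Gamma>. \<exists>A\<subseteq>edges \<Gamma>. copy E A}" using y by auto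
      qed
    qed simp
    finally show ?thesis unfolding M_def p_def .
  qed
  moreover have "0 < \<delta>" unfolding \<delta>_def using C by simp
  ultimately show ?thesis by (intro exI[of _ \<delta>] conjI eventually_sequentiallyI[of v]) auto
qed

section \<open>Sparse graphs in the case of equal 2-densities\<close>

definition star :: "'a set set \<Rightarrow> 'a \<Rightarrow> 'a set set" where
  "star E u = {e\<in>E. u \<in> e}"

lemma star_mono: "J \<subseteq> E \<Longrightarrow> star J u \<subseteq> star E u"
  unfolding star_def by auto

lemma finite_star: "finite E \<Longrightarrow> finite (star E u)"
  unfolding star_def by simp

lemma card_star_mono: "J \<subseteq> E \<Longrightarrow> finite E \<Longrightarrow> card (star J u) \<le> card (star E u)"
  by (intro card_mono star_mono finite_star)

lemma handshake:
  assumes "edge_set E"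
  shows "(\<Sum>u\<in>\<Union>E. card (star E u)) = 2 * card E"
proof -
  have fin: "finite E" "finite (\<Union>E)" using assms edge_set_Union_finite unfolding edge_set_def by auto
  have "(\<Sum>u\<in>\<Union>E. card (star E u)) = (\<Sum>u\<in>\<Union>E. \<Sum>e\<in>E. if u \<in> e then 1 else 0)"
    unfolding star_def using fin by (intro sum.cong refl) (simp add: sum.inter_filter[symmetric])
  also have "\<dots> = (\<Sum>e\<in>E. \<Sum>u\<in>\<Union>E. if u \<in> e then 1 else 0)" by (rule sum.swap)
  also have "\<dots> = (\<Sum>e\<in>E. 2)"
  proof (rule sum.cong[OF refl])
    fix e assume e: "e \<in> E"
    have "(\<Sum>u\<in>\<Union>E. if u \<in> e then 1 else 0) = card {u\<in>\<Union>E. u \<in> e}"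
      using fin by (simp add: sum.inter_filter[symmetric])
    also have "{u\<in>\<Union>E. u \<in> e} = e" using e by auto
    finally show "(\<Sum>u\<in>\<Union>E. if u \<in> e then 1 else 0) = (2::nat)" using assms e unfolding edge_set_def by simp
  qed
  finally show ?thesis by simp
qed

lemma low_degree_vertex:
  assumes "edge_set J" "J \<noteq> {}" "real (card J) \<le> x * real (card (\<Union>J))"
  shows "\<exists>u\<in>\<Union>J. real (card (star J u)) \<le> 2 * x"
proof (rule ccontr)
  assume neg: "\<not> ?thesis"
  have fin: "finite (\<Union>J)" using assms edge_set_Union_finite by auto
  have ne: "\<Union>J \<noteq> {}" using assms unfolding edge_set_def by fastforce
  have "2 * real (card J) = (\<Sum>u\<in>\<Union>J. real (card (star J u)))"
    using handshake[OF assms(1)] by (metis of_nat_mult of_nat_numeral of_nat_sum)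
  moreover have "(\<Sum>u\<in>\<Union>J. 2 * x) < (\<Sum>u\<in>\<Union>J. real (card (star J u)))"
    by (rule sum_strict_mono[OF fin ne]) (use neg in \<open>meson not_le\<close>)
  moreover have "2 * real (card J) \<le> (\<Sum>u\<in>\<Union>J. 2 * x)" using assms(3) by (simp add: algebra_simps)
  ultimately show False by linarith
qed

section \<open>Degrees in balanced graphs\<close>

definition triangle :: "'a set set \<Rightarrow> bool" where
  "triangle E \<longleftrightarrow> (\<exists>a b c. a \<noteq> b \<and> b \<noteq> c \<and> a \<noteq> c \<and> E = {{a, b}, {b, c}, {a, c}})"

lemma balanced_size:
  assumes "balanced x \<theta> \<epsilon> E" "\<theta> = 2 - 1 / x" "1 < x"
  shows "real (card E) = x * (real (card (\<Union>E)) - 2) + 1"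
proof -
  have "real (card (\<Union>E)) - real (card E) / x = 2 - 1 / x"
    using balancedD(5)[OF assms(1)] assms(2) unfolding wt_def by simp
  hence "real (card E) / x = real (card (\<Union>E)) - 2 + 1 / x" by linarith
  moreover have "real (card E) = x * (real (card E) / x)" using assms(3) by simp
  ultimately have "real (card E) = x * (real (card (\<Union>E)) - 2 + 1 / x)" by metis
  thus ?thesis using assms(3) by (simp add: distrib_left)
qed

text \<open>Deleting the star at u removes at least one vertex, so the gap of the remainder forces
  deg(u)/x > 1. A remainder without a gap is a single edge; then deg(u) = x (v - 2), which exceeds x
  unless v = 3, and v = 3 leaves only the triangle with x = 2.\<close>

lemma balanced_degree:
  assumes b: "balanced x \<theta> \<epsilon> E" "\<theta> = 2 - 1 / x" "1 < x" "0 < \<epsilon>" and u: "u \<in> \<Union>E"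
  shows "x < real (card (star E u)) \<or> (x = 2 \<and> card (\<Union>E) = 3 \<and> card E = 3)"
proof -
  note B = balancedD[OF b(1)]
  let ?S = "star E u"
  let ?J = "E - ?S"
  have finV: "finite (\<Union>E)" using B edge_set_Union_finite by auto
  have SE: "?S \<subseteq> E" unfolding star_def by auto
  have fS: "finite ?S" using SE B(2) finite_subset by auto
  have cS: "card ?S \<le> card E" using SE B(2) by (intro card_mono) auto
  have cJ: "real (card ?J) = real (card E) - real (card ?S)"
    using card_Diff_subset[OF fS SE] cS by simp
  have VJ: "\<Union>?J \<subseteq> \<Union>E - {u}" unfolding star_def by auto
  have "card (\<Union>?J) \<le> card (\<Union>E - {u})" using finV VJ by (intro card_mono) auto
  moreover have "card (\<Union>E - {u}) = card (\<Union>E) - 1" using u finV by simp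
  moreover have "card (\<Union>E) > 0" using u finV by (auto simp: card_gt_0_iff)
  ultimately have vJ: "real (card (\<Union>?J)) \<le> real (card (\<Union>E)) - 1" by linarith
  have wJ: "wt x ?J \<le> \<theta> - 1 + real (card ?S) / x"
  proof -
    have "real (card ?J) / x = real (card E) / x - real (card ?S) / x" unfolding cJ by (simp add: diff_divide_distrib)
    thus ?thesis using vJ B(5) unfolding wt_def by linarith
  qed
  obtain e where e: "e \<in> E" "u \<in> e" using u by auto
  have ce: "card e = 2" using e B(1) unfolding edge_set_def by auto
  then obtain w where w: "e = {u, w}" "w \<noteq> u" using e(2) unfolding card_2_iff by auto
  have Jne: "?J \<noteq> {}"
  proof
    assume "?J = {}"
    obtain h where h: "h \<in> E" "h \<noteq> e" "w \<in> h" using balanced_second_edge[OF b(1,3) e(1), of w] w by auto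
    have "u \<in> h" using \<open>?J = {}\<close> h(1) unfolding star_def by auto
    hence "e \<subseteq> h" using w h by auto
    moreover have "card h = 2" using h(1) B(1) unfolding edge_set_def by auto
    ultimately have "e = h" using ce by (metis card_subset_eq card.infinite zero_neq_numeral)
    thus False using h by simp
  qed
  have dx: "x < real (card ?S)" if "1 < real (card ?S) / x" using that b(3) by (simp add: field_simps)
  show ?thesis
  proof (cases "2 \<le> card ?J")
    case True
    have "\<theta> + \<epsilon> \<le> wt x ?J" using B(7)[of ?J] True e unfolding star_def by auto
    hence "1 < real (card ?S) / x" using wJ b(4) by linarith
    thus ?thesis using dx by simp
  next
    case False
    have "card ?J > 0" using Jne B(2) by (simp add: card_gt_0_iff)
    hence c1: "card ?J = 1" using False by linarith
    have sz: "real (card E) = x * (real (card (\<Union>E)) - 2) + 1" by (rule balanced_size[OF b(1-3)])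
    hence d: "real (card ?S) = x * (real (card (\<Union>E)) - 2)" using cJ c1 by simp
    have v3: "3 \<le> card (\<Union>E)" using card_Union_ge_3[OF B(1) B(3)] .
    show ?thesis
    proof (cases "card (\<Union>E) = 3")
      case True
      hence dx: "real (card ?S) = x" using d by simp
      have "E \<subseteq> {a. a \<subseteq> \<Union>E \<and> card a = 2}" using B(1) unfolding edge_set_def by auto
      hence "card E \<le> card {a. a \<subseteq> \<Union>E \<and> card a = 2}" using finV by (intro card_mono) auto
      also have "\<dots> = 3 choose 2" using n_subsets[OF finV, of 2] True by simp
      also have "\<dots> = 3" by (simp add: numeral_eq_Suc)
      finally have "card E \<le> 3" .
      moreover have "card E = card ?S + 1" using cJ c1 by linarith
      moreover have "1 < card ?S" using dx b(3) by linarith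
      ultimately have "card ?S = 2" "card E = 3" by linarith+
      thus ?thesis using dx True by simp
    next
      case False
      hence "4 \<le> card (\<Union>E)" using v3 by simp
      hence "x * 2 \<le> x * (real (card (\<Union>E)) - 2)" using b(3) by (intro mult_left_mono) auto
      thus ?thesis using d b(3) by linarith
    qed
  qed
qed

lemma triangleI:
  assumes "edge_set E" "card (\<Union>E) = 3" "card E = 3"
  shows "triangle E"
proof -
  have finV: "finite (\<Union>E)" using assms(1) by (rule edge_set_Union_finite)
  obtain a b c where abc: "\<Union>E = {a, b, c}" "a \<noteq> b" "b \<noteq> c" "a \<noteq> c" using assms(2) by (auto simp: card_3_iff)
  have "e \<in> {{a, b}, {b, c}, {a, c}}" if "e \<in> E" for e
  proof -
    have "card e = 2" "e \<subseteq> {a, b, c}" using that assms(1) abc(1) unfolding edge_set_def by auto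
    then obtain p q where "e = {p, q}" "p \<noteq> q" "p \<in> {a, b, c}" "q \<in> {a, b, c}" by (auto simp: card_2_iff)
    thus ?thesis by auto
  qed
  hence sub: "E \<subseteq> {{a, b}, {b, c}, {a, c}}" by auto
  have "card {{a, b}, {b, c}, {a, c}} = 3" using abc by (auto simp: doubleton_eq_iff)
  hence "E = {{a, b}, {b, c}, {a, c}}" using sub assms(3) by (intro card_subset_eq) auto
  thus ?thesis unfolding triangle_def using abc by blast
qed

section \<open>Colourings from vertex orders, partitions and orientations\<close>

lemma arrowsD: "arrows G E1 E2 \<Longrightarrow> R \<subseteq> G \<Longrightarrow> (\<exists>A\<subseteq>R. copy E1 A) \<or> (\<exists>B\<subseteq>G - R. copy E2 B)"
  unfolding arrows_def by simp

lemma arrows_sym: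
  assumes "arrows G E2 E1" shows "arrows G E1 E2"
  unfolding arrows_def
proof (intro allI impI)
  fix R assume R: "R \<subseteq> G"
  have eq: "G - (G - R) = R" using R by auto
  from arrowsD[OF assms, of "G - R"]
  show "(\<exists>A\<subseteq>R. copy E1 A) \<or> (\<exists>B\<subseteq>G - R. copy E2 B)"
    unfolding eq by (subst disj_commute) simp
qed

lemma not_arrowsI:
  assumes "R \<subseteq> G" "\<And>A. A \<subseteq> R \<Longrightarrow> \<not> copy E1 A" "\<And>B. B \<subseteq> G - R \<Longrightarrow> \<not> copy E2 B"
  shows "\<not> arrows G E1 E2"
proof
  assume "arrows G E1 E2"
  from arrowsD[OF this assms(1)] show False
    by (elim disjE exE conjE) (erule (1) notE[OF assms(2)], erule (1) notE[OF assms(3)])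
qed

lemma not_arrowsE:
  assumes "\<not> arrows G E1 E2"
  obtains R where "R \<subseteq> G" "\<And>A. A \<subseteq> R \<Longrightarrow> \<not> copy E1 A" "\<And>B. B \<subseteq> G - R \<Longrightarrow> \<not> copy E2 B"
proof -
  obtain R where R: "R \<subseteq> G" "\<not> ((\<exists>A\<subseteq>R. copy E1 A) \<or> (\<exists>B\<subseteq>G - R. copy E2 B))"
    using assms unfolding arrows_def by (simp only: not_all not_imp) (elim exE conjE)
  show ?thesis by (rule that[OF R(1)]) (use R(2) in simp_all)
qed

text \<open>The argument \<open>T\<close> fixes the vertex type of the copies.\<close>

definition mindeg :: "'a set set \<Rightarrow> 'b itself \<Rightarrow> nat \<Rightarrow> bool" where
  "mindeg E T k \<longleftrightarrow> (\<forall>A :: 'b set set. copy E A \<longrightarrow> (\<forall>u\<in>\<Union>A. k \<le> card (star A u)))"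

lemma degenerate_induct:
  assumes fin: "finite G" and deg: "\<And>J. J \<subseteq> G \<Longrightarrow> J \<noteq> {} \<Longrightarrow> \<exists>u\<in>\<Union>J. card (star J u) \<le> D"
    and base: "P {}" and step: "\<And>J u. J \<subseteq> G \<Longrightarrow> u \<in> \<Union>J \<Longrightarrow> card (star J u) \<le> D \<Longrightarrow> P (J - star J u) \<Longrightarrow> P J"
  shows "P G"
proof -
  have "J \<subseteq> G \<Longrightarrow> P J" for J
  proof (induction "card J" arbitrary: J rule: less_induct)
    case less
    have finJ: "finite J" using less.prems fin finite_subset by auto
    show ?case
    proof (cases "J = {}")
      case False
      obtain u where u: "u \<in> \<Union>J" "card (star J u) \<le> D" using deg[OF less.prems False] by auto
      have "star J u \<noteq> {}" "star J u \<subseteq> J" using u(1) unfolding star_def by auto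
      hence "J - star J u \<subset> J" by auto
      hence "card (J - star J u) < card J" by (rule psubset_card_mono[OF finJ])
      hence "P (J - star J u)" using less.hyps less.prems by auto
      thus ?thesis using step[OF less.prems u] by simp
    qed (simp add: base)
  qed
  thus ?thesis by simp
qed

lemma copy_nonempty: "copy E A \<Longrightarrow> E \<noteq> {} \<Longrightarrow> A \<noteq> {}"
  unfolding copy_def by auto

text \<open>At u at most a edges have the colour in question, so a copy of minimum degree a + 1
  cannot use u and would already lie in the old part.\<close>

lemma extend_vertex:
  fixes J :: "'b set set"
  assumes fin: "finite J" and R0: "R0 \<subseteq> J - star J u" "\<And>A. A \<subseteq> R0 \<Longrightarrow> \<not> copy E A"
    and S1: "S1 \<subseteq> star J u" "card S1 \<le> a" and md: "mindeg E TYPE('b) (a + 1)" and A: "A \<subseteq> R0 \<union> S1"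
  shows "\<not> copy E A"
proof
  assume cp: "copy E A"
  show False
  proof (cases "u \<in> \<Union>A")
    case True
    have "star A u \<subseteq> S1" using A R0(1) unfolding star_def by auto
    hence "card (star A u) \<le> card S1" using S1(1) finite_star[OF fin, of u] finite_subset by (intro card_mono) auto
    moreover have "a + 1 \<le> card (star A u)" using md cp True unfolding mindeg_def by blast
    ultimately show False using S1(2) by linarith
  next
    case False
    hence "A \<subseteq> R0" using A S1(1) unfolding star_def by auto
    thus False using R0(2) cp by auto
  qed
qed

text \<open>The edges at u are divided into at most a red and at most b blue ones, after which no
  copy in its own colour passes through u.\<close>

lemma extend_split:
  fixes J :: "'b set set"
  assumes fin: "finite J" and deg: "card (star J u) \<le> a + b"
    and md1: "mindeg E1 TYPE('b) (a + 1)" and md2: "mindeg E2 TYPE('b) (b + 1)"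
    and IH: "\<not> arrows (J - star J u) E1 E2"
  shows "\<not> arrows J E1 E2"
proof -
  obtain R0 where R0: "R0 \<subseteq> J - star J u" "\<And>A. A \<subseteq> R0 \<Longrightarrow> \<not> copy E1 A" "\<And>B. B \<subseteq> J - star J u - R0 \<Longrightarrow> \<not> copy E2 B"
    by (rule not_arrowsE[OF IH]) (rule that)
  obtain S1 where S1: "S1 \<subseteq> star J u" "card S1 = min a (card (star J u))"
    by (rule obtain_subset_with_card_n[of "min a (card (star J u))" "star J u"]) auto
  have SJ: "star J u \<subseteq> J" unfolding star_def by auto
  have fS: "finite (star J u)" using fin by (rule finite_star)
  have "card (star J u - S1) = card (star J u) - card S1"
    using S1(1) fS by (intro card_Diff_subset) (auto intro: finite_subset)
  hence cb: "card (star J u - S1) \<le> b" using S1(2) deg by auto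
  show ?thesis
  proof (rule not_arrowsI)
    show "R0 \<union> S1 \<subseteq> J" using R0(1) S1(1) SJ by auto
    show "\<not> copy E1 A" if "A \<subseteq> R0 \<union> S1" for A
      by (rule extend_vertex[OF fin R0(1,2) S1(1) _ md1 that]) (use S1(2) in auto)
    show "\<not> copy E2 B" if "B \<subseteq> J - (R0 \<union> S1)" for B
      by (rule extend_vertex[OF fin _ R0(3) _ cb md2, of "J - star J u - R0"]) (use that in auto)
  qed
qed

lemma empty_not_arrows:
  assumes "E1 \<noteq> {}" "E2 \<noteq> {}"
  shows "\<not> arrows {} E1 E2"
proof (rule not_arrowsI[of "{}"])
  show "\<not> copy E1 A" if "A \<subseteq> {}" for A using copy_nonempty[OF _ assms(1), of A] that by blast
  show "\<not> copy E2 B" if "B \<subseteq> {} - {}" for B using copy_nonempty[OF _ assms(2), of B] that by blast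
qed simp

text \<open>The map s divides the vertices into two sides; edges within a side will be red and
  crossing edges blue.\<close>

definition inside :: "('b \<Rightarrow> bool) \<Rightarrow> 'b set \<Rightarrow> bool" where
  "inside s e \<longleftrightarrow> (\<exists>c. \<forall>w\<in>e. s w = c)"

definition bipartite :: "'a set set \<Rightarrow> bool" where
  "bipartite E \<longleftrightarrow> (\<exists>s. \<forall>e\<in>E. \<not> inside s e)"

lemma bipartite_copy:
  assumes "copy E B" "\<forall>e\<in>B. \<not> inside s e" shows "bipartite E"
proof -
  obtain f where f: "B = (\<lambda>e. f ` e) ` E" using assms(1) unfolding copy_def by auto
  have "\<not> inside (s \<circ> f) e" if "e \<in> E" for e
    using assms(2) that unfolding f inside_def by auto
  thus ?thesis unfolding bipartite_def by blast
qed

text \<open>Crossing edges form a bipartite graph and so contain no copy of E2. The sides are chosen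
  by adding vertices in a degenerate order: of at most 2a + 1 edges at u, at most a lead to one of
  the sides, and u joins that side.\<close>

lemma split_nonbipartite:
  fixes G :: "'b set set"
  assumes es: "edge_set G" and deg: "\<And>J. J \<subseteq> G \<Longrightarrow> J \<noteq> {} \<Longrightarrow> \<exists>u\<in>\<Union>J. card (star J u) \<le> 2 * a + 1"
    and md: "mindeg E1 TYPE('b) (a + 1)" and nb: "\<not> bipartite E2" and ne: "E1 \<noteq> {}"
  shows "\<not> arrows G E1 E2"
proof -
  have fin: "finite G" using es unfolding edge_set_def by simp
  have "\<exists>s. \<forall>A\<subseteq>{e\<in>G. inside s e}. \<not> copy E1 A"
  proof (rule degenerate_induct[OF fin deg, where P = "\<lambda>J. \<exists>s. \<forall>A\<subseteq>{e\<in>J. inside s e}. \<not> copy E1 A"])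
    show "\<exists>s. \<forall>A\<subseteq>{e\<in>{}. inside s e}. \<not> copy E1 A" using copy_nonempty[OF _ ne] by auto
    fix J u assume J: "J \<subseteq> G" and u: "u \<in> \<Union>J" and d: "card (star J u) \<le> 2 * a + 1"
      and "\<exists>s. \<forall>A\<subseteq>{e\<in>J - star J u. inside s e}. \<not> copy E1 A"
    then obtain s where s: "\<And>A. A \<subseteq> {e\<in>J - star J u. inside s e} \<Longrightarrow> \<not> copy E1 A" by auto
    have finJ: "finite J" using J fin finite_subset by auto
    have fS: "finite (star J u)" using finJ by (rule finite_star)
    define S where "S c = {e\<in>star J u. \<forall>w\<in>e - {u}. s w = c}" for c
    have ne2: "e - {u} \<noteq> {}" if "e \<in> star J u" for e
    proof
      assume "e - {u} = {}"
      hence "card e \<le> card {u}" by (intro card_mono) auto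
      thus False using that J es unfolding star_def edge_set_def by auto
    qed
    have disj: "S True \<inter> S False = {}"
    proof (rule ccontr)
      assume "\<not> ?thesis"
      then obtain e where e: "e \<in> S True" "e \<in> S False" by auto
      have "e \<in> star J u" using e unfolding S_def by auto
      then obtain w where "w \<in> e - {u}" using ne2 by blast
      thus False using e unfolding S_def by auto
    qed
    have "card (S True) + card (S False) = card (S True \<union> S False)"
      using disj fS unfolding S_def by (intro card_Un_disjoint[symmetric]) auto
    also have "\<dots> \<le> card (star J u)" using fS unfolding S_def by (intro card_mono) auto
    finally have "card (S True) + card (S False) \<le> 2 * a + 1" using d by simp
    hence "card (S True) \<le> a \<or> card (S False) \<le> a" by linarith
    then obtain c where c: "card (S c) \<le> a" by auto
    have sub: "{e\<in>J. inside (s(u := c)) e} \<subseteq> {e\<in>J - star J u. inside s e} \<union> S c"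
    proof
      fix e assume e: "e \<in> {e\<in>J. inside (s(u := c)) e}"
      show "e \<in> {e\<in>J - star J u. inside s e} \<union> S c"
      proof (cases "u \<in> e")
        case True
        from e obtain c' where c': "\<forall>w\<in>e. (s(u := c)) w = c'" unfolding inside_def by auto
        have "c' = c" using c' True by auto
        hence "\<forall>w\<in>e - {u}. s w = c" using c' by auto
        thus ?thesis using e True unfolding S_def star_def by auto
      next
        case False
        from e obtain c' where c': "\<forall>w\<in>e. (s(u := c)) w = c'" unfolding inside_def by auto
        have "\<forall>w\<in>e. s w = c'" using c' False by (metis fun_upd_other)
        hence "inside s e" unfolding inside_def by auto
        thus ?thesis using e False unfolding star_def by auto
      qed
    qed
    show "\<exists>s. \<forall>A\<subseteq>{e\<in>J. inside s e}. \<not> copy E1 A"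
    proof (intro exI allI impI)
      fix A assume "A \<subseteq> {e\<in>J. inside (s(u := c)) e}"
      hence A: "A \<subseteq> {e\<in>J - star J u. inside s e} \<union> S c" using sub by auto
      show "\<not> copy E1 A"
        by (rule extend_vertex[OF finJ _ s _ c md A]) (auto simp: S_def)
    qed
  qed
  then obtain s where s: "\<And>A. A \<subseteq> {e\<in>G. inside s e} \<Longrightarrow> \<not> copy E1 A" by auto
  show ?thesis
  proof (rule not_arrowsI[of "{e\<in>G. inside s e}"])
    show "\<not> copy E2 B" if "B \<subseteq> G - {e\<in>G. inside s e}" for B
    proof
      assume cp: "copy E2 B"
      have "\<forall>e\<in>B. \<not> inside s e" using that by auto
      from bipartite_copy[OF cp this] nb show False by simp
    qed
    show "{e\<in>G. inside s e} \<subseteq> G" by simp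
    show "\<not> copy E1 A" if "A \<subseteq> {e\<in>G. inside s e}" for A by (rule s[OF that])
  qed
qed

text \<open>Hall's theorem for assigning edges to their ends under vertex capacities, by the usual
  induction. A tight proper part is assigned on its own and uses up the capacity of its vertices;
  without such a part, assigning one edge costs one unit of capacity, which every other part can
  spare.\<close>

lemma capacity_orientation:
  fixes G :: "'b set set" and cap :: "'b \<Rightarrow> nat"
  assumes "finite G" "\<And>e. e \<in> G \<Longrightarrow> finite e" "\<And>J. J \<subseteq> G \<Longrightarrow> card J \<le> sum cap (\<Union>J)"
  shows "\<exists>q. (\<forall>e\<in>G. q e \<in> e) \<and> (\<forall>v. card {e\<in>G. q e = v} \<le> cap v)"
  using assms
proof (induction "card G" arbitrary: G cap rule: less_induct)
  case less
  have finU: "finite (\<Union>J)" if "J \<subseteq> G" for J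
  proof (rule finite_Union)
    show "finite J" by (rule finite_subset[OF that less.prems(1)])
    show "finite e" if "e \<in> J" for e using less.prems(2) \<open>J \<subseteq> G\<close> that by auto
  qed
  show ?case
  proof (cases "\<exists>J. J \<subset> G \<and> J \<noteq> {} \<and> card J = sum cap (\<Union>J)")
    case True
    then obtain J where J: "J \<subset> G" "J \<noteq> {}" "card J = sum cap (\<Union>J)" by auto
    have finJ: "finite J" using J(1) less.prems(1) finite_subset by auto
    have "card J < card G" by (rule psubset_card_mono[OF less.prems(1) J(1)])
    obtain q1 where q1: "\<forall>e\<in>J. q1 e \<in> e" "\<forall>v. card {e\<in>J. q1 e = v} \<le> cap v"
    proof -
      have "\<exists>q. (\<forall>e\<in>J. q e \<in> e) \<and> (\<forall>v. card {e\<in>J. q e = v} \<le> cap v)"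
      proof (rule less.hyps)
        show "card J < card G" by fact
        show "finite J" by fact
        show "finite e" if "e \<in> J" for e using less.prems(2) J(1) that by auto
        show "card K \<le> sum cap (\<Union>K)" if "K \<subseteq> J" for K using less.prems(3) J(1) that by auto
      qed
      thus ?thesis using that by auto
    qed
    define cap' where "cap' v = (if v \<in> \<Union>J then 0 else cap v)" for v
    have lt2: "card (G - J) < card G" using J less.prems(1) by (intro psubset_card_mono) auto
    have K2: "card K \<le> sum cap' (\<Union>K)" if K: "K \<subseteq> G - J" for K
    proof -
      have fK: "finite K" using K less.prems(1) finite_subset by auto
      have fU: "finite (\<Union>K)" "finite (\<Union>J)" using finU K J(1) by auto
      have "card K + card J = card (K \<union> J)" using fK finJ K by (intro card_Un_disjoint[symmetric]) auto
      also have "\<dots> \<le> sum cap (\<Union>(K \<union> J))" using K J(1) by (intro less.prems(3)) auto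
      also have "\<Union>(K \<union> J) = (\<Union>K - \<Union>J) \<union> \<Union>J" by auto
      also have "sum cap ((\<Union>K - \<Union>J) \<union> \<Union>J) = sum cap (\<Union>K - \<Union>J) + sum cap (\<Union>J)"
        using fU by (intro sum.union_disjoint) auto
      finally have "card K \<le> sum cap (\<Union>K - \<Union>J)" using J(3) by simp
      also have "\<dots> = sum cap' (\<Union>K - \<Union>J)" unfolding cap'_def by (intro sum.cong) auto
      also have "\<dots> \<le> sum cap' (\<Union>K)" using fU by (intro sum_mono2) auto
      finally show ?thesis .
    qed
    obtain q2 where q2: "\<forall>e\<in>G - J. q2 e \<in> e" "\<forall>v. card {e\<in>G - J. q2 e = v} \<le> cap' v"
    proof -
      have "\<exists>q. (\<forall>e\<in>G - J. q e \<in> e) \<and> (\<forall>v. card {e\<in>G - J. q e = v} \<le> cap' v)"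
        by (rule less.hyps[OF lt2 _ _ K2]) (use less.prems(1,2) in auto)
      thus ?thesis using that by auto
    qed
    define q where "q e = (if e \<in> J then q1 e else q2 e)" for e
    have "card {e\<in>G. q e = v} \<le> cap v" for v
    proof -
      have eq: "{e\<in>G. q e = v} = {e\<in>J. q1 e = v} \<union> {e\<in>G - J. q2 e = v}" unfolding q_def using J(1) by auto
      have le: "card {e\<in>G. q e = v} \<le> card {e\<in>J. q1 e = v} + card {e\<in>G - J. q2 e = v}"
        unfolding eq by (rule card_Un_le)
      show ?thesis
      proof (cases "v \<in> \<Union>J")
        case True
        hence "card {e\<in>G - J. q2 e = v} \<le> 0" using q2(2)[rule_format, of v] unfolding cap'_def by simp
        moreover have "card {e\<in>J. q1 e = v} \<le> cap v" using q1(2) by simp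
        ultimately show ?thesis using le by linarith
      next
        case False
        hence e0: "{e\<in>J. q1 e = v} = {}" using q1(1) by auto
        have "card {e\<in>G - J. q2 e = v} \<le> cap v" using q2(2)[rule_format, of v] False unfolding cap'_def by simp
        thus ?thesis using le unfolding e0 by simp
      qed
    qed
    moreover have "\<forall>e\<in>G. q e \<in> e" unfolding q_def using q1(1) q2(1) by auto
    ultimately show ?thesis by blast
  next
    case False
    show ?thesis
    proof (cases "G = {}")
      case True
      thus ?thesis by simp
    next
      case ne: False
      then obtain e where e: "e \<in> G" by auto
      have "card {e} \<le> sum cap (\<Union>{e})" using e by (intro less.prems(3)) auto
      hence "sum cap e \<noteq> 0" by simp
      then obtain v0 where v0: "v0 \<in> e" "cap v0 \<noteq> 0" using sum.neutral by metis
      define cap' where "cap' = cap(v0 := cap v0 - 1)"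
      have lt2: "card (G - {e}) < card G" using e less.prems(1) by (intro psubset_card_mono) auto
      have K2: "card K \<le> sum cap' (\<Union>K)" if K: "K \<subseteq> G - {e}" for K
      proof (cases "K = {}")
        case False
        have KG: "K \<subset> G" using K e by auto
        have fU: "finite (\<Union>K)" using finU KG by auto
        have "card K \<noteq> sum cap (\<Union>K)" using \<open>\<not> (\<exists>J. J \<subset> G \<and> J \<noteq> {} \<and> card J = sum cap (\<Union>J))\<close> KG False by auto
        moreover have "card K \<le> sum cap (\<Union>K)" using KG by (intro less.prems(3)) auto
        ultimately have lt: "card K < sum cap (\<Union>K)" by simp
        have "sum cap (\<Union>K) \<le> sum cap' (\<Union>K) + (\<Sum>v\<in>\<Union>K. if v = v0 then 1 else 0)"
          unfolding sum.distrib[symmetric] cap'_def by (intro sum_mono) auto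
        also have "(\<Sum>v\<in>\<Union>K. if v = v0 then 1 else 0) \<le> (1::nat)" using fU by simp
        finally show ?thesis using lt by simp
      qed simp
      obtain q where q: "\<forall>e\<in>G - {e}. q e \<in> e" "\<forall>v. card {x\<in>G - {e}. q x = v} \<le> cap' v"
      proof -
        have "\<exists>q. (\<forall>x\<in>G - {e}. q x \<in> x) \<and> (\<forall>v. card {x\<in>G - {e}. q x = v} \<le> cap' v)"
          by (rule less.hyps[OF lt2 _ _ K2]) (use less.prems(1,2) in auto)
        thus ?thesis using that by auto
      qed
      have "card {x\<in>G. (q(e := v0)) x = v} \<le> cap v" for v
      proof (cases "v = v0")
        case True
        have "{x\<in>G. (q(e := v0)) x = v} = insert e {x\<in>G - {e}. q x = v}" using True e by auto
        hence "card {x\<in>G. (q(e := v0)) x = v} \<le> Suc (card {x\<in>G - {e}. q x = v})"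
          using less.prems(1) by (simp add: card_insert_if)
        also have "\<dots> \<le> Suc (cap' v)" using q(2) by simp
        also have "\<dots> = cap v" unfolding cap'_def using True v0(2) by simp
        finally show ?thesis .
      next
        case False
        have "{x\<in>G. (q(e := v0)) x = v} = {x\<in>G - {e}. q x = v}" using False by auto
        moreover have "cap' v = cap v" unfolding cap'_def using False by simp
        ultimately show ?thesis using q(2)[rule_format, of v] by simp
      qed
      moreover have "\<forall>x\<in>G. (q(e := v0)) x \<in> x" using q(1) v0(1) by auto
      ultimately show ?thesis by blast
    qed
  qed
qed

text \<open>Every vertex receives at most c1 + c2 edges, of which at most c1 become red and at most
  c2 blue. Counting the edges of a monochromatic graph by the vertices receiving them shows that it
  has too few edges to be a copy.\<close>

lemma split_oriented:
  fixes G :: "'b set set"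
  assumes es: "edge_set G" and G: "\<And>J. J \<subseteq> G \<Longrightarrow> card J \<le> (c1 + c2) * card (\<Union>J)"
    and d1: "\<And>A :: 'b set set. copy E1 A \<Longrightarrow> c1 * card (\<Union>A) < card A"
    and d2: "\<And>A :: 'b set set. copy E2 A \<Longrightarrow> c2 * card (\<Union>A) < card A"
  shows "\<not> arrows G E1 E2"
proof -
  have finG: "finite G" using es unfolding edge_set_def by simp
  have fe: "finite e" if "e \<in> G" for e using es that unfolding edge_set_def by (intro card_ge_0_finite) simp
  obtain q where q: "\<forall>e\<in>G. q e \<in> e" "\<forall>v. card {e\<in>G. q e = v} \<le> c1 + c2"
    using capacity_orientation[OF finG fe, of "\<lambda>_. c1 + c2"] G by (auto simp: mult.commute)
  have "\<exists>S. S \<subseteq> {e\<in>G. q e = v} \<and> card S = min c1 (card {e\<in>G. q e = v})" for v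
    by (rule obtain_subset_with_card_n[of "min c1 (card {e\<in>G. q e = v})" "{e\<in>G. q e = v}"]) auto
  then obtain S where S: "\<And>v. S v \<subseteq> {e\<in>G. q e = v}" "\<And>v. card (S v) = min c1 (card {e\<in>G. q e = v})" by metis
  define R where "R = (\<Union>v. S v)"
  have fib: "card A \<le> c * card (\<Union>A)" if A: "A \<subseteq> G" "\<And>v. card {e\<in>A. q e = v} \<le> c" for A c
  proof -
    have finA: "finite A" using A(1) finG finite_subset by auto
    have fU: "finite (\<Union>A)" using edge_set_Union_finite[OF edge_set_subset[OF es A(1)]] .
    have "A \<subseteq> (\<Union>v\<in>\<Union>A. {e\<in>A. q e = v})" using q(1) A(1) by blast
    moreover have "finite (\<Union>v\<in>\<Union>A. {e\<in>A. q e = v})" by (rule finite_subset[OF _ finA]) auto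
    ultimately have "card A \<le> card (\<Union>v\<in>\<Union>A. {e\<in>A. q e = v})" by (rule card_mono[rotated])
    also have "\<dots> \<le> (\<Sum>v\<in>\<Union>A. card {e\<in>A. q e = v})" using fU by (rule card_UN_le)
    also have "\<dots> \<le> (\<Sum>v\<in>\<Union>A. c)" using A(2) by (intro sum_mono) auto
    finally show ?thesis by (simp add: mult.commute)
  qed
  show ?thesis
  proof (rule not_arrowsI)
    show RG: "R \<subseteq> G" unfolding R_def using S(1) by blast
    have finf: "finite {e\<in>G. q e = v}" for v using finG by simp
    show "\<not> copy E1 A" if A: "A \<subseteq> R" for A
    proof
      assume cp: "copy E1 A"
      have "card {e\<in>A. q e = v} \<le> c1" for v
      proof -
        have "{e\<in>A. q e = v} \<subseteq> S v" using A S(1) unfolding R_def by blast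
        hence "card {e\<in>A. q e = v} \<le> card (S v)" using finite_subset[OF S(1) finf] by (intro card_mono) auto
        thus ?thesis using S(2)[of v] by simp
      qed
      hence "card A \<le> c1 * card (\<Union>A)" using A RG by (intro fib) auto
      thus False using d1[OF cp] by simp
    qed
    show "\<not> copy E2 A" if A: "A \<subseteq> G - R" for A
    proof
      assume cp: "copy E2 A"
      have "card {e\<in>A. q e = v} \<le> c2" for v
      proof -
        have "{e\<in>A. q e = v} \<subseteq> {e\<in>G. q e = v} - S v" using A unfolding R_def by blast
        hence "card {e\<in>A. q e = v} \<le> card ({e\<in>G. q e = v} - S v)" using finf by (intro card_mono) auto
        also have "\<dots> = card {e\<in>G. q e = v} - card (S v)" using finite_subset[OF S(1) finf] S(1) by (intro card_Diff_subset) auto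
        also have "\<dots> \<le> c2" using S(2)[of v] q(2)[rule_format, of v] by auto
        finally show ?thesis .
      qed
      hence "card A \<le> c2 * card (\<Union>A)" using A by (intro fib) auto
      thus False using d2[OF cp] by simp
    qed
  qed
qed

section \<open>Bipartite balanced graphs, bridges, and regular graphs\<close>

lemma bipartite_card_le:
  assumes es: "edge_set E" and bp: "bipartite E"
  shows "4 * card E \<le> card (\<Union>E) ^ 2"
proof -
  obtain s where s: "\<forall>e\<in>E. \<not> inside s e" using bp unfolding bipartite_def by auto
  define P where "P = {v\<in>\<Union>E. s v}"
  define N where "N = {v\<in>\<Union>E. \<not> s v}"
  have fV: "finite (\<Union>E)" using es by (rule edge_set_Union_finite)
  have fin: "finite P" "finite N" unfolding P_def N_def by (rule finite_subset[OF _ fV]; auto)+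
  have "E \<subseteq> (\<lambda>(a, b). {a, b}) ` (P \<times> N)"
  proof
    fix e assume e: "e \<in> E"
    obtain a b where ab: "e = {a, b}" "a \<noteq> b" using e es unfolding edge_set_def card_2_iff by blast
    have "s a \<noteq> s b" using s e ab unfolding inside_def by auto
    hence "(s a \<and> \<not> s b) \<or> (s b \<and> \<not> s a)" by auto
    thus "e \<in> (\<lambda>(a, b). {a, b}) ` (P \<times> N)"
    proof
      assume "s a \<and> \<not> s b"
      hence "(a, b) \<in> P \<times> N" unfolding P_def N_def using e ab by auto
      thus ?thesis using ab by (intro image_eqI[of _ _ "(a, b)"]) auto
    next
      assume "s b \<and> \<not> s a"
      hence "(b, a) \<in> P \<times> N" unfolding P_def N_def using e ab by auto
      thus ?thesis using ab by (intro image_eqI[of _ _ "(b, a)"]) auto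
    qed
  qed
  moreover have fPN: "finite (P \<times> N)" using fin by (rule finite_cartesian_product)
  ultimately have "card E \<le> card ((\<lambda>(a, b). {a, b}) ` (P \<times> N))" by (intro card_mono finite_imageI)
  also have "\<dots> \<le> card (P \<times> N)" by (rule card_image_le[OF fPN])
  finally have 1: "card E \<le> card P * card N" by (simp only: card_cartesian_product)
  have "card P + card N = card (P \<union> N)" unfolding P_def N_def using fin unfolding P_def N_def by (intro card_Un_disjoint[symmetric]) auto
  also have "P \<union> N = \<Union>E" unfolding P_def N_def by auto
  finally have 2: "card (\<Union>E) = card P + card N" by simp
  have "0 \<le> (int (card P) - int (card N)) ^ 2" by simp
  hence "4 * (int (card P) * int (card N)) \<le> (int (card P) + int (card N)) ^ 2" by (simp add: power2_eq_square algebra_simps)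
  hence "4 * (card P * card N) \<le> (card P + card N) ^ 2" by (metis (mono_tags, opaque_lifting) of_nat_add of_nat_le_iff of_nat_mult of_nat_numeral of_nat_power)
  thus ?thesis unfolding 2 using 1 by linarith
qed

text \<open>A bipartite graph has at most v^2/4 edges; inserting e = x (v - 2) + 1 and cancelling v
  - 2 gives v \<ge> 4x - 2. With x - c > 1/2 this makes (x - c) v exceed 2x - 1, which is c v <
  e.\<close>

lemma balanced_bipartite_dense:
  assumes b: "balanced x \<theta> \<epsilon> E" "\<theta> = 2 - 1 / x" "1 < x" and bp: "bipartite E"
    and c: "real c + 1 / 2 < x"
  shows "c * card (\<Union>E) < card E"
proof -
  note B = balancedD[OF b(1)]
  define v where "v = real (card (\<Union>E))"
  have v3: "3 \<le> v" unfolding v_def using card_Union_ge_3[OF B(1) B(3)] by simp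
  have e: "real (card E) = x * (v - 2) + 1" unfolding v_def by (rule balanced_size[OF b(1-3)])
  have "4 * real (card E) \<le> v ^ 2" unfolding v_def
    using bipartite_card_le[OF B(1) bp] by (metis of_nat_le_iff of_nat_mult of_nat_numeral of_nat_power)
  hence "4 * x * (v - 2) \<le> (v + 2) * (v - 2)" unfolding e by (simp add: algebra_simps power2_eq_square)
  hence "4 * x \<le> v + 2" using v3 by (simp add: mult_le_cancel_right)
  hence "2 * (2 * x - 1) \<le> v" by simp
  hence "(x - real c) * (2 * (2 * x - 1)) \<le> (x - real c) * v" using c by (intro mult_left_mono) auto
  moreover have "1 / 2 * (2 * (2 * x - 1)) < (x - real c) * (2 * (2 * x - 1))"
    using c b(3) by (intro mult_strict_right_mono) auto
  ultimately have "2 * x - 1 < (x - real c) * v" by simp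
  hence "real c * v < real (card E)" unfolding e by (simp add: algebra_simps)
  thus ?thesis unfolding v_def by (metis of_nat_less_iff of_nat_mult)
qed

text \<open>W contains the vertices on one side of the bridge g. Both sides weigh at least \<theta>,
  so B would weigh at least 2 \<theta> - 1/x, which exceeds \<theta> because x > 1.\<close>

lemma balanced_bridgeless:
  assumes b: "balanced x \<theta> \<epsilon> B" "\<theta> = 2 - 1 / x" "1 < x"
    and g: "g \<in> B" and W: "\<And>e. e \<in> B \<Longrightarrow> e \<noteq> g \<Longrightarrow> e \<subseteq> W \<or> e \<inter> W = {}"
    and B1: "e1 \<in> B" "e1 \<noteq> g" "e1 \<subseteq> W" and B2: "e2 \<in> B" "e2 \<noteq> g" "e2 \<inter> W = {}"
  shows False
proof -
  note B = balancedD[OF b(1)]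
  define K1 where "K1 = {e\<in>B. e \<noteq> g \<and> e \<subseteq> W}"
  define K2 where "K2 = {e\<in>B. e \<noteq> g \<and> e \<inter> W = {}}"
  have ne: "e \<noteq> {}" if "e \<in> B" for e using B(1) that unfolding edge_set_def by auto
  have fV: "finite (\<Union>B)" using B(1) by (rule edge_set_Union_finite)
  have BK: "B = insert g (K1 \<union> K2)" unfolding K1_def K2_def using W g by auto
  have disj: "K1 \<inter> K2 = {}" unfolding K1_def K2_def using ne by blast
  have "card B = Suc (card (K1 \<union> K2))"
  proof -
    have "finite (K1 \<union> K2)" "g \<notin> K1 \<union> K2" using B(2) unfolding K1_def K2_def by auto
    thus ?thesis using BK by (metis card_insert_disjoint)
  qed
  also have "card (K1 \<union> K2) = card K1 + card K2"
    using disj B(2) unfolding K1_def K2_def by (intro card_Un_disjoint) auto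
  finally have "real (card B) = real (card K1) + real (card K2) + 1" by simp
  hence cB: "real (card B) / x = real (card K1) / x + real (card K2) / x + 1 / x" by (simp add: add_divide_distrib)
  have sub: "K1 \<subseteq> B" "K2 \<subseteq> B" unfolding K1_def K2_def by auto
  have "card (\<Union>K1) + card (\<Union>K2) = card (\<Union>K1 \<union> \<Union>K2)"
  proof (rule card_Un_disjoint[symmetric])
    show "finite (\<Union>K1)" "finite (\<Union>K2)" by (rule finite_subset[OF Union_mono[OF sub(1)] fV], rule finite_subset[OF Union_mono[OF sub(2)] fV])
    show "\<Union>K1 \<inter> \<Union>K2 = {}" unfolding K1_def K2_def by blast
  qed
  also have "\<dots> \<le> card (\<Union>B)" using fV sub by (intro card_mono) auto
  finally have vB: "real (card (\<Union>K1)) + real (card (\<Union>K2)) \<le> real (card (\<Union>B))" by linarith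
  have "\<theta> \<le> wt x K1" "\<theta> \<le> wt x K2" using B(6)[OF sub(1)] B(6)[OF sub(2)] B1 B2 unfolding K1_def K2_def by auto
  moreover have "wt x B = \<theta>" by (rule B(5))
  ultimately have "\<theta> + \<theta> - 1 / x \<le> \<theta>" using cB vB unfolding wt_def by linarith
  moreover have "1 / x < 1" using b(3) by simp
  ultimately show False using b(2) by linarith
qed

text \<open>The red set \<open>R\<close> is a maximum \<open>k\<close>-degenerate set leaving the fewest blue copies of \<open>E2\<close>. Swapping an
  edge \<open>ab\<close> of a blue copy with a red edge at \<open>a\<close> destroys this copy, and a new blue copy would make
  \<open>ab\<close> a bridge of the old one.\<close>

lemma split_regular:
  fixes G :: "'b set set"
  assumes es: "edge_set G" and reg: "\<And>u. u \<in> \<Union>G \<Longrightarrow> card (star G u) = 2 * k + 1" and k: "1 \<le> k"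
    and md1: "mindeg E1 TYPE('b) (k + 1)" and md2: "mindeg E2 TYPE('b) (k + 1)" and ne1: "E1 \<noteq> {}" and ne2: "E2 \<noteq> {}"
    and b2: "balanced x \<theta> \<epsilon> E2" "\<theta> = 2 - 1 / x" "1 < x"
  shows "\<not> arrows G E1 E2"
proof -
  have finG: "finite G" using es unfolding edge_set_def by simp
  define dg where "dg R \<longleftrightarrow> R \<subseteq> G \<and> (\<forall>I\<subseteq>R. I \<noteq> {} \<longrightarrow> (\<exists>u\<in>\<Union>I. card (star I u) \<le> k))" for R
  have bd: "\<forall>R. dg R \<longrightarrow> card R < Suc (card G)" 
    by (intro allI impI le_imp_less_Suc card_mono[OF finG]) (simp add: dg_def)
  have dg0: "dg {}" unfolding dg_def by auto
  obtain R0 where R0: "dg R0" "\<And>R. dg R \<Longrightarrow> card R \<le> card R0"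
    using ex_has_greatest_nat[of dg, OF dg0 bd] by auto
  define best where "best R \<longleftrightarrow> dg R \<and> card R = card R0" for R
  define bl where "bl R = card {B. B \<subseteq> G - R \<and> copy E2 B}" for R
  have "best R0" unfolding best_def using R0 by simp
  then obtain R where R: "best R" "\<And>R'. best R' \<Longrightarrow> bl R \<le> bl R'" using ex_has_least_nat[of best R0 bl] by blast
  \<comment> \<open>A vertex with fewer than k red edges could receive one more: it would still have
    degree at most k in every red part containing the new edge, against the maximality of the red
    set.\<close>
  have bestdeg: "k \<le> card (star R u)" if "best R" "u \<in> \<Union>G" for R u
  proof (rule ccontr)
    assume "\<not> ?thesis"
    hence lt: "card (star R u) < k" by simp
    have RG: "R \<subseteq> G" using that(1) unfolding best_def dg_def by auto
    have finR: "finite R" using RG finG finite_subset by auto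
    have "\<not> star G u \<subseteq> star R u"
    proof
      assume "star G u \<subseteq> star R u"
      hence "card (star G u) \<le> card (star R u)" using finite_star[OF finR] by (intro card_mono) auto
      thus False using lt reg[OF that(2)] by simp
    qed
    then obtain e where e: "e \<in> G" "u \<in> e" "e \<notin> R" unfolding star_def by auto
    have "dg (insert e R)" unfolding dg_def
    proof (intro conjI allI impI)
      show "insert e R \<subseteq> G" using e RG by auto
      fix I assume I: "I \<subseteq> insert e R" "I \<noteq> {}"
      show "\<exists>u\<in>\<Union>I. card (star I u) \<le> k"
      proof (cases "e \<in> I")
        case True
        have "star I u \<subseteq> insert e (star R u)" using I unfolding star_def by auto
        hence "card (star I u) \<le> card (insert e (star R u))" using finite_star[OF finR] by (intro card_mono) auto
        also have "\<dots> \<le> Suc (card (star R u))" using finite_star[OF finR] by (simp add: card_insert_if)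
        finally have "card (star I u) \<le> k" using lt by simp
        thus ?thesis using True e by auto
      next
        case False
        hence "I \<subseteq> R" using I by auto
        thus ?thesis using that(1) I(2) unfolding best_def dg_def by auto
      qed
    qed
    hence "card (insert e R) \<le> card R0" by (rule R0(2))
    thus False using that(1) e finR unfolding best_def by simp
  qed
  have bluedeg: "card (star (G - R) u) + card (star R u) = 2 * k + 1" if "R \<subseteq> G" "u \<in> \<Union>G" for R u
  proof -
    have "star (G - R) u \<union> star R u = star G u" "star (G - R) u \<inter> star R u = {}" using that unfolding star_def by auto
    moreover have "finite (star (G - R) u)" "finite (star R u)" by (intro finite_star finite_subset[OF _ finG] Diff_subset that(1))+
    ultimately show ?thesis using reg[OF that(2)] card_Un_disjoint by metis
  qed
  \<comment> \<open>Minimum degree k + 1 and at least k red edges out of 2k + 1 leave no slack. So a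
    blue copy contains every blue edge at each of its vertices and is a union of blue
    components.\<close>
  have blue: "star B u = star (G - R) u \<and> card (star (G - R) u) = k + 1 \<and> card (star R u) = k"
    if R: "best R" and B: "B \<subseteq> G - R" "copy E2 B" and u: "u \<in> \<Union>B" for R B u
  proof -
    have RG: "R \<subseteq> G" using R unfolding best_def dg_def by auto
    have uG: "u \<in> \<Union>G" using u B by auto
    have "k + 1 \<le> card (star B u)" using md2 B(2) u unfolding mindeg_def by blast
    moreover have sub: "star B u \<subseteq> star (G - R) u" using B(1) by (rule star_mono)
    moreover have fin: "finite (star (G - R) u)" using finG by (simp add: finite_star)
    ultimately have "k + 1 \<le> card (star (G - R) u)" using card_mono by (meson le_trans)
    moreover have "k \<le> card (star R u)" by (rule bestdeg[OF R uG])
    moreover note bluedeg[OF RG uG]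
    ultimately have "card (star (G - R) u) = k + 1" "card (star R u) = k" by linarith+
    moreover have "star B u = star (G - R) u"
      using \<open>k + 1 \<le> card (star B u)\<close> calculation(1) sub fin by (intro card_seteq) auto
    ultimately show ?thesis by simp
  qed
  have Rdg: "dg R" and RG: "R \<subseteq> G" using R(1) unfolding best_def dg_def by auto
  have finR: "finite R" using RG finG finite_subset by auto
  show ?thesis
  proof (rule not_arrowsI[OF RG])
    show "\<not> copy E1 A" if A: "A \<subseteq> R" for A
    proof
      assume cp: "copy E1 A"
      have "A \<noteq> {}" using copy_nonempty[OF cp ne1] .
      then obtain u where u: "u \<in> \<Union>A" "card (star A u) \<le> k" using Rdg A unfolding dg_def by blast
      moreover have "k + 1 \<le> card (star A u)" using md1 cp u(1) unfolding mindeg_def by blast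
      ultimately show False by simp
    qed
    show "\<not> copy E2 B" if B: "B \<subseteq> G - R" for B
    proof
      assume cp: "copy E2 B"
      have bB: "balanced x \<theta> \<epsilon> B" by (rule balanced_copy(1)[OF b2(1) cp])
      have esB: "edge_set B" by (rule balancedD(1)[OF bB])
      obtain g where g: "g \<in> B" using copy_nonempty[OF cp ne2] by auto
      obtain a b where ab: "g = {a, b}" "a \<noteq> b" using g esB unfolding edge_set_def card_2_iff by blast
      have aB: "a \<in> \<Union>B" and bB': "b \<in> \<Union>B" using g ab by auto
      note bla = blue[OF R(1) B cp aB] and blb = blue[OF R(1) B cp bB']
      have "star R a \<noteq> {}" using bla k by auto
      then obtain h where h: "h \<in> R" "a \<in> h" unfolding star_def by auto
      have gR: "g \<notin> R" "g \<in> G" using g B by auto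
      have hg: "h \<noteq> g" using h gR by auto
      have ch: "card h = 2" "card g = 2" using h RG gR es unfolding edge_set_def by auto
      have bh: "b \<notin> h"
      proof
        assume "b \<in> h"
        hence "g \<subseteq> h" using ab h by auto
        hence "g = h" using ch by (metis card_subset_eq card.infinite zero_neq_numeral)
        thus False using hg by simp
      qed
      \<comment> \<open>The swap keeps the size of the red set, and its k-degeneracy because a still
        has at most k red edges.\<close>
      define R' where "R' = insert g (R - {h})"
      have R'G: "R' \<subseteq> G" unfolding R'_def using gR RG by auto
      have finR': "finite R'" unfolding R'_def using finR by simp
      have cR': "card R' = card R" 
      proof -
        have "card R' = Suc (card (R - {h}))" unfolding R'_def using gR finR by (intro card_insert_disjoint) auto
        thus ?thesis using card.remove[OF finR h(1)] by linarith
      qed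
      have starR'a: "card (star R' a) \<le> k"
      proof -
        have "star R' a = insert g (star R a - {h})" unfolding R'_def star_def using ab by auto
        hence "card (star R' a) \<le> Suc (card (star R a - {h}))" using finite_star[OF finR] by (simp add: card_insert_if)
        also have "card (star R a - {h}) = card (star R a) - 1" using h finite_star[OF finR, of a] by (intro card_Diff_singleton) (auto simp: star_def)
        finally show ?thesis using bla k by simp
      qed
      have "dg R'" unfolding dg_def
      proof (intro conjI allI impI)
        show "R' \<subseteq> G" by fact
        fix I assume I: "I \<subseteq> R'" "I \<noteq> {}"
        show "\<exists>u\<in>\<Union>I. card (star I u) \<le> k"
        proof (cases "g \<in> I")
          case True
          have "card (star I a) \<le> card (star R' a)" by (rule card_star_mono[OF I(1) finR'])
          hence "card (star I a) \<le> k" using starR'a by simp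
          moreover have "a \<in> \<Union>I" using True ab by auto
          ultimately show ?thesis by blast
        next
          case False
          hence "I \<subseteq> R" using I unfolding R'_def by auto
          thus ?thesis using Rdg I(2) unfolding dg_def by blast
        qed
      qed
      hence bR': "best R'" unfolding best_def using cR' R(1) unfolding best_def by simp
      have noh: "h \<notin> B'" if B': "B' \<subseteq> G - R'" "copy E2 B'" for B'
      proof
        assume hB': "h \<in> B'"
        have aB': "a \<in> \<Union>B'" using hB' h by auto
        \<comment> \<open>b has lost the blue edge g and gained none, so its blue degree is now at
          most k, too small for a vertex of a blue copy.\<close>
        have bW: "b \<notin> \<Union>B'"
        proof
          assume "b \<in> \<Union>B'"
          hence 1: "card (star (G - R') b) = k + 1" using blue[OF bR' B'] by simp
          have "star (G - R') b \<subseteq> star (G - R) b - {g}" unfolding R'_def star_def using bh by auto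
          hence "card (star (G - R') b) \<le> card (star (G - R) b - {g})" using finG by (intro card_mono) (auto simp: finite_star)
          also have "\<dots> = card (star (G - R) b) - 1"
            using gR ab finG finite_star[of "G - R" b] by (intro card_Diff_singleton) (auto simp: star_def)
          finally show False using 1 blb by simp
        qed
        \<comment> \<open>The other edges of B stay blue, and B' is a union of blue components after
          the swap.\<close>
        have dich: "e \<subseteq> \<Union>B' \<or> e \<inter> \<Union>B' = {}" if e: "e \<in> B" "e \<noteq> g" for e
        proof (cases "e \<inter> \<Union>B' = {}")
          case False
          then obtain w where w: "w \<in> e" "w \<in> \<Union>B'" by auto
          have "e \<in> star (G - R') w" unfolding star_def R'_def using e B w by auto
          hence "e \<in> star B' w" using blue[OF bR' B' w(2)] by simp
          thus ?thesis unfolding star_def by auto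
        qed simp
        obtain e1 where e1: "e1 \<in> B" "e1 \<noteq> g" "a \<in> e1" using balanced_second_edge[OF bB b2(3) g, of a] ab by auto
        obtain e2 where e2: "e2 \<in> B" "e2 \<noteq> g" "b \<in> e2" using balanced_second_edge[OF bB b2(3) g, of b] ab by auto
        have "e1 \<subseteq> \<Union>B'" using dich[OF e1(1,2)] e1(3) aB' by auto
        moreover have "e2 \<inter> \<Union>B' = {}" using dich[OF e2(1,2)] e2(3) bW by auto
        ultimately show False
          using balanced_bridgeless[OF bB b2(2,3) g, of "\<Union>B'" e1 e2] dich e1 e2 by blast
      qed
      have "{B'. B' \<subseteq> G - R' \<and> copy E2 B'} \<subset> {B'. B' \<subseteq> G - R \<and> copy E2 B'}"
      proof
        show "{B'. B' \<subseteq> G - R' \<and> copy E2 B'} \<subseteq> {B'. B' \<subseteq> G - R \<and> copy E2 B'}"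
        proof
          fix B' assume "B' \<in> {B'. B' \<subseteq> G - R' \<and> copy E2 B'}"
          hence B': "B' \<subseteq> G - R'" "copy E2 B'" by auto
          have "h \<notin> B'" by (rule noh[OF B'])
          hence "B' \<subseteq> G - R" using B'(1) unfolding R'_def by auto
          thus "B' \<in> {B'. B' \<subseteq> G - R \<and> copy E2 B'}" using B' by simp
        qed
        have "B \<notin> {B'. B' \<subseteq> G - R' \<and> copy E2 B'}" using g unfolding R'_def by auto
        moreover have "B \<in> {B'. B' \<subseteq> G - R \<and> copy E2 B'}" using B cp by simp
        ultimately show "{B'. B' \<subseteq> G - R' \<and> copy E2 B'} \<noteq> {B'. B' \<subseteq> G - R \<and> copy E2 B'}" by metis
      qed
      hence "bl R' < bl R" unfolding bl_def using finG
        by (intro psubset_card_mono finite_subset[of "{B'. B' \<subseteq> G - R \<and> copy E2 B'}" "Pow G"]) auto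
      thus False using R(2)[OF bR'] by simp
    qed
  qed
qed

section \<open>Triangles\<close>

lemma triangle_copy:
  assumes "triangle E" "copy E A"
  shows "triangle A"
proof -
  obtain f where f: "inj_on f (\<Union>E)" "A = (\<lambda>e. f ` e) ` E" using assms(2) unfolding copy_def by auto
  obtain a b c where abc: "a \<noteq> b" "b \<noteq> c" "a \<noteq> c" "E = {{a, b}, {b, c}, {a, c}}" using assms(1) unfolding triangle_def by auto
  have "A = {{f a, f b}, {f b, f c}, {f a, f c}}" unfolding f(2) abc(4) by simp
  moreover have "f a \<noteq> f b" "f b \<noteq> f c" "f a \<noteq> f c" using f(1) abc unfolding inj_on_def by auto
  ultimately show ?thesis unfolding triangle_def by blast
qed

lemma triangle_not_bipartite:
  assumes "triangle E" shows "\<not> bipartite E"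
proof
  assume "bipartite E"
  then obtain s where s: "\<forall>e\<in>E. \<not> inside s e" unfolding bipartite_def by auto
  obtain a b c where E: "E = {{a, b}, {b, c}, {a, c}}" using assms unfolding triangle_def by auto
  have "s a \<noteq> s b" "s b \<noteq> s c" "s a \<noteq> s c" using s unfolding E inside_def by auto
  thus False by auto
qed

text \<open>Adjacency in the 5-cycle on 0, ..., 4, which will be the red half of the classical
  colouring of the complete graph on five vertices without monochromatic triangles.\<close>

definition adj5 :: "nat \<Rightarrow> nat \<Rightarrow> bool" where
  "adj5 i j \<longleftrightarrow> (i + 1) mod 5 = j \<or> (j + 1) mod 5 = i"

lemma less_5_cases: "(i::nat) < 5 \<Longrightarrow> i = 0 \<or> i = 1 \<or> i = 2 \<or> i = 3 \<or> i = 4"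
  by arith

lemma adj5_no_triangle:
  assumes "i < 5" "j < 5" "k < 5" "i \<noteq> j" "j \<noteq> k" "i \<noteq> k"
  shows "\<not> (adj5 i j \<and> adj5 j k \<and> adj5 i k)" "\<not> (\<not> adj5 i j \<and> \<not> adj5 j k \<and> \<not> adj5 i k)"
proof -
  note cs = less_5_cases[OF assms(1)] less_5_cases[OF assms(2)] less_5_cases[OF assms(3)]
  show "\<not> (adj5 i j \<and> adj5 j k \<and> adj5 i k)" using cs assms(4-6) unfolding adj5_def by (elim disjE) simp_all
  show "\<not> (\<not> adj5 i j \<and> \<not> adj5 j k \<and> \<not> adj5 i k)" using cs assms(4-6) unfolding adj5_def by (elim disjE) simp_all
qed

text \<open>The graph is 5-colourable, and the pentagon and its complement are triangle-free.\<close>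

lemma split_triangles:
  fixes G :: "'b set set"
  assumes es: "edge_set G" and deg: "\<And>J. J \<subseteq> G \<Longrightarrow> J \<noteq> {} \<Longrightarrow> \<exists>u\<in>\<Union>J. card (star J u) \<le> 4"
    and t: "triangle E1" "triangle E2"
  shows "\<not> arrows G E1 E2"
proof -
  have fin: "finite G" using es unfolding edge_set_def by simp
  have "\<exists>f :: 'b \<Rightarrow> nat. (\<forall>v. f v < 5) \<and> (\<forall>e\<in>G. \<forall>v\<in>e. \<forall>w\<in>e. v \<noteq> w \<longrightarrow> f v \<noteq> f w)"
  proof (rule degenerate_induct[OF fin deg, where P = "\<lambda>J. \<exists>f :: 'b \<Rightarrow> nat. (\<forall>v. f v < 5) \<and> (\<forall>e\<in>J. \<forall>v\<in>e. \<forall>w\<in>e. v \<noteq> w \<longrightarrow> f v \<noteq> f w)"])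
    show "\<exists>f :: 'b \<Rightarrow> nat. (\<forall>v. f v < 5) \<and> (\<forall>e\<in>{}. \<forall>v\<in>e. \<forall>w\<in>e. v \<noteq> w \<longrightarrow> f v \<noteq> f w)"
      by (intro exI[of _ "\<lambda>_. 0"]) auto
    fix J u assume J: "J \<subseteq> G" and u: "u \<in> \<Union>J" and d: "card (star J u) \<le> 4"
      and "\<exists>f :: 'b \<Rightarrow> nat. (\<forall>v. f v < 5) \<and> (\<forall>e\<in>J - star J u. \<forall>v\<in>e. \<forall>w\<in>e. v \<noteq> w \<longrightarrow> f v \<noteq> f w)"
    then obtain f :: "'b \<Rightarrow> nat" where f: "\<forall>v. f v < 5" "\<forall>e\<in>J - star J u. \<forall>v\<in>e. \<forall>w\<in>e. v \<noteq> w \<longrightarrow> f v \<noteq> f w" by auto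
    have finJ: "finite J" by (rule finite_subset[OF J fin])
    have fS: "finite (star J u)" using finJ by (rule finite_star)
    define N where "N = (\<Union>e\<in>star J u. e - {u})"
    have "card N \<le> (\<Sum>e\<in>star J u. card (e - {u}))" unfolding N_def by (rule card_UN_le[OF fS])
    also have "\<dots> \<le> (\<Sum>e\<in>star J u. 1)"
    proof (rule sum_mono)
      fix e assume "e \<in> star J u"
      hence "card e = 2" "u \<in> e" using J es unfolding star_def edge_set_def by auto
      thus "card (e - {u}) \<le> 1" by simp
    qed
    also have "\<dots> \<le> 4" using d by simp
    finally have cN: "card N \<le> 4" .
    have "N \<subseteq> \<Union>J" unfolding N_def star_def by auto
    hence fN: "finite N" by (rule finite_subset[OF _ edge_set_Union_finite[OF edge_set_subset[OF es J]]])
    \<comment> \<open>Greedy colouring: u has at most four neighbours, so one of five colours is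
      free.\<close>
    have "\<not> {..<5} \<subseteq> f ` N"
    proof
      assume "{..<5} \<subseteq> f ` N"
      hence "card {..<5::nat} \<le> card (f ` N)" using fN by (intro card_mono) auto
      also have "\<dots> \<le> card N" using fN by (rule card_image_le)
      finally show False using cN by simp
    qed
    then obtain c where c: "c < 5" "c \<notin> f ` N" by auto
    have "(f(u := c)) v \<noteq> (f(u := c)) w" if e: "e \<in> J" "v \<in> e" "w \<in> e" "v \<noteq> w" for e v w
    proof (cases "u \<in> e")
      case True
      hence eS: "e \<in> star J u" using e unfolding star_def by auto
      have ce: "card e = 2" using e J es unfolding edge_set_def by auto
      have "{v, w} \<subseteq> e" "card {v, w} = 2" using e by auto
      hence "{v, w} = e" using ce by (metis card_subset_eq card.infinite zero_neq_numeral)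
      hence "u = v \<or> u = w" using True by auto
      moreover have "z \<in> N" if "z \<in> e" "z \<noteq> u" for z unfolding N_def using eS that by auto
      ultimately show ?thesis using c(2) e by auto
    next
      case False
      hence "e \<in> J - star J u" using e unfolding star_def by auto
      hence "f v \<noteq> f w" using f(2) e by blast
      thus ?thesis using False e by auto
    qed
    moreover have "\<forall>v. (f(u := c)) v < 5" using f(1) c by simp
    ultimately show "\<exists>f :: 'b \<Rightarrow> nat. (\<forall>v. f v < 5) \<and> (\<forall>e\<in>J. \<forall>v\<in>e. \<forall>w\<in>e. v \<noteq> w \<longrightarrow> f v \<noteq> f w)" by blast
  qed
  then obtain f :: "'b \<Rightarrow> nat" where f: "\<And>v. f v < 5" "\<And>e v w. e \<in> G \<Longrightarrow> v \<in> e \<Longrightarrow> w \<in> e \<Longrightarrow> v \<noteq> w \<Longrightarrow> f v \<noteq> f w" by blast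
  define R where "R = {e\<in>G. \<exists>v w. e = {v, w} \<and> adj5 (f v) (f w)}"
  have adj_sym: "adj5 i j = adj5 j i" for i j unfolding adj5_def by auto
  have inR: "{v, w} \<in> R \<longleftrightarrow> adj5 (f v) (f w)" if "{v, w} \<in> G" for v w
  proof
    assume "{v, w} \<in> R"
    then obtain v' w' where "{v, w} = {v', w'}" "adj5 (f v') (f w')" unfolding R_def by blast
    hence "v = v' \<and> w = w' \<or> v = w' \<and> w = v'" by (simp add: doubleton_eq_iff)
    thus "adj5 (f v) (f w)" using \<open>adj5 (f v') (f w')\<close> adj_sym[of "f v'" "f w'"] by (elim disjE) simp_all
  qed (use that in \<open>auto simp: R_def\<close>)
  show ?thesis
  proof (rule not_arrowsI)
    show RG: "R \<subseteq> G" unfolding R_def by auto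
    show "\<not> copy E1 A" if A: "A \<subseteq> R" for A
    proof
      assume cp: "copy E1 A"
      obtain a b c where abc: "a \<noteq> b" "b \<noteq> c" "a \<noteq> c" "A = {{a, b}, {b, c}, {a, c}}"
        using triangle_copy[OF t(1) cp] unfolding triangle_def by auto
      have g: "{a, b} \<in> G" "{b, c} \<in> G" "{a, c} \<in> G" using A RG abc(4) by auto
      have "f a \<noteq> f b" "f b \<noteq> f c" "f a \<noteq> f c" using f(2)[OF g(1)] f(2)[OF g(2)] f(2)[OF g(3)] abc by auto
      moreover have "adj5 (f a) (f b)" "adj5 (f b) (f c)" "adj5 (f a) (f c)" using A abc(4) inR g by auto
      ultimately show False using adj5_no_triangle(1)[of "f a" "f b" "f c"] f(1) by blast
    qed
    show "\<not> copy E2 A" if A: "A \<subseteq> G - R" for A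
    proof
      assume cp: "copy E2 A"
      obtain a b c where abc: "a \<noteq> b" "b \<noteq> c" "a \<noteq> c" "A = {{a, b}, {b, c}, {a, c}}"
        using triangle_copy[OF t(2) cp] unfolding triangle_def by auto
      have g: "{a, b} \<in> G" "{b, c} \<in> G" "{a, c} \<in> G" using A abc(4) by auto
      have "f a \<noteq> f b" "f b \<noteq> f c" "f a \<noteq> f c" using f(2)[OF g(1)] f(2)[OF g(2)] f(2)[OF g(3)] abc by auto
      moreover have "\<not> adj5 (f a) (f b)" "\<not> adj5 (f b) (f c)" "\<not> adj5 (f a) (f c)" using A abc(4) inR g by auto
      ultimately show False using adj5_no_triangle(2)[of "f a" "f b" "f c"] f(1) by blast
    qed
  qed
qed

section \<open>Colouring in the case of equal densities\<close>

lemma balanced_mindeg: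
  assumes b: "balanced x \<theta> \<epsilon> E" "\<theta> = 2 - 1 / x" "1 < x" "0 < \<epsilon>" and nt: "\<not> triangle E" and k: "real k \<le> x"
  shows "mindeg E TYPE('b) (k + 1)"
  unfolding mindeg_def
proof (intro allI impI ballI)
  fix A :: "'b set set" and u assume cp: "copy E A" and u: "u \<in> \<Union>A"
  have bA: "balanced x \<theta> \<epsilon> A" and cA: "card A = card E" using balanced_copy[OF b(1) cp] by auto
  obtain f where f: "inj_on f (\<Union>E)" "A = (\<lambda>e. f ` e) ` E" using cp unfolding copy_def by auto
  have "card (\<Union>A) = card (\<Union>E)" unfolding f(2) by (rule copy_sub(2)[OF f(1)]) simp
  moreover have "\<not> (card (\<Union>E) = 3 \<and> card E = 3)" using triangleI[OF balancedD(1)[OF b(1)]] nt by auto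
  ultimately have "x < real (card (star A u))" using balanced_degree[OF bA b(2-4) u] cA by auto
  thus "k + 1 \<le> card (star A u)" using k by linarith
qed

lemma triangle_card:
  assumes "triangle E" shows "card (\<Union>E) = 3" "card E = 3"
proof -
  obtain a b c where abc: "a \<noteq> b" "b \<noteq> c" "a \<noteq> c" "E = {{a, b}, {b, c}, {a, c}}" using assms unfolding triangle_def by auto
  have "\<Union>E = {a, b, c}" unfolding abc(4) by auto
  thus "card (\<Union>E) = 3" using abc by simp
  show "card E = 3" unfolding abc(4) using abc(1-3) by (auto simp: doubleton_eq_iff)
qed

text \<open>Average degrees in G and its subgraphs are at most 2x, while copies have minimum degree
  above x unless they are triangles. The position of 2x relative to 2k + 1, with k the integer part
  of x, decides which colouring applies. Above it the degree 2k + 1 is one too many for splitting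
  stars evenly, so a vertex partition or an orientation is used.\<close>

theorem equal_density_not_arrows:
  fixes G :: "'c set set"
  assumes b1: "balanced x \<theta> \<epsilon> E1" and b2: "balanced x \<theta> \<epsilon> E2" and par: "\<theta> = 2 - 1 / x" "1 < x" "0 < \<epsilon>"
    and es: "edge_set G" and sparse: "\<And>J. J \<subseteq> G \<Longrightarrow> real (card J) \<le> x * real (card (\<Union>J))"
  shows "\<not> arrows G E1 E2"
proof -
  have fin: "finite G" using es unfolding edge_set_def by simp
  have ne: "E1 \<noteq> {}" "E2 \<noteq> {}" using balancedD(4)[OF b1] balancedD(4)[OF b2] by auto
  have lowdeg: "\<exists>u\<in>\<Union>J. card (star J u) \<le> D" if J: "J \<subseteq> G" "J \<noteq> {}" "2 * x < real D + 1" for J D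
  proof -
    obtain u where u: "u \<in> \<Union>J" "real (card (star J u)) \<le> 2 * x"
      using low_degree_vertex[OF edge_set_subset[OF es J(1)] J(2) sparse[OF J(1)]] by auto
    have "card (star J u) \<le> D" using u(2) J(3) by linarith
    thus ?thesis using u(1) by blast
  qed
  define k where "k = nat \<lfloor>x\<rfloor>"
  have k: "real k \<le> x" "x < real k + 1" unfolding k_def using par(2) by linarith+
  have k1: "1 \<le> k" unfolding k_def using par(2) by linarith
  show ?thesis
  proof (cases "triangle E1 \<or> triangle E2")
    case True
    hence x: "x = 2"
    proof
      assume "triangle E1"
      thus ?thesis using balanced_size[OF b1 par(1,2)] triangle_card[of E1] by simp
    next
      assume "triangle E2"
      thus ?thesis using balanced_size[OF b2 par(1,2)] triangle_card[of E2] by simp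
    qed
    have d4: "\<exists>u\<in>\<Union>J. card (star J u) \<le> 4" if "J \<subseteq> G" "J \<noteq> {}" for J by (rule lowdeg[OF that]) (use x in simp)
    \<comment> \<open>The weaker bound 5 = 2 * 2 + 1 has the form required by a vertex partition
      with a = 2.\<close>
    have d5: "\<exists>u\<in>\<Union>J. card (star J u) \<le> 2 * 2 + 1" if "J \<subseteq> G" "J \<noteq> {}" for J by (rule lowdeg[OF that]) (use x in simp)
    consider "triangle E1" "triangle E2" | "\<not> triangle E1" "triangle E2" | "triangle E1" "\<not> triangle E2" using True by auto
    thus ?thesis
    proof cases
      case 1
      thus ?thesis using split_triangles[OF es d4] by simp
    next
      case 2
      have "mindeg E1 TYPE('c) (2 + 1)" by (rule balanced_mindeg[OF b1 par 2(1)]) (use x in simp)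
      thus ?thesis using split_nonbipartite[OF es d5 _ triangle_not_bipartite[OF 2(2)] ne(1)] by simp
    next
      case 3
      have "mindeg E2 TYPE('c) (2 + 1)" by (rule balanced_mindeg[OF b2 par 3(2)]) (use x in simp)
      hence "\<not> arrows G E2 E1" using split_nonbipartite[OF es d5 _ triangle_not_bipartite[OF 3(1)] ne(2)] by simp
      thus ?thesis using arrows_sym by blast
    qed
  next
    case False
    have md: "mindeg E1 TYPE('c) (k + 1)" "mindeg E2 TYPE('c) (k + 1)"
      using balanced_mindeg[OF b1 par _ k(1)] balanced_mindeg[OF b2 par _ k(1)] False by auto
    consider "x < real k + 1 / 2" | "x = real k + 1 / 2" | "real k + 1 / 2 < x" by linarith
    thus ?thesis
    proof cases
      case 1
      show ?thesis
      proof (rule degenerate_induct[OF fin, of "k + k"])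
        show "\<exists>u\<in>\<Union>J. card (star J u) \<le> k + k" if "J \<subseteq> G" "J \<noteq> {}" for J by (rule lowdeg[OF that]) (use 1 in simp)
        show "\<not> arrows {} E1 E2" by (rule empty_not_arrows[OF ne])
        fix J u assume J: "J \<subseteq> G" "card (star J u) \<le> k + k" "\<not> arrows (J - star J u) E1 E2"
        show "\<not> arrows J E1 E2" by (rule extend_split[OF finite_subset[OF J(1) fin] J(2) md J(3)])
      qed
    next
      \<comment> \<open>Now 2x = 2k + 1, so a subgraph without vertices of degree at most 2k has
        minimum degree at least 2k + 1 and average degree at most 2k + 1: it is regular.\<close>
      case 2
      have "J \<subseteq> G \<Longrightarrow> \<not> arrows J E1 E2" for J
      proof (induction "card J" arbitrary: J rule: less_induct)
        case less
        have finJ: "finite J" by (rule finite_subset[OF less.prems fin])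
        have esJ: "edge_set J" by (rule edge_set_subset[OF es less.prems])
        show ?case
        proof (cases "\<exists>u\<in>\<Union>J. card (star J u) \<le> k + k")
          case True
          then obtain u where u: "u \<in> \<Union>J" "card (star J u) \<le> k + k" by auto
          have "J - star J u \<subset> J" using u(1) unfolding star_def by auto
          hence "card (J - star J u) < card J" by (rule psubset_card_mono[OF finJ])
          hence "\<not> arrows (J - star J u) E1 E2" using less.hyps less.prems by auto
          thus ?thesis by (rule extend_split[OF finJ u(2) md])
        next
          case False
          have ge: "2 * k + 1 \<le> card (star J u)" if "u \<in> \<Union>J" for u using False that by (simp add: not_le) force
          have finV: "finite (\<Union>J)" using esJ by (rule edge_set_Union_finite)
          have "real (\<Sum>u\<in>\<Union>J. card (star J u)) = real (2 * card J)" using handshake[OF esJ] by simp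
          also have "\<dots> \<le> 2 * (x * real (card (\<Union>J)))" using sparse[OF less.prems] by simp
          also have "\<dots> = real ((2 * k + 1) * card (\<Union>J))" unfolding 2 by (simp add: algebra_simps)
          finally have "(\<Sum>u\<in>\<Union>J. card (star J u)) \<le> (2 * k + 1) * card (\<Union>J)" by (simp only: of_nat_le_iff)
          hence le: "(\<Sum>u\<in>\<Union>J. card (star J u)) \<le> (\<Sum>u\<in>\<Union>J. 2 * k + 1)" by (simp add: mult.commute)
          have "card (star J u) = 2 * k + 1" if u: "u \<in> \<Union>J" for u
          proof (rule ccontr)
            assume "card (star J u) \<noteq> 2 * k + 1"
            hence "2 * k + 1 < card (star J u)" using ge[OF u] by simp
            hence "(\<Sum>u\<in>\<Union>J. 2 * k + 1) < (\<Sum>u\<in>\<Union>J. card (star J u))"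
              using u ge by (intro sum_strict_mono_ex1[OF finV]) auto
            thus False using le by simp
          qed
          thus ?thesis by (intro split_regular[OF esJ _ k1 md ne b2 par(1,2)])
        qed
      qed
      thus ?thesis by simp
    next
      case 3
      have d: "\<exists>u\<in>\<Union>J. card (star J u) \<le> 2 * k + 1" if "J \<subseteq> G" "J \<noteq> {}" for J by (rule lowdeg[OF that]) (use k in simp)
      consider "\<not> bipartite E2" | "\<not> bipartite E1" | "bipartite E1" "bipartite E2" by auto
      thus ?thesis
      proof cases
        case 1
        show ?thesis by (rule split_nonbipartite[OF es d md(1) 1 ne(1)])
      next
        case 2
        have "\<not> arrows G E2 E1" by (rule split_nonbipartite[OF es d md(2) 2 ne(2)])
        thus ?thesis using arrows_sym by blast
      next
        case bp: 3
        \<comment> \<open>Capacities with sum k + 1 > x suffice to orient all edges, while c1, c2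
          \<le> k < x - 1/2 makes both balanced graphs too dense for their colour.\<close>
        define c1 where "c1 = (k + 2) div 2"
        define c2 where "c2 = (k + 1) div 2"
        have cs: "c1 + c2 = k + 1" unfolding c1_def c2_def by linarith
        have c12: "real c1 + 1 / 2 < x" "real c2 + 1 / 2 < x"
        proof -
          have "c1 \<le> k" "c2 \<le> k" unfolding c1_def c2_def using k1 by linarith+
          thus "real c1 + 1 / 2 < x" "real c2 + 1 / 2 < x" using 3 by linarith+
        qed
        show ?thesis
        proof (rule split_oriented[OF es, of c1 c2])
          show "card J \<le> (c1 + c2) * card (\<Union>J)" if "J \<subseteq> G" for J
          proof -
            have "real (card J) \<le> x * real (card (\<Union>J))" by (rule sparse[OF that])
            also have "\<dots> \<le> real (k + 1) * real (card (\<Union>J))" using k by (intro mult_right_mono) auto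
            finally show ?thesis unfolding cs by (metis of_nat_le_iff of_nat_mult)
          qed
          show "c1 * card (\<Union>A) < card A" if cp: "copy E1 A" for A :: "'c set set"
          proof -
            obtain f where f: "inj_on f (\<Union>E1)" "A = (\<lambda>e. f ` e) ` E1" using cp unfolding copy_def by auto
            have "c1 * card (\<Union>E1) < card E1" by (rule balanced_bipartite_dense[OF b1 par(1,2) bp(1) c12(1)])
            thus ?thesis unfolding f(2) using copy_sub(1,2)[OF f(1), of E1] by simp
          qed
          show "c2 * card (\<Union>A) < card A" if cp: "copy E2 A" for A :: "'c set set"
          proof -
            obtain f where f: "inj_on f (\<Union>E2)" "A = (\<lambda>e. f ` e) ` E2" using cp unfolding copy_def by auto
            have "c2 * card (\<Union>E2) < card E2" by (rule balanced_bipartite_dense[OF b2 par(1,2) bp(2) c12(2)])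
            thus ?thesis unfolding f(2) using copy_sub(1,2)[OF f(1), of E2] by simp
          qed
        qed
      qed
    qed
  qed
qed

section \<open>Densities of graphs\<close>

lemma simple_graph_edge_set: "simple_graph H \<Longrightarrow> edge_set (edges H)"
  unfolding simple_graph_def edge_set_def
  using finite_subset[of "edges H" "Pow (verts H)"] by blast

lemma simple_graph_Union: "simple_graph H \<Longrightarrow> \<Union>(edges H) \<subseteq> verts H"
  unfolding simple_graph_def by auto

lemma simple_graph_of_edges: "edge_set J \<Longrightarrow> simple_graph (Graph (\<Union>J) J)"
  unfolding simple_graph_def using edge_set_Union_finite unfolding edge_set_def by auto

lemma subgraph_of_edges:
  assumes "simple_graph H" "J \<subseteq> edges H"
  shows "subgraph (Graph (\<Union>J) J) H"
  unfolding subgraph_def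
  using assms simple_graph_of_edges[OF edge_set_subset[OF simple_graph_edge_set[OF assms(1)] assms(2)]]
    simple_graph_Union[OF assms(1)] by auto

lemma subgraph_refl: "simple_graph H \<Longrightarrow> subgraph H H"
  unfolding subgraph_def by simp

lemma subgraph_trans: "subgraph K J \<Longrightarrow> subgraph J H \<Longrightarrow> subgraph K H"
  unfolding subgraph_def by auto

lemma finite_subgraphs:
  assumes "simple_graph H" shows "finite {J. subgraph J H}"
proof -
  have "{J. subgraph J H} \<subseteq> (\<lambda>(V, E). Graph V E) ` (Pow (verts H) \<times> Pow (edges H))"
  proof
    fix J assume "J \<in> {J. subgraph J H}"
    hence "verts J \<subseteq> verts H" "edges J \<subseteq> edges H" unfolding subgraph_def by auto
    thus "J \<in> (\<lambda>(V, E). Graph V E) ` (Pow (verts H) \<times> Pow (edges H))"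
      by (intro image_eqI[of _ _ "(verts J, edges J)"]) auto
  qed
  moreover have "finite (verts H)" "finite (edges H)"
    using assms simple_graph_edge_set[OF assms] unfolding simple_graph_def edge_set_def by auto
  hence "finite ((\<lambda>(V, E). Graph V E) ` (Pow (verts H) \<times> Pow (edges H)))" by simp
  ultimately show ?thesis by (rule finite_subset)
qed

lemma finite_subgraph_image:
  assumes "simple_graph H" shows "finite {f J | J. subgraph J H \<and> P J}"
proof -
  have "{f J | J. subgraph J H \<and> P J} \<subseteq> f ` {J. subgraph J H}" by auto
  thus ?thesis by (rule finite_subset[OF _ finite_imageI[OF finite_subgraphs[OF assms]]])
qed

lemma edge_num_verts:
  assumes "simple_graph H" "edges H \<noteq> {}"
  shows "2 \<le> num_verts H"
proof -
  obtain e where e: "e \<in> edges H" using assms by auto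
  hence "card e = 2" "e \<subseteq> verts H" using assms unfolding simple_graph_def by auto
  thus ?thesis unfolding num_verts_def using assms card_mono[of "verts H" e] unfolding simple_graph_def by auto
qed

lemma two_verts_one_edge:
  assumes "simple_graph H" "num_verts H = 2"
  shows "num_edges H \<le> 1"
proof -
  have fin: "finite (verts H)" using assms unfolding simple_graph_def by simp
  have "edges H \<subseteq> {e. e \<subseteq> verts H \<and> card e = 2}" using assms unfolding simple_graph_def by auto
  hence "card (edges H) \<le> card {e. e \<subseteq> verts H \<and> card e = 2}" using fin by (intro card_mono) auto
  also have "\<dots> = 1" using n_subsets[OF fin, of 2] assms(2) unfolding num_verts_def by simp
  finally show ?thesis unfolding num_edges_def .
qed

lemma m2_ge:
  assumes "simple_graph H" "subgraph J H" "3 \<le> num_verts J" "edges J \<noteq> {}"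
  shows "(real (num_edges J) - 1) / (real (num_verts J) - 2) \<le> m2 H"
proof -
  have "edges H \<noteq> {}" "num_verts H \<noteq> 2"
  proof -
    show "edges H \<noteq> {}" using assms unfolding subgraph_def by auto
    have "num_verts J \<le> num_verts H" using assms unfolding subgraph_def num_verts_def simple_graph_def by (intro card_mono) auto
    thus "num_verts H \<noteq> 2" using assms by simp
  qed
  moreover have "(real (num_edges J) - 1) / (real (num_verts J) - 2)
      \<in> {(real (num_edges J) - 1) / (real (num_verts J) - 2) | J. subgraph J H \<and> num_verts J \<ge> 3}" using assms by blast
  ultimately show ?thesis unfolding m2_def using Max_ge[OF finite_subgraph_image[OF assms(1)]] by simp
qed

lemma m2_attained:
  assumes "simple_graph H" "1 < m2 H"
  shows "edges H \<noteq> {}" "3 \<le> num_verts H"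
    "\<exists>J. subgraph J H \<and> 3 \<le> num_verts J \<and> m2 H = (real (num_edges J) - 1) / (real (num_verts J) - 2)"
proof -
  show ne: "edges H \<noteq> {}" using assms(2) unfolding m2_def by (auto split: if_splits)
  have n2: "num_verts H \<noteq> 2" using assms(2) unfolding m2_def by (auto split: if_splits)
  show n3: "3 \<le> num_verts H" using edge_num_verts[OF assms(1) ne] n2 by simp
  let ?S = "{(real (num_edges J) - 1) / (real (num_verts J) - 2) | J. subgraph J H \<and> num_verts J \<ge> 3}"
  have "m2 H = Max ?S" using ne n2 unfolding m2_def by simp
  moreover have "?S \<noteq> {}" using subgraph_refl[OF assms(1)] n3 by auto
  hence "Max ?S \<in> ?S" using finite_subgraph_image[OF assms(1)] by (intro Max_in)
  ultimately have "m2 H \<in> ?S" by simp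
  thus "\<exists>J. subgraph J H \<and> 3 \<le> num_verts J \<and> m2 H = (real (num_edges J) - 1) / (real (num_verts J) - 2)" by auto
qed

lemma m2_mono:
  assumes "simple_graph H" "subgraph J H" "1 < m2 J"
  shows "m2 J \<le> m2 H"
proof -
  have sJ: "simple_graph J" using assms(2) unfolding subgraph_def by simp
  obtain K where K: "subgraph K J" "3 \<le> num_verts K" "m2 J = (real (num_edges K) - 1) / (real (num_verts K) - 2)"
    using m2_attained(3)[OF sJ assms(3)] by auto
  have "edges K \<noteq> {}"
  proof
    assume "edges K = {}"
    hence "m2 J = - 1 / (real (num_verts K) - 2)" using K(3) unfolding num_edges_def by simp
    also have "\<dots> \<le> 0" using K(2) by simp
    finally show False using assms(3) by simp
  qed
  thus ?thesis using m2_ge[OF assms(1) subgraph_trans[OF K(1) assms(2)] K(2)] K(3) by simp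
qed

lemma mixed_ge:
  assumes "simple_graph H" "subgraph J H" "2 \<le> num_verts J"
  shows "real (num_edges J) / (real (num_verts J) - 2 + 1 / m2 H2) \<le> mixed_m2 H H2"
proof -
  have "num_verts J \<le> num_verts H" using assms unfolding subgraph_def num_verts_def simple_graph_def by (intro card_mono) auto
  hence "\<not> num_verts H < 2" using assms(3) by simp
  moreover have "real (num_edges J) / (real (num_verts J) - 2 + 1 / m2 H2)
      \<in> {real (num_edges J) / (real (num_verts J) - 2 + 1 / m2 H2) | J. subgraph J H \<and> num_verts J \<ge> 2}" using assms by blast
  ultimately show ?thesis unfolding mixed_m2_def using Max_ge[OF finite_subgraph_image[OF assms(1)]] by simp
qed

lemma mixed_attained:
  assumes "simple_graph H" "2 \<le> num_verts H"
  shows "\<exists>J. subgraph J H \<and> 2 \<le> num_verts J \<and> mixed_m2 H H2 = real (num_edges J) / (real (num_verts J) - 2 + 1 / m2 H2)"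
proof -
  let ?S = "{real (num_edges J) / (real (num_verts J) - 2 + 1 / m2 H2) | J. subgraph J H \<and> num_verts J \<ge> 2}"
  have "mixed_m2 H H2 = Max ?S" using assms(2) unfolding mixed_m2_def by simp
  moreover have "?S \<noteq> {}" using subgraph_refl[OF assms(1)] assms(2) by auto
  hence "Max ?S \<in> ?S" using finite_subgraph_image[OF assms(1)] by (intro Max_in)
  ultimately have "mixed_m2 H H2 \<in> ?S" by simp
  thus ?thesis by auto
qed

section \<open>Strict balancedness in terms of weights\<close>

lemma balancedI:
  assumes "edge_set E" "2 \<le> card E" "wt \<mu> E = \<theta>"
    and "\<And>J. J \<subseteq> E \<Longrightarrow> J \<noteq> {} \<Longrightarrow> \<theta> \<le> wt \<mu> J"
    and "\<And>J. J \<subset> E \<Longrightarrow> 2 \<le> card J \<Longrightarrow> \<theta> < wt \<mu> J"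
  shows "\<exists>\<epsilon>>0. \<epsilon> \<le> 1 \<and> balanced \<mu> \<theta> \<epsilon> E"
proof -
  \<comment> \<open>There are finitely many parts J, so the strict inequalities improve to a common
    gap, which is then capped at 1.\<close>
  have "finite ((\<lambda>J. \<theta> - wt \<mu> J) ` Pow E)" using assms(1) unfolding edge_set_def by simp
  then obtain \<eta> where eta: "\<eta> > 0" "\<forall>v\<in>(\<lambda>J. \<theta> - wt \<mu> J) ` Pow E. v < 0 \<longrightarrow> v \<le> - \<eta>"
    using finite_negative_gap by blast
  have "\<theta> + min \<eta> 1 \<le> wt \<mu> J" if J: "J \<subset> E" "2 \<le> card J" for J
  proof -
    have "\<theta> - wt \<mu> J < 0" using assms(5)[OF J] by simp
    moreover have "\<theta> - wt \<mu> J \<in> (\<lambda>J. \<theta> - wt \<mu> J) ` Pow E" using J by auto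
    ultimately have "\<theta> - wt \<mu> J \<le> - \<eta>" using eta(2) by blast
    thus ?thesis by simp
  qed
  hence "balanced \<mu> \<theta> (min \<eta> 1) E" unfolding balanced_def using assms(1-4) by blast
  thus ?thesis using eta(1) by (intro exI[of _ "min \<eta> 1"]) auto
qed

lemma balanced_mono:
  assumes "balanced \<mu> \<theta> \<epsilon> E" "\<epsilon>' \<le> \<epsilon>" shows "balanced \<mu> \<theta> \<epsilon>' E"
  unfolding balanced_def
proof (intro conjI allI impI)
  note B = balancedD[OF assms(1)]
  show "edge_set E" "2 \<le> card E" "wt \<mu> E = \<theta>" by (rule B)+
  show "\<theta> \<le> wt \<mu> J" if "J \<subseteq> E" "J \<noteq> {}" for J by (rule B(6)[OF that])
  show "\<theta> + \<epsilon>' \<le> wt \<mu> J" if "J \<subset> E \<and> 2 \<le> card J" for J using B(7)[of J] that assms(2) by linarith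
qed

lemma common_balanced:
  assumes "\<exists>\<epsilon>>0. \<epsilon> \<le> 1 \<and> balanced \<mu> \<theta> \<epsilon> E" "\<exists>\<epsilon>>0. \<epsilon> \<le> 1 \<and> balanced \<mu>' \<theta> \<epsilon> E'"
  shows "\<exists>\<epsilon>>0. \<epsilon> \<le> 1 \<and> balanced \<mu> \<theta> \<epsilon> E \<and> balanced \<mu>' \<theta> \<epsilon> E'"
proof -
  obtain a where a: "0 < a" "a \<le> 1" "balanced \<mu> \<theta> a E" using assms(1) by auto
  obtain b where b: "0 < b" "b \<le> 1" "balanced \<mu>' \<theta> b E'" using assms(2) by auto
  have "balanced \<mu> \<theta> (min a b) E" "balanced \<mu>' \<theta> (min a b) E'"
    by (rule balanced_mono[OF a(3)], simp) (rule balanced_mono[OF b(3)], simp)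
  thus ?thesis using a b by (intro exI[of _ "min a b"] conjI) auto
qed

lemma num_verts_of_edges: "num_verts (Graph (\<Union>J) J) = card (\<Union>J)" "num_edges (Graph (\<Union>J) J) = card J"
  unfolding num_verts_def num_edges_def by simp_all

lemma card_Union_ge_2:
  assumes "edge_set J" "J \<noteq> {}" shows "2 \<le> card (\<Union>J)"
proof -
  obtain e where "e \<in> J" using assms by auto
  hence "card e = 2" "e \<subseteq> \<Union>J" using assms unfolding edge_set_def by auto
  thus ?thesis using card_mono[OF edge_set_Union_finite[OF assms(1)], of e] by simp
qed

lemma wt_single:
  assumes "edge_set J" "card J = 1" shows "wt \<mu> J = 2 - 1 / \<mu>"
proof -
  obtain e where "J = {e}" using assms(2) card_1_singletonE by blast
  thus ?thesis using assms(1) unfolding wt_def edge_set_def by simp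
qed

text \<open>The maximum in m2 H is attained by H itself, since a proper maximiser would violate
  strictness; so e = x (v - 2) + 1, which is weight \<theta>. Proper parts have a smaller ratio and
  hence a larger weight. Isolated vertices are excluded because dropping them would not lower the
  ratio.\<close>

lemma strictly_2_balanced_imp_balanced:
  fixes H :: "'a graph"
  assumes H: "simple_graph H" "strictly_2_balanced H" "1 < m2 H"
  shows "verts H = \<Union>(edges H)" "\<exists>\<epsilon>>0. \<epsilon> \<le> 1 \<and> balanced (m2 H) (2 - 1 / m2 H) \<epsilon> (edges H)"
proof -
  define x where "x = m2 H"
  have x1: "1 < x" unfolding x_def by fact
  note att = m2_attained[OF H(1,3)]
  let ?E = "edges H"
  have es: "edge_set ?E" using H(1) by (rule simple_graph_edge_set)
  have ratio: "(real (num_edges J) - 1) / (real (num_verts J) - 2) < x" if J: "proper_subgraph J H" "3 \<le> num_verts J" for J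
  proof (cases "edges J = {}")
    case True
    hence "(real (num_edges J) - 1) / (real (num_verts J) - 2) = - 1 / (real (num_verts J) - 2)" unfolding num_edges_def by simp
    also have "\<dots> \<le> 0" using J(2) by simp
    finally show ?thesis using x1 by simp
  next
    case False
    have sJ: "simple_graph J" using J(1) unfolding proper_subgraph_def subgraph_def by simp
    have "(real (num_edges J) - 1) / (real (num_verts J) - 2) \<le> m2 J" using m2_ge[OF sJ subgraph_refl[OF sJ] J(2) False] .
    also have "\<dots> < x" using H(2) J(1) unfolding strictly_2_balanced_def x_def by simp
    finally show ?thesis .
  qed
  have xH: "x = (real (num_edges H) - 1) / (real (num_verts H) - 2)"
  proof -
    obtain J where J: "subgraph J H" "3 \<le> num_verts J" "x = (real (num_edges J) - 1) / (real (num_verts J) - 2)"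
      using att(3) unfolding x_def by auto
    have "\<not> proper_subgraph J H" using ratio[OF _ J(2)] J(3) by auto
    hence "J = H" using J(1) unfolding proper_subgraph_def by simp
    thus ?thesis using J(3) by simp
  qed
  have sz: "real (num_edges H) - 1 = x * (real (num_verts H) - 2)" using xH att(2) by simp
  have cE: "2 \<le> card ?E"
  proof -
    have "x * 1 \<le> x * (real (num_verts H) - 2)" using x1 att(2) by (intro mult_left_mono) auto
    hence "1 < real (card ?E) - 1" using sz x1 unfolding num_edges_def by linarith
    thus ?thesis by linarith
  qed
  have v3: "3 \<le> card (\<Union>?E)" by (rule card_Union_ge_3[OF es cE])
  show V: "verts H = \<Union>?E"
  proof (rule ccontr)
    assume ne: "verts H \<noteq> \<Union>?E"
    let ?J = "Graph (\<Union>?E) ?E"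
    have "?J \<noteq> H" using ne by (metis graph.sel(1))
    hence "proper_subgraph ?J H" unfolding proper_subgraph_def using subgraph_of_edges[OF H(1)] by simp
    hence "(real (card ?E) - 1) / (real (card (\<Union>?E)) - 2) < x" using ratio[of ?J] v3 unfolding num_verts_of_edges by simp
    hence "real (card ?E) - 1 < x * (real (card (\<Union>?E)) - 2)" using v3 by (simp add: pos_divide_less_eq)
    also have "\<dots> \<le> x * (real (num_verts H) - 2)"
    proof -
      have "card (\<Union>?E) \<le> num_verts H" unfolding num_verts_def
        using simple_graph_Union[OF H(1)] H(1) unfolding simple_graph_def by (intro card_mono) auto
      thus ?thesis using x1 by (intro mult_left_mono) auto
    qed
    finally show False using sz unfolding num_edges_def by simp
  qed
  have wE: "wt x ?E = 2 - 1 / x"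
  proof -
    have "real (card ?E) = x * (real (card (\<Union>?E)) - 2) + 1" using sz unfolding num_edges_def num_verts_def V by simp
    hence "real (card ?E) / x = real (card (\<Union>?E)) - 2 + 1 / x" using x1 by (simp add: add_divide_distrib)
    thus ?thesis unfolding wt_def by simp
  qed
  have strict: "2 - 1 / x < wt x J" if J: "J \<subset> ?E" "2 \<le> card J" for J
  proof -
    have esJ: "edge_set J" using edge_set_subset[OF es] J(1) by auto
    have vJ: "3 \<le> card (\<Union>J)" by (rule card_Union_ge_3[OF esJ J(2)])
    have "Graph (\<Union>J) J \<noteq> H" using J(1) by (metis graph.sel(2) psubset_eq)
    hence "proper_subgraph (Graph (\<Union>J) J) H" unfolding proper_subgraph_def using subgraph_of_edges[OF H(1)] J(1) by auto
    hence "(real (card J) - 1) / (real (card (\<Union>J)) - 2) < x" using ratio[of "Graph (\<Union>J) J"] vJ unfolding num_verts_of_edges by simp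
    hence "real (card J) < x * (real (card (\<Union>J)) - 2) + 1" using vJ by (simp add: pos_divide_less_eq)
    hence "real (card J) / x < (x * (real (card (\<Union>J)) - 2) + 1) / x" using x1 by (intro divide_strict_right_mono) auto
    also have "\<dots> = real (card (\<Union>J)) - 2 + 1 / x" using x1 by (simp add: add_divide_distrib)
    finally show ?thesis unfolding wt_def by simp
  qed
  have "\<exists>\<epsilon>>0. \<epsilon> \<le> 1 \<and> balanced x (2 - 1 / x) \<epsilon> ?E"
  proof (rule balancedI[OF es cE wE _ strict])
    fix J assume J: "J \<subseteq> ?E" "J \<noteq> {}"
    have esJ: "edge_set J" by (rule edge_set_subset[OF es J(1)])
    have "card J > 0" using J esJ unfolding edge_set_def by (simp add: card_gt_0_iff)
    hence "card J = 1 \<or> 2 \<le> card J" by linarith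
    then consider "card J = 1" | "J = ?E" | "J \<subset> ?E" "2 \<le> card J" using J(1) by blast
    thus "2 - 1 / x \<le> wt x J"
    proof cases
      case 1 thus ?thesis using wt_single[OF esJ] by simp
    next
      case 2 thus ?thesis using wE by simp
    next
      case 3 thus ?thesis using strict by (simp add: less_imp_le)
    qed
  qed
  thus "\<exists>\<epsilon>>0. \<epsilon> \<le> 1 \<and> balanced (m2 H) (2 - 1 / m2 H) \<epsilon> (edges H)" unfolding x_def .
qed

lemma strictly_mixed_balanced_attained:
  assumes H: "simple_graph H1" "strictly_mixed_balanced H1 H2" and n2: "2 \<le> num_verts H1"
  shows "mixed_m2 H1 H2 = real (num_edges H1) / (real (num_verts H1) - 2 + 1 / m2 H2)"
    "\<And>J. proper_subgraph J H1 \<Longrightarrow> 2 \<le> num_verts J \<Longrightarrow> real (num_edges J) / (real (num_verts J) - 2 + 1 / m2 H2) < mixed_m2 H1 H2"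
proof -
  show ratio: "real (num_edges J) / (real (num_verts J) - 2 + 1 / m2 H2) < mixed_m2 H1 H2"
    if J: "proper_subgraph J H1" "2 \<le> num_verts J" for J
  proof -
    have sJ: "simple_graph J" using J(1) unfolding proper_subgraph_def subgraph_def by simp
    have "real (num_edges J) / (real (num_verts J) - 2 + 1 / m2 H2) \<le> mixed_m2 J H2"
      by (rule mixed_ge[OF sJ subgraph_refl[OF sJ] J(2)])
    also have "\<dots> < mixed_m2 H1 H2" using H(2) J(1) unfolding strictly_mixed_balanced_def by simp
    finally show ?thesis .
  qed
  obtain J where J: "subgraph J H1" "2 \<le> num_verts J" "mixed_m2 H1 H2 = real (num_edges J) / (real (num_verts J) - 2 + 1 / m2 H2)"
    using mixed_attained[OF H(1) n2] by blast
  have "\<not> proper_subgraph J H1" using ratio[OF _ J(2)] J(3) by auto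
  hence "J = H1" using J(1) unfolding proper_subgraph_def by simp
  thus "mixed_m2 H1 H2 = real (num_edges H1) / (real (num_verts H1) - 2 + 1 / m2 H2)" using J(3) by simp
qed

text \<open>H1 itself attains the maximum, and m = e/(v - 2 + 1/x) rearranges to weight 2 - 1/x at
  m. Thus H1 and H2 get the same \<theta>, each with respect to its own density.\<close>

lemma strictly_mixed_balanced_imp_balanced:
  fixes H1 :: "'a graph" and H2 :: "'b graph"
  assumes H: "simple_graph H1" "strictly_mixed_balanced H1 H2" and m21: "m2 H2 \<le> m2 H1" and x1: "1 < m2 H2"
  shows "verts H1 = \<Union>(edges H1)" "m2 H2 < mixed_m2 H1 H2"
    "\<exists>\<epsilon>>0. \<epsilon> \<le> 1 \<and> balanced (mixed_m2 H1 H2) (2 - 1 / m2 H2) \<epsilon> (edges H1)"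
proof -
  define x where "x = m2 H2"
  define m where "m = mixed_m2 H1 H2"
  have x1: "1 < x" unfolding x_def by fact
  let ?E = "edges H1"
  have es: "edge_set ?E" using H(1) by (rule simple_graph_edge_set)
  have m21': "1 < m2 H1" using m21 x1 unfolding x_def by simp
  note att = m2_attained[OF H(1) m21']
  have n2: "2 \<le> num_verts H1" using att(2) by simp
  note mA = strictly_mixed_balanced_attained(1)[OF H n2, folded m_def x_def]
  note mB = strictly_mixed_balanced_attained(2)[OF H n2, folded m_def x_def]
  obtain e where e: "e \<in> ?E" using att(1) by auto
  have ce: "card e = 2" using e es unfolding edge_set_def by auto
  \<comment> \<open>A single edge has ratio 1/(0 + 1/x) = x, and it is a proper subgraph because m2
    H1 > 1 forces three vertices.\<close>
  have xm: "x < m"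
  proof -
    let ?J = "Graph (\<Union>{e}) {e}"
    have "num_verts ?J = 2" "num_edges ?J = 1" unfolding num_verts_of_edges using ce by simp_all
    moreover have "proper_subgraph ?J H1" unfolding proper_subgraph_def
      using subgraph_of_edges[OF H(1), of "{e}"] e att(2) \<open>num_verts ?J = 2\<close> by auto
    ultimately show ?thesis using mB[of ?J] x1 by simp
  qed
  thus "m2 H2 < mixed_m2 H1 H2" unfolding x_def m_def .
  have m0: "0 < m" using xm x1 by simp
  have ix: "0 < 1 / x" using x1 by simp
  have pos: "0 < real (num_verts H1) - 2 + 1 / x" using att(2) ix by linarith
  have sz: "real (num_edges H1) = m * (real (num_verts H1) - 2 + 1 / x)" using mA pos by simp
  have v2: "2 \<le> card (\<Union>J)" if "J \<subseteq> ?E" "J \<noteq> {}" for J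
    using card_Union_ge_2[OF edge_set_subset[OF es that(1)] that(2)] .
  have lt: "real (card J) < m * (real (card (\<Union>J)) - 2 + 1 / x)" if J: "J \<subseteq> ?E" "J \<noteq> {}" "Graph (\<Union>J) J \<noteq> H1" for J
  proof -
    have "proper_subgraph (Graph (\<Union>J) J) H1" unfolding proper_subgraph_def using subgraph_of_edges[OF H(1) J(1)] J(3) by simp
    hence "real (card J) / (real (card (\<Union>J)) - 2 + 1 / x) < m" using mB[of "Graph (\<Union>J) J"] v2[OF J(1,2)] unfolding num_verts_of_edges by simp
    moreover have "0 < real (card (\<Union>J)) - 2 + 1 / x" using v2[OF J(1,2)] ix by linarith
    ultimately show ?thesis by (simp add: pos_divide_less_eq)
  qed
  show V: "verts H1 = \<Union>?E"
  proof (rule ccontr)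
    assume "verts H1 \<noteq> \<Union>?E"
    hence "Graph (\<Union>?E) ?E \<noteq> H1" by (metis graph.sel(1))
    hence "real (card ?E) < m * (real (card (\<Union>?E)) - 2 + 1 / x)" using lt[of ?E] att(1) by simp
    also have "\<dots> \<le> m * (real (num_verts H1) - 2 + 1 / x)"
    proof -
      have "card (\<Union>?E) \<le> num_verts H1" unfolding num_verts_def
        using simple_graph_Union[OF H(1)] H(1) unfolding simple_graph_def by (intro card_mono) auto
      thus ?thesis using m0 by (intro mult_left_mono) auto
    qed
    finally show False using sz unfolding num_edges_def by simp
  qed
  have wE: "wt m ?E = 2 - 1 / x"
  proof -
    have "real (card ?E) / m = real (card (\<Union>?E)) - 2 + 1 / x" using sz m0 unfolding num_edges_def num_verts_def V by simp
    thus ?thesis unfolding wt_def by simp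
  qed
  have strict: "2 - 1 / x < wt m J" if J: "J \<subset> ?E" "J \<noteq> {}" for J
  proof -
    have "Graph (\<Union>J) J \<noteq> H1" using J(1) by (metis graph.sel(2) psubset_eq)
    hence "real (card J) < m * (real (card (\<Union>J)) - 2 + 1 / x)" using lt[of J] J by auto
    hence "real (card J) / m < real (card (\<Union>J)) - 2 + 1 / x" using m0 by (simp add: pos_divide_less_eq mult.commute)
    thus ?thesis unfolding wt_def by simp
  qed
  have cE: "2 \<le> card ?E"
  proof (rule ccontr)
    assume "\<not> 2 \<le> card ?E"
    moreover have "card ?E > 0" using att(1) es unfolding edge_set_def by (simp add: card_gt_0_iff)
    ultimately have "card ?E = 1" by linarith
    then obtain e' where "?E = {e'}" by (rule card_1_singletonE)
    hence "?E = {e}" using e by simp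
    hence "num_verts H1 = 2" using V ce unfolding num_verts_def by simp
    thus False using att(2) by simp
  qed
  have "\<exists>\<epsilon>>0. \<epsilon> \<le> 1 \<and> balanced m (2 - 1 / x) \<epsilon> ?E"
  proof (rule balancedI[OF es cE wE])
    fix J assume J: "J \<subseteq> ?E" "J \<noteq> {}"
    show "2 - 1 / x \<le> wt m J"
    proof (cases "J = ?E")
      case False
      hence "J \<subset> ?E" using J(1) by blast
      thus ?thesis using strict J(2) by (simp add: less_imp_le)
    qed (simp add: wE)
  next
    fix J assume J: "J \<subset> ?E" "2 \<le> card J"
    have "J \<noteq> {}" using J(2) by auto
    thus "2 - 1 / x < wt m J" by (rule strict[OF J(1)])
  qed
  thus "\<exists>\<epsilon>>0. \<epsilon> \<le> 1 \<and> balanced (mixed_m2 H1 H2) (2 - 1 / m2 H2) \<epsilon> (edges H1)" unfolding x_def m_def .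
qed

section \<open>Strictly balanced subgraphs of the same density\<close>

lemma smaller_proper_subgraph:
  assumes "simple_graph H" "proper_subgraph J H"
  shows "num_verts J + num_edges J < num_verts H + num_edges H"
proof -
  have sub: "verts J \<subseteq> verts H" "edges J \<subseteq> edges H" and ne: "J \<noteq> H"
    using assms(2) unfolding proper_subgraph_def subgraph_def by auto
  have fin: "finite (verts H)" "finite (edges H)"
    using assms(1) simple_graph_edge_set[OF assms(1)] unfolding simple_graph_def edge_set_def by auto
  have le: "num_verts J \<le> num_verts H" "num_edges J \<le> num_edges H"
    unfolding num_verts_def num_edges_def using sub fin by (auto intro: card_mono)
  have "verts J \<noteq> verts H \<or> edges J \<noteq> edges H" using ne by (metis graph.expand)
  hence "num_verts J < num_verts H \<or> num_edges J < num_edges H"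
    unfolding num_verts_def num_edges_def
    using psubset_card_mono[OF fin(1), of "verts J"] psubset_card_mono[OF fin(2), of "edges J"] sub by auto
  thus ?thesis using le by linarith
qed

lemma minimal_subgraph:
  assumes H: "simple_graph H" and PH: "P H"
  shows "\<exists>K. subgraph K H \<and> P K \<and> (\<forall>J. proper_subgraph J K \<longrightarrow> \<not> P J)"
proof -
  have "subgraph H H \<and> P H" using subgraph_refl[OF H] PH by simp
  then obtain K where K: "subgraph K H \<and> P K" "\<And>J. subgraph J H \<and> P J \<Longrightarrow> num_verts K + num_edges K \<le> num_verts J + num_edges J"
    using ex_has_least_nat[of "\<lambda>K. subgraph K H \<and> P K" H "\<lambda>K. num_verts K + num_edges K"] by blast
  have sK: "simple_graph K" using K(1) unfolding subgraph_def by simp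
  have "\<not> P J" if J: "proper_subgraph J K" for J
  proof
    assume "P J"
    have "subgraph J K" using J unfolding proper_subgraph_def by simp
    hence "subgraph J H" using subgraph_trans K(1) by blast
    hence "num_verts K + num_edges K \<le> num_verts J + num_edges J" using K(2) \<open>P J\<close> by simp
    thus False using smaller_proper_subgraph[OF sK J] by simp
  qed
  thus ?thesis using K(1) by blast
qed

text \<open>A minimal subgraph among those whose 2-density has not dropped is strictly balanced by
  its choice.\<close>

lemma strictly_2_balanced_subgraph:
  assumes "simple_graph H" "1 < m2 H"
  shows "\<exists>K. subgraph K H \<and> strictly_2_balanced K \<and> m2 K = m2 H"
proof -
  obtain K where K: "subgraph K H" "m2 H \<le> m2 K" "\<forall>J. proper_subgraph J K \<longrightarrow> \<not> m2 H \<le> m2 J"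
    using minimal_subgraph[OF assms(1), of "\<lambda>K. m2 H \<le> m2 K"] by auto
  have "m2 K \<le> m2 H" using m2_mono[OF assms(1) K(1)] K(2) assms(2) by simp
  hence eq: "m2 K = m2 H" using K(2) by simp
  have "strictly_2_balanced K" unfolding strictly_2_balanced_def eq using K(3) by (simp add: not_le)
  thus ?thesis using K(1) eq by blast
qed

lemma mixed_nonneg: "simple_graph H \<Longrightarrow> 0 < m2 H2 \<Longrightarrow> 0 \<le> mixed_m2 H H2"
  using mixed_ge[OF _ subgraph_refl[of H], of H2]
  by (cases "num_verts H < 2") (force simp: mixed_m2_def intro: order.trans[rotated])+

lemma mixed_mono:
  assumes "simple_graph H" "subgraph J H" "0 < m2 H2"
  shows "mixed_m2 J H2 \<le> mixed_m2 H H2"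
proof (cases "num_verts J < 2")
  case True
  hence "mixed_m2 J H2 = 0" unfolding mixed_m2_def by simp
  thus ?thesis using mixed_nonneg[OF assms(1,3)] by simp
next
  case False
  have sJ: "simple_graph J" using assms(2) unfolding subgraph_def by simp
  obtain K where K: "subgraph K J" "2 \<le> num_verts K" "mixed_m2 J H2 = real (num_edges K) / (real (num_verts K) - 2 + 1 / m2 H2)"
    using mixed_attained[OF sJ, of H2] False by auto
  show ?thesis unfolding K(3) by (rule mixed_ge[OF assms(1) subgraph_trans[OF K(1) assms(2)] K(2)])
qed

lemma mixed_cong: "m2 H2 = m2 H2' \<Longrightarrow> mixed_m2 H H2 = mixed_m2 H H2'"
  unfolding mixed_m2_def by simp

text \<open>A minimal subgraph K of undiminished mixed density works. The last conclusion makes the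
  pair of K and H2 admissible for the deterministic statement: since m > x, K is more than an edge,
  and e = m (v - 2 + 1/x) \<ge> x (v - 2) + 1 gives m2 K \<ge> x. The strict inequality m2 H2 < m2 H
  is what yields m > x.\<close>

lemma strictly_mixed_balanced_subgraph:
  assumes H: "simple_graph H" and x: "1 < m2 H2" and lt: "m2 H2 < m2 H"
  shows "\<exists>K. subgraph K H \<and> strictly_mixed_balanced K H2 \<and> mixed_m2 K H2 = mixed_m2 H H2 \<and> m2 H2 \<le> m2 K"
proof -
  define x where "x = m2 H2"
  define m where "m = mixed_m2 H H2"
  have x1: "1 < x" unfolding x_def by fact
  have ix: "0 < 1 / x" using x1 by simp
  obtain K where K: "subgraph K H" "m \<le> mixed_m2 K H2" "\<forall>J. proper_subgraph J K \<longrightarrow> \<not> m \<le> mixed_m2 J H2"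
    using minimal_subgraph[OF H, of "\<lambda>K. m \<le> mixed_m2 K H2"] unfolding m_def by auto
  have sK: "simple_graph K" using K(1) unfolding subgraph_def by simp
  have "mixed_m2 K H2 \<le> m" unfolding m_def using mixed_mono[OF H K(1), of H2] x by simp
  hence eq: "mixed_m2 K H2 = m" using K(2) by simp
  have smb: "strictly_mixed_balanced K H2" unfolding strictly_mixed_balanced_def eq using K(3) by (simp add: not_le)
  have m21: "1 < m2 H" using x lt by simp
  have xm: "x < m"
  proof -
    obtain J where J: "subgraph J H" "3 \<le> num_verts J" "m2 H = (real (num_edges J) - 1) / (real (num_verts J) - 2)"
      using m2_attained(3)[OF H m21] by auto
    define v where "v = real (num_verts J) - 2"
    have v: "1 \<le> v" unfolding v_def using J(2) by simp
    have "x < (real (num_edges J) - 1) / v" using lt J(3) unfolding x_def v_def by simp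
    hence "x * v < real (num_edges J) - 1" using v by (simp add: pos_less_divide_eq)
    hence "x * (v + 1 / x) < real (num_edges J)" using x1 by (simp add: distrib_left)
    moreover have "0 < v + 1 / x" using v ix by linarith
    ultimately have "x < real (num_edges J) / (v + 1 / x)" by (simp add: pos_less_divide_eq)
    also have "\<dots> \<le> m" unfolding m_def v_def x_def by (rule mixed_ge[OF H J(1)]) (use J(2) in simp)
    finally show ?thesis .
  qed
  have n2: "2 \<le> num_verts K"
  proof (rule ccontr)
    assume "\<not> 2 \<le> num_verts K"
    hence "mixed_m2 K H2 = 0" unfolding mixed_m2_def by simp
    thus False using eq xm x1 by simp
  qed
  define v where "v = real (num_verts K) - 2"
  have mK: "m = real (num_edges K) / (v + 1 / x)"
    using strictly_mixed_balanced_attained(1)[OF sK smb n2] unfolding eq v_def x_def .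
  have v0: "0 \<le> v" unfolding v_def using n2 by simp
  have pos: "0 < v + 1 / x" using v0 ix by linarith
  have e: "real (num_edges K) = m * (v + 1 / x)" using mK pos by simp
  have n3: "3 \<le> num_verts K"
  proof (rule ccontr)
    assume "\<not> 3 \<le> num_verts K"
    hence n: "num_verts K = 2" using n2 by simp
    have "real (num_edges K) \<le> 1" using two_verts_one_edge[OF sK n] by simp
    moreover have "real (num_edges K) = m / x" using e n unfolding v_def by simp
    ultimately have "m \<le> x" using x1 by (simp add: pos_divide_le_eq)
    thus False using xm by simp
  qed
  have v1: "1 \<le> v" unfolding v_def using n3 by simp
  have ne: "edges K \<noteq> {}"
  proof
    assume "edges K = {}"
    hence "real (num_edges K) = 0" unfolding num_edges_def by simp
    moreover have "0 < m * (v + 1 / x)" using xm x1 pos by (intro mult_pos_pos) auto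
    ultimately show False using e by linarith
  qed
  have "x * v \<le> real (num_edges K) - 1"
  proof -
    have "x * (v + 1 / x) \<le> m * (v + 1 / x)" using xm pos by (intro mult_right_mono) auto
    thus ?thesis using e x1 by (simp add: distrib_left)
  qed
  hence "x \<le> (real (num_edges K) - 1) / v" using v1 by (simp add: pos_le_divide_eq)
  also have "\<dots> \<le> m2 K" unfolding v_def by (rule m2_ge[OF sK subgraph_refl[OF sK] n3 ne])
  finally show ?thesis using K(1) smb eq unfolding m_def x_def by blast
qed

text \<open>For v \<ge> 3 the bound (e - 1)/(v - 2) \<le> x is equivalent to e/(v - 2 + 1/x) \<le>
  x, and a single edge gives equality in the latter.\<close>

lemma mixed_eq_m2:
  assumes H: "simple_graph H" and x: "1 < m2 H2" and eq: "m2 H = m2 H2"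
  shows "mixed_m2 H H2 = m2 H2"
proof -
  define x where "x = m2 H2"
  have x1: "1 < x" unfolding x_def by fact
  have ix: "0 < 1 / x" using x1 by simp
  have m21: "1 < m2 H" using x eq by simp
  note att = m2_attained[OF H m21]
  have n2: "2 \<le> num_verts H" using att(2) by simp
  obtain J where J: "subgraph J H" "2 \<le> num_verts J" "mixed_m2 H H2 = real (num_edges J) / (real (num_verts J) - 2 + 1 / x)"
    using mixed_attained[OF H n2, of H2] unfolding x_def by auto
  have sJ: "simple_graph J" using J(1) unfolding subgraph_def by simp
  have "real (num_edges J) \<le> x * (real (num_verts J) - 2) + 1"
  proof (cases "num_verts J = 2 \<or> edges J = {}")
    case True
    thus ?thesis
    proof
      assume "num_verts J = 2"
      thus ?thesis using two_verts_one_edge[OF sJ] by simp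
    next
      assume "edges J = {}"
      moreover have "0 \<le> x * (real (num_verts J) - 2)" using J(2) x1 by simp
      ultimately show ?thesis unfolding num_edges_def by simp
    qed
  next
    case False
    hence n3: "3 \<le> num_verts J" and ne: "edges J \<noteq> {}" using J(2) by auto
    have "(real (num_edges J) - 1) / (real (num_verts J) - 2) \<le> x" using m2_ge[OF H J(1) n3 ne] eq unfolding x_def by simp
    hence "real (num_edges J) - 1 \<le> x * (real (num_verts J) - 2)" using n3 by (simp add: pos_divide_le_eq)
    thus ?thesis by simp
  qed
  also have "\<dots> = x * (real (num_verts J) - 2 + 1 / x)" using x1 by (simp add: distrib_left)
  finally have "real (num_edges J) \<le> x * (real (num_verts J) - 2 + 1 / x)" .
  moreover have "0 < real (num_verts J) - 2 + 1 / x" using J(2) ix by linarith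
  ultimately have le: "mixed_m2 H H2 \<le> x" unfolding J(3) by (simp add: pos_divide_le_eq)
  obtain e where e: "e \<in> edges H" using att(1) by auto
  have ce: "card e = 2" using e simple_graph_edge_set[OF H] unfolding edge_set_def by auto
  have "real (num_edges (Graph (\<Union>{e}) {e})) / (real (num_verts (Graph (\<Union>{e}) {e})) - 2 + 1 / m2 H2) \<le> mixed_m2 H H2"
    by (rule mixed_ge[OF H subgraph_of_edges[OF H]], use e in simp, unfold num_verts_of_edges, use ce in simp)
  hence "x \<le> mixed_m2 H H2" unfolding num_verts_of_edges x_def using ce x by simp
  thus ?thesis using le unfolding x_def by simp
qed

section \<open>Copies, isomorphisms and colourings\<close>

lemma copy_trans: "copy E A \<Longrightarrow> inj_on f (\<Union>A) \<Longrightarrow> copy E ((\<lambda>e. f ` e) ` A)"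
proof -
  assume "copy E A" and f: "inj_on f (\<Union>A)"
  then obtain h where h: "inj_on h (\<Union>E)" "A = (\<lambda>e. h ` e) ` E" unfolding copy_def by auto
  have "\<Union>A = h ` \<Union>E" unfolding h(2) by auto
  hence "inj_on (f \<circ> h) (\<Union>E)" using h(1) f by (simp add: comp_inj_on)
  moreover have "(\<lambda>e. f ` e) ` A = (\<lambda>e. (f \<circ> h) ` e) ` E" unfolding h(2) by (simp add: image_image image_comp)
  ultimately show "copy E ((\<lambda>e. f ` e) ` A)" unfolding copy_def by blast
qed

lemma arrows_mono:
  assumes "arrows A E1 E2" "A \<subseteq> G" shows "arrows G E1 E2"
  unfolding arrows_def
proof (intro allI impI)
  fix R assume "R \<subseteq> G"
  from arrowsD[OF assms(1), of "A \<inter> R"]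
  have "(\<exists>A1\<subseteq>A \<inter> R. copy E1 A1) \<or> (\<exists>B\<subseteq>A - A \<inter> R. copy E2 B)" by simp
  thus "(\<exists>A\<subseteq>R. copy E1 A) \<or> (\<exists>B\<subseteq>G - R. copy E2 B)"
  proof (elim disjE exE conjE)
    fix A1 assume "A1 \<subseteq> A \<inter> R" "copy E1 A1"
    thus ?thesis by (intro disjI1 exI[of _ A1]) auto
  next
    fix B assume "B \<subseteq> A - A \<inter> R" "copy E2 B"
    thus ?thesis using assms(2) by (intro disjI2 exI[of _ B]) auto
  qed
qed

lemma arrows_copy:
  assumes ar: "arrows G E1 E2" and cp: "copy G A"
  shows "arrows A E1 E2"
  unfolding arrows_def
proof (intro allI impI)
  fix R assume R: "R \<subseteq> A"
  obtain f where f: "inj_on f (\<Union>G)" "A = (\<lambda>e. f ` e) ` G" using cp unfolding copy_def by auto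
  define R0 where "R0 = {e\<in>G. f ` e \<in> R}"
  have R0G: "R0 \<subseteq> G" unfolding R0_def by auto
  have inj: "inj_on f (\<Union>J)" if "J \<subseteq> G" for J by (rule inj_on_subset[OF f(1)]) (use that in auto)
  from arrowsD[OF ar R0G]
  show "(\<exists>A\<subseteq>R. copy E1 A) \<or> (\<exists>B\<subseteq>A - R. copy E2 B)"
  proof (elim disjE exE conjE)
    fix A1 assume A1: "A1 \<subseteq> R0" "copy E1 A1"
    have "copy E1 ((\<lambda>e. f ` e) ` A1)" by (rule copy_trans[OF A1(2) inj]) (use A1(1) R0G in auto)
    moreover have "(\<lambda>e. f ` e) ` A1 \<subseteq> R" using A1(1) unfolding R0_def by auto
    ultimately show ?thesis by (intro disjI1 exI conjI)
  next
    fix B assume B: "B \<subseteq> G - R0" "copy E2 B"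
    have "copy E2 ((\<lambda>e. f ` e) ` B)" by (rule copy_trans[OF B(2) inj]) (use B(1) in auto)
    moreover have "(\<lambda>e. f ` e) ` B \<subseteq> A - R" using B(1) unfolding R0_def f(2) by auto
    ultimately show ?thesis by (intro disjI2 exI conjI)
  qed
qed

lemma isomorphic_imp_copy:
  assumes iso: "isomorphic J H" and J: "simple_graph J" and H: "simple_graph H" and E: "E \<subseteq> edges H"
  shows "\<exists>A\<subseteq>edges J. copy E A"
proof -
  obtain f where f: "bij_betw f (verts J) (verts H)" "(\<lambda>e. f ` e) ` edges J = edges H" using iso unfolding isomorphic_def by auto
  define g where "g = inv_into (verts J) f"
  have fJ: "f ` verts J = verts H" using f(1) unfolding bij_betw_def by simp
  have "\<Union>E \<subseteq> f ` verts J" unfolding fJ using simple_graph_Union[OF H] E by auto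
  hence inj: "inj_on g (\<Union>E)" unfolding g_def by (rule inj_on_inv_into)
  have "(\<lambda>e. g ` e) ` E \<subseteq> edges J"
  proof
    fix a assume "a \<in> (\<lambda>e. g ` e) ` E"
    then obtain e where e: "e \<in> E" "a = g ` e" by auto
    hence "e \<in> (\<lambda>e. f ` e) ` edges J" using E f(2) by auto
    then obtain e0 where e0: "e0 \<in> edges J" "e = f ` e0" by auto
    have "g ` f ` e0 = e0" unfolding g_def
    proof (rule inv_into_image_cancel)
      show "inj_on f (verts J)" using f(1) unfolding bij_betw_def by simp
      show "e0 \<subseteq> verts J" using simple_graph_Union[OF J] e0(1) by auto
    qed
    thus "a \<in> edges J" using e e0 by simp
  qed
  thus ?thesis unfolding copy_def using inj by blast
qed

text \<open>The inverse of the injection is the isomorphism. Assumption \<open>V\<close> enters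
  because an edge set determines a graph only up to isolated vertices.\<close>

lemma isomorphic_of_copy:
  assumes cp: "copy (edges H) A" and V: "verts H = \<Union>(edges H)"
  shows "isomorphic (Graph (\<Union>A) A) H"
proof -
  obtain f where f: "inj_on f (\<Union>(edges H))" "A = (\<lambda>e. f ` e) ` edges H" using cp unfolding copy_def by auto
  define g where "g = inv_into (\<Union>(edges H)) f"
  have UA: "\<Union>A = f ` \<Union>(edges H)" unfolding f(2) by auto
  have "bij_betw f (\<Union>(edges H)) (\<Union>A)" unfolding bij_betw_def UA using f(1) by simp
  hence "bij_betw g (\<Union>A) (\<Union>(edges H))" unfolding g_def by (rule bij_betw_inv_into)
  moreover have "(\<lambda>e. g ` e) ` A = edges H"
  proof -
    have "g ` f ` e = e" if "e \<in> edges H" for e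
      unfolding g_def by (rule inv_into_image_cancel[OF f(1)]) (use that in auto)
    thus ?thesis unfolding f(2) image_image by simp
  qed
  ultimately show ?thesis unfolding isomorphic_def using V by auto
qed

lemma arrows_imp_ramsey:
  assumes G: "simple_graph G" and ar: "arrows (edges G) (edges H1) (edges H2)"
    and V: "verts H1 = \<Union>(edges H1)" "verts H2 = \<Union>(edges H2)"
  shows "ramsey_for G [H1, H2]"
  unfolding ramsey_for_def
proof (intro allI impI)
  fix \<phi> :: "'a set \<Rightarrow> nat"
  assume col: "\<forall>e\<in>edges G. \<phi> e < length [H1, H2]"
  define R where "R = {e\<in>edges G. \<phi> e = 0}"
  have "R \<subseteq> edges G" unfolding R_def by auto
  from arrowsD[OF ar this]
  show "\<exists>i<length [H1, H2]. \<exists>J. subgraph J G \<and> isomorphic J ([H1, H2] ! i) \<and> (\<forall>e\<in>edges J. \<phi> e = i)"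
  proof (elim disjE exE conjE)
    fix A assume A: "A \<subseteq> R" "copy (edges H1) A"
    have "subgraph (Graph (\<Union>A) A) G" by (rule subgraph_of_edges[OF G]) (use A R_def in auto)
    moreover have "isomorphic (Graph (\<Union>A) A) H1" by (rule isomorphic_of_copy[OF A(2) V(1)])
    moreover have "\<forall>e\<in>A. \<phi> e = 0" using A unfolding R_def by auto
    ultimately show ?thesis by (intro exI[of _ 0] conjI exI[of _ "Graph (\<Union>A) A"]) simp_all
  next
    fix B assume B: "B \<subseteq> edges G - R" "copy (edges H2) B"
    have "subgraph (Graph (\<Union>B) B) G" by (rule subgraph_of_edges[OF G]) (use B in auto)
    moreover have "isomorphic (Graph (\<Union>B) B) H2" by (rule isomorphic_of_copy[OF B(2) V(2)])
    moreover have "\<forall>e\<in>B. \<phi> e = 1"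
    proof
      fix e assume "e \<in> B"
      hence "e \<in> edges G" "\<phi> e \<noteq> 0" using B unfolding R_def by auto
      thus "\<phi> e = 1" using col by force
    qed
    ultimately show ?thesis by (intro exI[of _ 1] conjI exI[of _ "Graph (\<Union>B) B"]) simp_all
  qed
qed

section \<open>The equivalence\<close>

lemma gnp_support:
  assumes "G \<in> set_pmf (gnp n p)"
  shows "verts G = {1..n}" "edges G \<subseteq> all_pairs n" "simple_graph G"
proof -
  show 1: "verts G = {1..n}" and 2: "edges G \<subseteq> all_pairs n" using assms unfolding gnp_def by auto
  have "\<forall>e\<in>edges G. e \<subseteq> verts G \<and> card e = 2" using 2 unfolding 1 all_pairs_def by auto
  thus "simple_graph G" unfolding simple_graph_def 1 by simp
qed

lemma prob_mono_support:
  assumes "\<And>\<omega>. \<omega> \<in> set_pmf M \<Longrightarrow> \<omega> \<in> A \<Longrightarrow> \<omega> \<in> B"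
  shows "measure_pmf.prob M A \<le> measure_pmf.prob M B"
proof -
  have "measure_pmf.prob M A = measure_pmf.prob M (A \<inter> set_pmf M)" by (simp add: measure_Int_set_pmf)
  also have "\<dots> \<le> measure_pmf.prob M B" by (rule measure_pmf.finite_measure_mono) (use assms in auto)
  finally show ?thesis .
qed

text \<open>Colour R with 0 and all other edges with 1. A copy of \<open>Hs ! i\<close> in colour i
  \<ge> 2 would need an edge of a colour that does not occur, and every \<open>Hs ! i\<close> has an
  edge.\<close>

lemma ramsey_imp_arrows:
  assumes G: "simple_graph G" and len: "2 \<le> length Hs"
    and Hs: "\<And>i. i < length Hs \<Longrightarrow> simple_graph (Hs ! i) \<and> edges (Hs ! i) \<noteq> {}"
    and E: "E1 \<subseteq> edges (Hs ! 0)" "E2 \<subseteq> edges (Hs ! 1)" and ram: "ramsey_for G Hs"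
  shows "arrows (edges G) E1 E2"
  unfolding arrows_def
proof (intro allI impI)
  fix R assume R: "R \<subseteq> edges G"
  define \<phi> :: "'a set \<Rightarrow> nat" where "\<phi> e = (if e \<in> R then 0 else 1)" for e
  have "\<forall>e\<in>edges G. \<phi> e < length Hs" unfolding \<phi>_def using len by auto
  then obtain i J where i: "i < length Hs" and J: "subgraph J G" "isomorphic J (Hs ! i)" and mono: "\<forall>e\<in>edges J. \<phi> e = i"
    using ram unfolding ramsey_for_def by blast
  have sJ: "simple_graph J" and JG: "edges J \<subseteq> edges G" using J(1) unfolding subgraph_def by auto
  have sH: "simple_graph (Hs ! i)" using Hs[OF i] by simp
  consider "i = 0" | "i = 1" | "2 \<le> i" by linarith
  thus "(\<exists>A\<subseteq>R. copy E1 A) \<or> (\<exists>B\<subseteq>edges G - R. copy E2 B)"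
  proof cases
    case 1
    obtain A where A: "A \<subseteq> edges J" "copy E1 A"
      using isomorphic_imp_copy[OF J(2) sJ sH, of E1] E(1) unfolding 1 by auto
    have "A \<subseteq> R"
    proof
      fix e assume "e \<in> A"
      hence "\<phi> e = 0" using A(1) mono 1 by auto
      thus "e \<in> R" unfolding \<phi>_def by (simp split: if_splits)
    qed
    thus ?thesis using A(2) by (intro disjI1 exI[of _ A] conjI)
  next
    case 2
    obtain B where B: "B \<subseteq> edges J" "copy E2 B"
      using isomorphic_imp_copy[OF J(2) sJ sH, of E2] E(2) unfolding 2 by auto
    have "B \<subseteq> edges G - R"
    proof
      fix e assume e: "e \<in> B"
      hence "\<phi> e = 1" using B(1) mono 2 by auto
      thus "e \<in> edges G - R" using e B(1) JG unfolding \<phi>_def by (auto split: if_splits)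
    qed
    thus ?thesis using B(2) by (intro disjI2 exI[of _ B] conjI)
  next
    case 3
    have "edges J \<noteq> {}" using J(2) Hs[OF i] unfolding isomorphic_def by auto
    then obtain e where "e \<in> edges J" by auto
    hence "\<phi> e = i" using mono by simp
    thus ?thesis using 3 unfolding \<phi>_def by (simp split: if_splits)
  qed
qed

text \<open>Isolated vertices only lower a density, so a densest subgraph may be replaced by its set
  of edges.\<close>

lemma max_density_gt_imp_dense:
  assumes L: "edge_set L" and m: "0 \<le> m" and md: "m < max_density (Graph (\<Union>L) L)"
  shows "\<exists>J\<subseteq>L. m * real (card (\<Union>J)) < real (card J)"
proof -
  let ?G = "Graph (\<Union>L) L"
  let ?S = "{real (num_edges J) / real (num_verts J) | J. subgraph J ?G \<and> num_verts J \<ge> 1}"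
  have sG: "simple_graph ?G" using L by (rule simple_graph_of_edges)
  have ne: "\<Union>L \<noteq> {}" using m md unfolding max_density_def by (auto split: if_splits)
  hence "verts ?G \<noteq> {}" by simp
  hence eq: "max_density ?G = Max ?S" unfolding max_density_def by (rule if_not_P)
  have "num_verts ?G \<ge> 1" unfolding num_verts_of_edges using ne edge_set_Union_finite[OF L] by (simp add: Suc_le_eq card_gt_0_iff)
  hence "?S \<noteq> {}" using subgraph_refl[OF sG] by auto
  hence "Max ?S \<in> ?S" using finite_subgraph_image[OF sG] by (intro Max_in)
  then obtain J where J: "subgraph J ?G" "num_verts J \<ge> 1" "max_density ?G = real (num_edges J) / real (num_verts J)"
    unfolding eq by auto
  have sJ: "simple_graph J" and JL: "edges J \<subseteq> L" using J(1) unfolding subgraph_def by auto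
  have "card (\<Union>(edges J)) \<le> num_verts J"
    unfolding num_verts_def using simple_graph_Union[OF sJ] sJ unfolding simple_graph_def by (intro card_mono) auto
  hence "m * real (card (\<Union>(edges J))) \<le> m * real (num_verts J)" using m by (intro mult_left_mono) auto
  also have "\<dots> < real (num_edges J)" using md J(2) unfolding J(3) by (simp add: pos_less_divide_eq)
  finally show ?thesis using JL unfolding num_edges_def by blast
qed

lemma max_density_le_imp_sparse:
  assumes G: "simple_graph G" and md: "max_density G \<le> m" and J: "J \<subseteq> edges G"
  shows "real (card J) \<le> m * real (card (\<Union>J))"
proof (cases "J = {}")
  case False
  let ?S = "{real (num_edges J) / real (num_verts J) | J. subgraph J G \<and> num_verts J \<ge> 1}"
  let ?J = "Graph (\<Union>J) J"
  have esJ: "edge_set J" using edge_set_subset[OF simple_graph_edge_set[OF G] J] .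
  have v: "2 \<le> card (\<Union>J)" by (rule card_Union_ge_2[OF esJ False])
  have "\<Union>J \<noteq> {}" using v by (metis card.empty not_numeral_le_zero)
  hence "verts G \<noteq> {}" using simple_graph_Union[OF G] J by blast
  hence eq: "max_density G = Max ?S" unfolding max_density_def by (rule if_not_P)
  have "real (num_edges ?J) / real (num_verts ?J) \<in> ?S"
    using subgraph_of_edges[OF G J] v num_verts_of_edges(1)[of J] by force
  hence "real (num_edges ?J) / real (num_verts ?J) \<le> max_density G"
    unfolding eq using finite_subgraph_image[OF G] by (intro Max_ge)
  hence "real (card J) / real (card (\<Union>J)) \<le> m" using md unfolding num_verts_of_edges by simp
  moreover have "0 < real (card (\<Union>J))" using v by simp
  ultimately show ?thesis by (simp only: pos_divide_le_eq)
qed simp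

text \<open>Passing from \<open>Hs\<close> to parts E1 and E2 of its first two members only enlarges
  the event, so the limit 0 carries over.\<close>

lemma zero_statement:
  fixes Hs :: "nat graph list" and E1 E2 :: "nat set set"
  assumes bal: "\<exists>\<epsilon>>0. \<epsilon> \<le> 1 \<and> balanced m (2 - 1 / x) \<epsilon> E1 \<and> balanced x (2 - 1 / x) \<epsilon> E2" and x: "1 < x" "x \<le> m"
    and dense: "\<And>L :: nat set set. edge_set L \<Longrightarrow> arrows L E1 E2 \<Longrightarrow> \<exists>J\<subseteq>L. m * real (card (\<Union>J)) < real (card J)"
    and len: "2 \<le> length Hs" and Hs: "\<And>i. i < length Hs \<Longrightarrow> simple_graph (Hs ! i) \<and> edges (Hs ! i) \<noteq> {}"
    and E: "E1 \<subseteq> edges (Hs ! 0)" "E2 \<subseteq> edges (Hs ! 1)"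
  shows "\<exists>c::real. c > 0 \<and> (\<forall>p :: nat \<Rightarrow> real.
     (\<forall>n. 0 \<le> p n \<and> p n \<le> 1) \<and> (\<forall>n\<ge>1. p n \<le> c * real n powr (- 1 / m)) \<longrightarrow>
     (\<lambda>n. measure_pmf.prob (gnp n (p n)) {G. ramsey_for G Hs}) \<longlonglongrightarrow> 0)"
proof -
  obtain \<epsilon> where eps: "0 < \<epsilon>" "\<epsilon> \<le> 1" "balanced m (2 - 1 / x) \<epsilon> E1" "balanced x (2 - 1 / x) \<epsilon> E2" using bal by auto
  obtain c where c: "c > 0" "\<And>p. (\<forall>n. 0 \<le> p n \<and> p n \<le> 1) \<and> (\<forall>n\<ge>1. p n \<le> c * real n powr (- 1 / m)) \<Longrightarrow>
           (\<lambda>n. measure_pmf.prob (gnp n (p n)) {G. edges G \<subseteq> all_pairs n \<and> arrows (edges G) E1 E2}) \<longlonglongrightarrow> 0"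
    using prob_arrows_tendsto_0[OF eps(3,4) x refl eps(1,2) dense] by blast
  have "(\<lambda>n. measure_pmf.prob (gnp n (p n)) {G. ramsey_for G Hs}) \<longlonglongrightarrow> 0"
    if p: "(\<forall>n. 0 \<le> p n \<and> p n \<le> 1) \<and> (\<forall>n\<ge>1. p n \<le> c * real n powr (- 1 / m))" for p
  proof (rule tendsto_sandwich[OF _ _ tendsto_const c(2)[OF p]])
    show "\<forall>\<^sub>F n in sequentially. 0 \<le> measure_pmf.prob (gnp n (p n)) {G. ramsey_for G Hs}" by simp
    have "measure_pmf.prob (gnp n (p n)) {G. ramsey_for G Hs}
        \<le> measure_pmf.prob (gnp n (p n)) {G. edges G \<subseteq> all_pairs n \<and> arrows (edges G) E1 E2}" for n
    proof (rule prob_mono_support)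
      fix G assume G: "G \<in> set_pmf (gnp n (p n))" "G \<in> {G. ramsey_for G Hs}"
      have "arrows (edges G) E1 E2" using ramsey_imp_arrows[OF gnp_support(3)[OF G(1)] len Hs E] G(2) by simp
      thus "G \<in> {G. edges G \<subseteq> all_pairs n \<and> arrows (edges G) E1 E2}" using gnp_support(2)[OF G(1)] by simp
    qed
    thus "\<forall>\<^sub>F n in sequentially. measure_pmf.prob (gnp n (p n)) {G. ramsey_for G Hs}
        \<le> measure_pmf.prob (gnp n (p n)) {G. edges G \<subseteq> all_pairs n \<and> arrows (edges G) E1 E2}" by simp
  qed
  thus ?thesis using c(1) by blast
qed

lemma max_density_ramsey_gt:
  fixes H1 H2 :: "nat graph" and G :: "'a graph"
  assumes H1: "simple_graph H1" and H2: "simple_graph H2" and sb: "strictly_balanced_pair H1 H2"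
    and m21: "m2 H2 \<le> m2 H1" and x1: "1 < m2 H2" and G: "simple_graph G" and ram: "ramsey_for G [H1, H2]"
    and zero: "\<exists>c::real. c > 0 \<and> (\<forall>p :: nat \<Rightarrow> real.
                  (\<forall>n. 0 \<le> p n \<and> p n \<le> 1) \<and> (\<forall>n\<ge>1. p n \<le> c * real n powr (- 1 / mixed_m2 H1 H2)) \<longrightarrow>
                  (\<lambda>n. measure_pmf.prob (gnp n (p n)) {G. ramsey_for G [H1, H2]}) \<longlonglongrightarrow> 0)"
  shows "mixed_m2 H1 H2 < max_density G"
proof -
  define m where "m = mixed_m2 H1 H2"
  have sb': "strictly_2_balanced H2" "strictly_mixed_balanced H1 H2" using sb unfolding strictly_balanced_pair_def by auto
  note V = strictly_mixed_balanced_imp_balanced(1)[OF H1 sb'(2) m21 x1] strictly_2_balanced_imp_balanced(1)[OF H2 sb'(1) x1]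
  have m0: "0 < m" using strictly_mixed_balanced_imp_balanced(2)[OF H1 sb'(2) m21 x1] x1 unfolding m_def by simp
  have ne: "edges H1 \<noteq> {}" "edges H2 \<noteq> {}" using m2_attained(1)[OF H1] m2_attained(1)[OF H2] m21 x1 by auto
  have Hs: "simple_graph ([H1, H2] ! i) \<and> edges ([H1, H2] ! i) \<noteq> {}" if "i < length [H1, H2]" for i
    using that H1 H2 ne by (cases "i = 0") (auto simp: less_Suc_eq)
  have ar: "arrows (edges G) (edges H1) (edges H2)"
    by (rule ramsey_imp_arrows[OF G _ Hs _ _ ram]) auto
  show "mixed_m2 H1 H2 < max_density G"
  proof (rule ccontr)
    assume "\<not> ?thesis"
    hence md: "max_density G \<le> m" unfolding m_def by simp
    have Gne: "edges G \<noteq> {}" using ar empty_not_arrows[OF ne] by auto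
    from zero obtain c where c: "c > 0" "\<And>p. (\<forall>n. 0 \<le> p n \<and> p n \<le> 1) \<and> (\<forall>n\<ge>1. p n \<le> c * real n powr (- 1 / m)) \<Longrightarrow>
                  (\<lambda>n. measure_pmf.prob (gnp n (p n)) {G. ramsey_for G [H1, H2]}) \<longlonglongrightarrow> 0"
      unfolding m_def by blast
    \<comment> \<open>The largest probability the zero statement permits; the cap at 1 keeps it
      admissible for small n.\<close>
    define p where "p n = min 1 (c * real n powr (- 1 / m))" for n
    have lim: "(\<lambda>n. measure_pmf.prob (gnp n (p n)) {G. ramsey_for G [H1, H2]}) \<longlonglongrightarrow> 0"
      by (rule c(2)) (use c(1) in \<open>auto simp: p_def\<close>)
    obtain \<delta> where d: "0 < \<delta>" "\<forall>\<^sub>F n in sequentially. \<delta> \<le> measure_pmf.prob (gnp n (p n)) {\<Gamma>. \<exists>A\<subseteq>edges \<Gamma>. copy (edges G) A}"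
      using prob_contains_copy[OF simple_graph_edge_set[OF G] Gne m0 c(1) max_density_le_imp_sparse[OF G md]]
      unfolding p_def by blast
    have le: "measure_pmf.prob (gnp n (p n)) {\<Gamma>. \<exists>A\<subseteq>edges \<Gamma>. copy (edges G) A}
        \<le> measure_pmf.prob (gnp n (p n)) {G. ramsey_for G [H1, H2]}" for n
    proof (rule prob_mono_support)
      fix \<Gamma> assume \<Gamma>: "\<Gamma> \<in> set_pmf (gnp n (p n))" "\<Gamma> \<in> {\<Gamma>. \<exists>A\<subseteq>edges \<Gamma>. copy (edges G) A}"
      then obtain A where A: "A \<subseteq> edges \<Gamma>" "copy (edges G) A" by auto
      have "arrows (edges \<Gamma>) (edges H1) (edges H2)" by (rule arrows_mono[OF arrows_copy[OF ar A(2)] A(1)])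
      hence "ramsey_for \<Gamma> [H1, H2]" by (rule arrows_imp_ramsey[OF gnp_support(3)[OF \<Gamma>(1)] _ V])
      thus "\<Gamma> \<in> {G. ramsey_for G [H1, H2]}" by simp
    qed
    have "\<forall>\<^sub>F n in sequentially. measure_pmf.prob (gnp n (p n)) {G. ramsey_for G [H1, H2]} < \<delta>"
      using lim d(1) by (rule order_tendstoD)
    with d(2) have "\<forall>\<^sub>F n in sequentially. False"
    proof eventually_elim
      case (elim n)
      thus ?case using le[of n] by linarith
    qed
    thus False by simp
  qed
qed

text \<open>The mixed 2-density depends on its second argument only through m2, so
  \<open>Hs ! 1\<close> can be replaced by a strictly balanced subgraph K2 of equal 2-density before
  a subgraph K1 of \<open>Hs ! 0\<close> is balanced with respect to K2. For equal 2-densities K1 is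
  strictly 2-balanced instead.\<close>

lemma zero_statement_of_deterministic:
  fixes Hs :: "nat graph list"
  assumes det: "\<And>(H1 :: nat graph) (H2 :: nat graph) (G :: nat graph). simple_graph H1 \<Longrightarrow> simple_graph H2 \<Longrightarrow> strictly_balanced_pair H1 H2 \<Longrightarrow>
      m2 H2 \<le> m2 H1 \<Longrightarrow> 1 < m2 H2 \<Longrightarrow> simple_graph G \<Longrightarrow> ramsey_for G [H1, H2] \<Longrightarrow> mixed_m2 H1 H2 < max_density G"
    and r: "2 \<le> r" "length Hs = r" and Hs: "\<forall>i<r. simple_graph (Hs ! i) \<and> edges (Hs ! i) \<noteq> {}"
    and dec: "\<forall>i j. i \<le> j \<and> j < r \<longrightarrow> m2 (Hs ! j) \<le> m2 (Hs ! i)" and x1: "1 < m2 (Hs ! 1)"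
  shows "\<exists>c::real. c > 0 \<and> (\<forall>p :: nat \<Rightarrow> real.
     (\<forall>n. 0 \<le> p n \<and> p n \<le> 1) \<and> (\<forall>n\<ge>1. p n \<le> c * real n powr (- 1 / mixed_m2 (Hs ! 0) (Hs ! 1))) \<longrightarrow>
     (\<lambda>n. measure_pmf.prob (gnp n (p n)) {G. ramsey_for G Hs}) \<longlonglongrightarrow> 0)"
proof -
  let ?H1 = "Hs ! 0"
  let ?H2 = "Hs ! 1"
  define x where "x = m2 ?H2"
  have x: "1 < x" unfolding x_def by fact
  define m where "m = mixed_m2 ?H1 ?H2"
  have sH: "simple_graph ?H1" "simple_graph ?H2" using Hs r by auto
  have le: "x \<le> m2 ?H1" unfolding x_def using dec[rule_format, of 0 1] r by simp
  have len: "2 \<le> length Hs" using r by simp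
  have Hs': "simple_graph (Hs ! i) \<and> edges (Hs ! i) \<noteq> {}" if "i < length Hs" for i using Hs r that by simp
  obtain K2 where K2: "subgraph K2 ?H2" "strictly_2_balanced K2" "m2 K2 = x"
    using strictly_2_balanced_subgraph[OF sH(2) x1] unfolding x_def by auto
  have sK2: "simple_graph K2" and E2: "edges K2 \<subseteq> edges ?H2" using K2(1) unfolding subgraph_def by auto
  have x2: "1 < m2 K2" using K2(3) x by simp
  note b2 = strictly_2_balanced_imp_balanced[OF sK2 K2(2) x2, unfolded K2(3)]
  have mK2: "mixed_m2 H K2 = mixed_m2 H ?H2" for H :: "nat graph" by (rule mixed_cong) (use K2(3) x_def in simp)
  show ?thesis
  proof (cases "m2 ?H1 = x")
    case True
    have mx: "mixed_m2 ?H1 ?H2 = x" unfolding x_def by (rule mixed_eq_m2[OF sH(1) x1]) (use True x_def in simp)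
    obtain K1 where K1: "subgraph K1 ?H1" "strictly_2_balanced K1" "m2 K1 = x"
      using strictly_2_balanced_subgraph[OF sH(1)] True x by auto
    have sK1: "simple_graph K1" and E1: "edges K1 \<subseteq> edges ?H1" using K1(1) unfolding subgraph_def by auto
    have x1': "1 < m2 K1" using K1(3) x by simp
    note b1 = strictly_2_balanced_imp_balanced[OF sK1 K1(2) x1', unfolded K1(3)]
    have cb: "\<exists>\<epsilon>>0. \<epsilon> \<le> 1 \<and> balanced x (2 - 1 / x) \<epsilon> (edges K1) \<and> balanced x (2 - 1 / x) \<epsilon> (edges K2)"
      by (rule common_balanced[OF b1(2) b2(2)])
    then obtain \<epsilon> where eps: "0 < \<epsilon>" "balanced x (2 - 1 / x) \<epsilon> (edges K1)" "balanced x (2 - 1 / x) \<epsilon> (edges K2)" by auto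
    show ?thesis unfolding mx
    proof (rule zero_statement[OF cb x order_refl _ len Hs' E1 E2])
      fix L :: "nat set set" assume L: "edge_set L" "arrows L (edges K1) (edges K2)"
      show "\<exists>J\<subseteq>L. x * real (card (\<Union>J)) < real (card J)"
      proof (rule ccontr)
        assume "\<not> ?thesis"
        hence "real (card J) \<le> x * real (card (\<Union>J))" if "J \<subseteq> L" for J using that by (simp add: not_less)
        from equal_density_not_arrows[OF eps(2,3) refl x eps(1) L(1) this] L(2) show False by simp
      qed
    qed
  next
    case False
    hence lt: "m2 K2 < m2 ?H1" using le K2(3) by simp
    obtain K1 where K1: "subgraph K1 ?H1" "strictly_mixed_balanced K1 K2" "mixed_m2 K1 K2 = mixed_m2 ?H1 K2" "m2 K2 \<le> m2 K1"
      using strictly_mixed_balanced_subgraph[OF sH(1) x2 lt] by blast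
    have sK1: "simple_graph K1" and E1: "edges K1 \<subseteq> edges ?H1" using K1(1) unfolding subgraph_def by auto
    have mm: "mixed_m2 K1 K2 = m" unfolding m_def by (rule trans[OF K1(3) mK2])
    note b1 = strictly_mixed_balanced_imp_balanced[OF sK1 K1(2,4) x2, unfolded mm K2(3)]
    have xm: "x \<le> m" using b1(2) by simp
    have cb: "\<exists>\<epsilon>>0. \<epsilon> \<le> 1 \<and> balanced m (2 - 1 / x) \<epsilon> (edges K1) \<and> balanced x (2 - 1 / x) \<epsilon> (edges K2)"
      by (rule common_balanced[OF b1(3) b2(2)])
    show ?thesis unfolding m_def[symmetric]
    proof (rule zero_statement[OF cb x xm _ len Hs' E1 E2])
      fix L :: "nat set set" assume L: "edge_set L" "arrows L (edges K1) (edges K2)"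
      let ?G = "Graph (\<Union>L) L"
      have sG: "simple_graph ?G" by (rule simple_graph_of_edges[OF L(1)])
      have ram: "ramsey_for ?G [K1, K2]" by (rule arrows_imp_ramsey[OF sG _ b1(1) b2(1)]) (use L(2) in simp)
      have "strictly_balanced_pair K1 K2" unfolding strictly_balanced_pair_def using K1(2) K2(2) by simp
      from det[OF sK1 sK2 this K1(4) x2 sG ram] have "mixed_m2 K1 K2 < max_density ?G" .
      hence "m < max_density ?G" unfolding mm .
      thus "\<exists>J\<subseteq>L. m * real (card (\<Union>J)) < real (card J)"
        using max_density_gt_imp_dense[OF L(1)] xm x by simp
    qed
  qed
qed

theorem theorem1p3:
  shows "(\<forall>(r::nat) (Hs :: nat graph list).
            r \<ge> 2 \<and> length Hs = r \<and>
            (\<forall>i<r. simple_graph (Hs ! i) \<and> edges (Hs ! i) \<noteq> {}) \<and>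
            (\<forall>i j. i \<le> j \<and> j < r \<longrightarrow> m2 (Hs ! i) \<ge> m2 (Hs ! j)) \<and>
            m2 (Hs ! 1) > 1 \<longrightarrow>
            (\<exists>c::real. c > 0 \<and>
               (\<forall>p :: nat \<Rightarrow> real.
                  (\<forall>n. 0 \<le> p n \<and> p n \<le> 1) \<and>
                  (\<forall>n\<ge>1. p n \<le> c * real n powr (- 1 / mixed_m2 (Hs ! 0) (Hs ! 1))) \<longrightarrow>
                  (\<lambda>n. measure_pmf.prob (gnp n (p n)) {G. ramsey_for G Hs})
                    \<longlonglongrightarrow> 0)))
         \<longleftrightarrow>
         (\<forall>(H1 :: nat graph) (H2 :: nat graph).
            simple_graph H1 \<and> simple_graph H2 \<and> strictly_balanced_pair H1 H2 \<and>
            m2 H1 \<ge> m2 H2 \<and> m2 H2 > 1 \<longrightarrow>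
            (\<forall>G :: nat graph.
               simple_graph G \<and> ramsey_for G [H1, H2] \<longrightarrow> max_density G > mixed_m2 H1 H2))"
proof (rule iffI, goal_cases)
  case prob: 1
  show ?case
  proof (intro allI impI, elim conjE)
    fix H1 H2 G :: "nat graph"
    assume H: "simple_graph H1" "simple_graph H2" "strictly_balanced_pair H1 H2" "m2 H2 \<le> m2 H1" "1 < m2 H2"
      and G: "simple_graph G" "ramsey_for G [H1, H2]"
    have ne: "edges H1 \<noteq> {}" "edges H2 \<noteq> {}" using m2_attained(1)[OF H(1)] m2_attained(1)[OF H(2)] H(4,5) by auto
    have Hs: "\<forall>i<2. simple_graph ([H1, H2] ! i) \<and> edges ([H1, H2] ! i) \<noteq> {}"
      using H ne by (auto simp: less_2_cases_iff)
    have dec: "\<forall>i j. i \<le> j \<and> j < 2 \<longrightarrow> m2 ([H1, H2] ! i) \<ge> m2 ([H1, H2] ! j)"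
    proof (intro allI impI)
      fix i j :: nat assume "i \<le> j \<and> j < 2"
      hence "(i = 0 \<and> j = 0) \<or> (i = 0 \<and> j = 1) \<or> (i = 1 \<and> j = 1)" by auto
      thus "m2 ([H1, H2] ! i) \<ge> m2 ([H1, H2] ! j)" using H(4) by auto
    qed
    show "mixed_m2 H1 H2 < max_density G"
      by (rule max_density_ramsey_gt[OF H G])
        (use prob[rule_format, of 2 "[H1, H2]"] Hs dec H(5) in simp)
  qed
next
  case det: 2
  show ?case
  proof (intro allI impI, elim conjE)
    fix r :: nat and Hs :: "nat graph list"
    assume r: "2 \<le> r" "length Hs = r" "\<forall>i<r. simple_graph (Hs ! i) \<and> edges (Hs ! i) \<noteq> {}"
      "\<forall>i j. i \<le> j \<and> j < r \<longrightarrow> m2 (Hs ! j) \<le> m2 (Hs ! i)" "1 < m2 (Hs ! 1)"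
    show "\<exists>c>0. \<forall>p. (\<forall>n. 0 \<le> p n \<and> p n \<le> 1) \<and>
        (\<forall>n\<ge>1. p n \<le> c * real n powr (- 1 / mixed_m2 (Hs ! 0) (Hs ! 1))) \<longrightarrow>
        (\<lambda>n. measure_pmf.prob (gnp n (p n)) {G. ramsey_for G Hs}) \<longlonglongrightarrow> 0"
      by (rule zero_statement_of_deterministic[OF _ r]) (use det in blast)
  qed
qed

end
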